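(* Let $f:\mathbb{R}^n\to\mathbb{R}^n$ have bounded second derivatives, let $\Gamma,\sigma\in\mathbb{R}^{n\times n}$ be constant matrices with $\Gamma$ invertible and $\sigma\sigma^T=2k_B\Theta\,\Gamma$, and let $z(t)=(x(t),v(t))$, $0\le t\le T$, be the solution of the Langevin equation $$dx=v\,dt,\qquad dv=f(x)\,dt-\Gamma v\,dt+\sigma\,dW_t .$$ Then the stochastic velocity-Verlet (SVV) algorithm $$x_{k+1}=x_k+c_1v_k+c_2f(x_k)+\int_{t_k}^{t_{k+1}}\int_{t_k}^{t}e^{-\Gamma(t-s)}\sigma\,dW_s\,dt,$$ $$v_{k+1}=c_0v_k+c_1f(x_k)+\frac{c_2}{\Delta t}\big(f(x_{k+1})-f(x_k)\big)+\int_{t_k}^{t_{k+1}}e^{-\Gamma(t_{k+1}-s)}\sigma\,dW_s,$$ where $c_0=e^{-\Gamma\Delta t}$, $c_1=\Gamma^{-1}(I-e^{-\Gamma\Delta t})$ and $c_2=\int_0^{\Delta t}\Gamma^{-1}(I-e^{-\Gamma s})\,ds$, has strong order $2$.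
   Context: $W=(W^1,\dots,W^n)$ is a standard $n$-dimensional Brownian motion, $I$ is the $n\times n$ identity matrix, $e^{-\Gamma t}$ is a matrix exponential, $k_B$ is Boltzmann's constant and $\Theta$ is the temperature (a constant). The interval $[0,T]$ is discretized uniformly: $t_k=k\Delta t$, $k=0,\dots,n_T$, $n_T\Delta t=T$. The numerical solution $(x_k,v_k)$ starts from the same initial value as the exact solution and is driven by the same Brownian motion. Strong order: a discrete-time approximation $Y=Y^{\Delta t}$ of $X$ with uniform step size $\Delta t$ converges with (has) strong order $\gamma\in\{0.5,1,1.5,2,\dots\}$ at time $T>0$ if there are constants $C$ and $\Delta>0$ such that $$\mathbb{E}\Big(\sup_{0\le k\le n_T}|X(k\Delta t)-Y(k\Delta t)|\Big)\le C\,\Delta t^{\gamma}\quad\text{for all }0<\Delta t<\Delta .$$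
   Formalization: "Bounded second derivatives" is read as bounded first and second derivatives of f (with only second derivatives bounded the claim fails, e.g. f a smoothed -x|x|), and the initial value is assumed square integrable. *)

theory Defs
  imports "HOL-Probability.Probability"
begin

subsection \<open>Matrix exponential\<close>

text \<open>On \<open>real^'n^'n\<close> the type-class operations \<open>(*)\<close>, \<open>(^)\<close> act componentwise,
  so the power and exponential of the matrix algebra are introduced here.\<close>

primrec matrix_power :: "real^'n^'n \<Rightarrow> nat \<Rightarrow> real^'n^'n" where
  "matrix_power A 0 = mat 1"
| "matrix_power A (Suc k) = A ** matrix_power A k"

definition matrix_exp :: "real^'n^'n \<Rightarrow> real^'n^'n" where
  "matrix_exp A = (\<Sum>k. (1 / fact k) *\<^sub>R matrix_power A k)"


subsection \<open>Bounded derivatives up to order two\<close>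

text \<open>\<open>f\<close> is twice (Frechet) differentiable with bounded first and second derivatives. A bound
  on the second derivative alone would not give the global Lipschitz property that underlies
  existence of the solution and strong convergence of the explicit scheme: for a smoothed
  \<open>f x = - x * \<bar>x\<bar>\<close>, which has a bounded second derivative, the moments of the scheme diverge
  as the step size tends to 0.\<close>

definition bounded_derivatives2 ::
  "('a::real_normed_vector \<Rightarrow> 'b::real_normed_vector) \<Rightarrow> bool" where
  "bounded_derivatives2 f \<longleftrightarrow>
     (\<exists>(f' :: 'a \<Rightarrow> 'a \<Rightarrow>\<^sub>L 'b) (f'' :: 'a \<Rightarrow> 'a \<Rightarrow>\<^sub>L ('a \<Rightarrow>\<^sub>L 'b)).
        (\<forall>x. (f has_derivative blinfun_apply (f' x)) (at x)) \<and>
        (\<forall>x. (f' has_derivative blinfun_apply (f'' x)) (at x)) \<and>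
        bounded (range f') \<and> bounded (range f''))"


subsection \<open>Brownian motion\<close>

text \<open>Standard Brownian motion relative to a filtration \<open>F\<close>. Only times \<open>t \<ge> 0\<close> are relevant.\<close>

locale brownian_motion = prob_space M
  for M :: "'w measure" and F :: "real \<Rightarrow> 'w measure" and W :: "real \<Rightarrow> 'w \<Rightarrow> real^'n" +
  assumes filtration_subalgebra: "\<And>t. 0 \<le> t \<Longrightarrow> subalgebra M (F t)"
    and filtration_mono: "\<And>s t. 0 \<le> s \<Longrightarrow> s \<le> t \<Longrightarrow> sets (F s) \<subseteq> sets (F t)"
    and adapted: "\<And>t. 0 \<le> t \<Longrightarrow> W t \<in> borel_measurable (F t)"
    and start_0: "AE \<omega> in M. W 0 \<omega> = 0"
    and increment_indep_past: "\<And>s t. 0 \<le> s \<Longrightarrow> s < t \<Longrightarrow>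
          indep_set (sets (F s)) {(\<lambda>\<omega>. W t \<omega> - W s \<omega>) -` B \<inter> space M | B. B \<in> sets borel}"
    and increment_components_indep: "\<And>s t. 0 \<le> s \<Longrightarrow> s < t \<Longrightarrow>
          indep_vars (\<lambda>_. borel) (\<lambda>i \<omega>. W t \<omega> $ i - W s \<omega> $ i) (UNIV :: 'n set)"
    and increment_normal: "\<And>s t i. 0 \<le> s \<Longrightarrow> s < t \<Longrightarrow>
          distributed M lborel (\<lambda>\<omega>. W t \<omega> $ i - W s \<omega> $ i) (normal_density 0 (sqrt (t - s)))"
    and continuous_paths: "AE \<omega> in M. continuous_on {0..} (\<lambda>t. W t \<omega>)"


subsection \<open>The stochastic integral of a deterministic integrand\<close>

text \<open>Ito integral over \<open>{a..b}\<close> of a matrix-valued square-integrable deterministic \<open>G\<close>: the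
  \<open>L\<^sup>2\<close>-limit of the elementary integrals of step functions converging to \<open>G\<close> in \<open>L\<^sup>2\<close>.
  The integral is determined only almost surely, hence the relational form. A step function is
  given by its number \<open>m\<close> of pieces, its partition points \<open>p 0 \<le> \<dots> \<le> p m\<close> and its values \<open>A\<close>.\<close>

definition step_function :: "nat \<Rightarrow> (nat \<Rightarrow> real) \<Rightarrow> (nat \<Rightarrow> real^'m^'d) \<Rightarrow> real \<Rightarrow> real^'m^'d" where
  "step_function m p A s = (\<Sum>i<m. indicat_real {p i<..p (Suc i)} s *\<^sub>R A i)"

definition step_integral ::
  "(real \<Rightarrow> 'w \<Rightarrow> real^'m) \<Rightarrow> nat \<Rightarrow> (nat \<Rightarrow> real) \<Rightarrow> (nat \<Rightarrow> real^'m^'d) \<Rightarrow> 'w \<Rightarrow> real^'d" where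
  "step_integral W m p A \<omega> = (\<Sum>i<m. A i *v (W (p (Suc i)) \<omega> - W (p i) \<omega>))"

definition is_stochastic_integral ::
  "'w measure \<Rightarrow> (real \<Rightarrow> 'w \<Rightarrow> real^'m) \<Rightarrow> real \<Rightarrow> real \<Rightarrow> (real \<Rightarrow> real^'m^'d) \<Rightarrow> ('w \<Rightarrow> real^'d) \<Rightarrow> bool"
where
  "is_stochastic_integral M W a b G I \<longleftrightarrow>
     G \<in> borel_measurable borel \<and> I \<in> borel_measurable M \<and>
     (\<exists>m p A.
        (\<forall>j. p j 0 = a \<and> p j (m j) = b \<and> (\<forall>i < m j. p j i \<le> p j (Suc i))) \<and>
        (\<lambda>j. \<integral>\<^sup>+ s \<in> {a..b}. ennreal ((norm (G s - step_function (m j) (p j) (A j) s))\<^sup>2) \<partial>lborel)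
          \<longlonglongrightarrow> 0 \<and>
        (\<lambda>j. \<integral>\<^sup>+ \<omega>. ennreal ((norm (I \<omega> - step_integral W (m j) (p j) (A j) \<omega>))\<^sup>2) \<partial>M)
          \<longlonglongrightarrow> 0)"

text \<open>A continuous version of the process \<open>t \<mapsto> \<integral>\<^sub>a\<^sup>t G t s dW\<^sub>s\<close>, \<open>a \<le> t \<le> b\<close>; continuity makes
  the pathwise time integral of this process well defined up to a null set.\<close>

definition is_stochastic_integral_process ::
  "'w measure \<Rightarrow> (real \<Rightarrow> 'w \<Rightarrow> real^'m) \<Rightarrow> real \<Rightarrow> real \<Rightarrow> (real \<Rightarrow> real \<Rightarrow> real^'m^'d)
    \<Rightarrow> (real \<Rightarrow> 'w \<Rightarrow> real^'d) \<Rightarrow> bool" where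
  "is_stochastic_integral_process M W a b G J \<longleftrightarrow>
     (\<forall>t\<in>{a..b}. is_stochastic_integral M W a t (G t) (J t)) \<and>
     (AE \<omega> in M. continuous_on {a..b} (\<lambda>t. J t \<omega>))"


subsection \<open>The Langevin equation\<close>

text \<open>Integral form of the equation. As \<open>\<sigma>\<close> is constant, \<open>\<integral>\<^sub>0\<^sup>t \<sigma> dW\<^sub>s\<close> is the elementary integral
  \<open>\<sigma> *v (W t - W 0)\<close>.\<close>

definition langevin_solution ::
  "'w measure \<Rightarrow> (real \<Rightarrow> 'w measure) \<Rightarrow> (real \<Rightarrow> 'w \<Rightarrow> real^'n) \<Rightarrow> real
    \<Rightarrow> (real^'n \<Rightarrow> real^'n) \<Rightarrow> real^'n^'n \<Rightarrow> real^'n^'n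
    \<Rightarrow> (real \<Rightarrow> 'w \<Rightarrow> real^'n) \<Rightarrow> (real \<Rightarrow> 'w \<Rightarrow> real^'n) \<Rightarrow> bool" where
  "langevin_solution M F W T f \<Gamma> \<sigma> x v \<longleftrightarrow>
     (\<forall>t\<in>{0..T}. x t \<in> borel_measurable (F t) \<and> v t \<in> borel_measurable (F t)) \<and>
     (AE \<omega> in M.
        continuous_on {0..T} (\<lambda>t. x t \<omega>) \<and> continuous_on {0..T} (\<lambda>t. v t \<omega>) \<and>
        (\<forall>t\<in>{0..T}.
           x t \<omega> = x 0 \<omega> + integral {0..t} (\<lambda>s. v s \<omega>) \<and>
           v t \<omega> = v 0 \<omega> + integral {0..t} (\<lambda>s. f (x s \<omega>)) - integral {0..t} (\<lambda>s. \<Gamma> *v v s \<omega>)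
                  + \<sigma> *v (W t \<omega> - W 0 \<omega>)))"


subsection \<open>The stochastic velocity-Verlet algorithm\<close>

definition svv_c0 :: "real^'n^'n \<Rightarrow> real \<Rightarrow> real^'n^'n" where
  "svv_c0 \<Gamma> h = matrix_exp (- (h *\<^sub>R \<Gamma>))"

definition svv_c1 :: "real^'n^'n \<Rightarrow> real \<Rightarrow> real^'n^'n" where
  "svv_c1 \<Gamma> h = matrix_inv \<Gamma> ** (mat 1 - matrix_exp (- (h *\<^sub>R \<Gamma>)))"

definition svv_c2 :: "real^'n^'n \<Rightarrow> real \<Rightarrow> real^'n^'n" where
  "svv_c2 \<Gamma> h = integral {0..h} (\<lambda>s. matrix_inv \<Gamma> ** (mat 1 - matrix_exp (- (s *\<^sub>R \<Gamma>))))"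

text \<open>\<open>(X k, V k)\<close>, \<open>k \<le> N\<close>, is the output of the algorithm with step size \<open>h\<close>, driven by \<open>W\<close> and
  started at \<open>(x\<^sub>0, v\<^sub>0)\<close>. In each step, \<open>J\<close> and \<open>K\<close> are the two stochastic integrals over the
  current time interval; different choices of their versions change \<open>(X, V)\<close> only on null sets.\<close>

definition svv_algorithm ::
  "'w measure \<Rightarrow> (real \<Rightarrow> 'w \<Rightarrow> real^'n) \<Rightarrow> (real^'n \<Rightarrow> real^'n) \<Rightarrow> real^'n^'n \<Rightarrow> real^'n^'n
    \<Rightarrow> ('w \<Rightarrow> real^'n) \<Rightarrow> ('w \<Rightarrow> real^'n) \<Rightarrow> real \<Rightarrow> nat
    \<Rightarrow> (nat \<Rightarrow> 'w \<Rightarrow> real^'n) \<Rightarrow> (nat \<Rightarrow> 'w \<Rightarrow> real^'n) \<Rightarrow> bool" where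
  "svv_algorithm M W f \<Gamma> \<sigma> x\<^sub>0 v\<^sub>0 h N X V \<longleftrightarrow>
     (\<forall>k\<le>N. X k \<in> borel_measurable M \<and> V k \<in> borel_measurable M) \<and>
     (AE \<omega> in M. X 0 \<omega> = x\<^sub>0 \<omega> \<and> V 0 \<omega> = v\<^sub>0 \<omega>) \<and>
     (\<forall>k<N. let a = real k * h; b = real (Suc k) * h in
        \<exists>J K.
          is_stochastic_integral_process M W a b
            (\<lambda>t s. matrix_exp (- ((t - s) *\<^sub>R \<Gamma>)) ** \<sigma>) J \<and>
          is_stochastic_integral M W a b (\<lambda>s. matrix_exp (- ((b - s) *\<^sub>R \<Gamma>)) ** \<sigma>) K \<and>
          (AE \<omega> in M.
             X (Suc k) \<omega> = X k \<omega> + svv_c1 \<Gamma> h *v V k \<omega> + svv_c2 \<Gamma> h *v f (X k \<omega>)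
                           + integral {a..b} (\<lambda>t. J t \<omega>) \<and>
             V (Suc k) \<omega> = svv_c0 \<Gamma> h *v V k \<omega> + svv_c1 \<Gamma> h *v f (X k \<omega>)
                           + ((1 / h) *\<^sub>R svv_c2 \<Gamma> h) *v (f (X (Suc k) \<omega>) - f (X k \<omega>))
                           + K \<omega>))"


subsection \<open>Strong order of convergence\<close>

text \<open>\<open>Y h k\<close> is the approximation with uniform step size \<open>h\<close> at the \<open>k\<close>-th grid point; the
  admissible step sizes are \<open>h = T / N\<close>. The expectation is a nonnegative integral, so the
  inequality includes its finiteness.\<close>

definition strong_order ::
  "'w measure \<Rightarrow> real \<Rightarrow> (real \<Rightarrow> 'w \<Rightarrow> 'a::real_normed_vector)
    \<Rightarrow> (real \<Rightarrow> nat \<Rightarrow> 'w \<Rightarrow> 'a) \<Rightarrow> real \<Rightarrow> bool" where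
  "strong_order M T X Y \<gamma> \<longleftrightarrow>
     (\<exists>C \<Delta>. \<Delta> > 0 \<and>
        (\<forall>h N. 0 < h \<and> h < \<Delta> \<and> real N * h = T \<longrightarrow>
           (\<integral>\<^sup>+ \<omega>. ennreal (MAX k\<in>{..N}. norm (X (real k * h) \<omega> - Y h k \<omega>)) \<partial>M)
             \<le> ennreal (C * h powr \<gamma>)))"

end

theory Submission
  imports Defs
begin

text \<open>
  Why the order is two. Over one step \<open>[a, b]\<close> with \<open>b = a + h\<close>, variation of constants writes the exact
  solution with the same coefficients \<open>c\<^sub>0, c\<^sub>1\<close> and with the same two Gaussian terms as the scheme
  (\<open>variation_of_constants_velocity\<close>, \<open>variation_of_constants_position\<close>). These Gaussian terms
  cancel exactly, and the scheme differs from the solution only in its treatment of the force: the position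
  update freezes \<open>f (x s)\<close> at \<open>s = a\<close>, the velocity update replaces it by its linear interpolant, since
  \<open>c\<^sub>2 = \<integral>\<^sub>0\<^sup>h c\<^sub>1\<close> is also \<open>\<integral>\<^sub>a\<^sup>b (s - a) c\<^sub>0(b - s) ds\<close>.

  Freezing costs \<open>O(h\<^sup>3)\<close> in the position, because \<open>f (x s) - f (x a) = O(h)\<close> is integrated twice. In the
  velocity, after replacing \<open>c\<^sub>0\<close> by the identity, the error is that of the trapezoidal rule for
  \<open>s \<mapsto> f (x s)\<close>, whose derivative \<open>f' (x s) (v s)\<close> is as rough as \<open>W\<close>. The Peano kernel isolates
  the leading part \<open>f' (x a) \<sigma> U\<close> with \<open>U = \<integral>\<^sub>a\<^sup>b ((a + b)/2 - s) (W s - W a) ds\<close>, and the rest is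
  \<open>h\<^sup>2 \<integral>\<^sub>a\<^sup>b (1 + |x|\<^sup>2 + |v|\<^sup>2)\<close> up to a constant (\<open>velocity_local_error\<close>). The leading part is only of size
  \<open>h\<^bsup>5/2\<^esup>\<close>, but it is a martingale difference, so that \<open>T / h\<close> of these terms add up to
  \<open>(T / h)\<^bsup>1/2\<^esup> h\<^bsup>5/2\<^esup> = O(h\<^sup>2)\<close>, uniformly in time by Doob's inequality. The remainders add up to \<open>O(h\<^sup>2)\<close>
  times \<open>\<integral>\<^sub>0\<^sup>T (1 + |x|\<^sup>2 + |v|\<^sup>2)\<close>, which has finite expectation as soon as the initial data have second
  moments (\<open>integral_energy_le\<close>). A discrete Gronwall argument on each path carries the local errors to
  the global error (\<open>global_error\<close>).

  The one-step bounds and the propagation of errors are deterministic and hold for each path. Three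
  probabilistic facts complete the proof: the stochastic integrals of the scheme are almost surely equal
  to pathwise expressions, by the Ito isometry and summation by parts
  (\<open>stochastic_integral_eq_ou_velocity\<close>, \<open>integral_stochastic_integral_process_eq_ou_position\<close>); the
  maximal inequality for the leading noise (\<open>noise_maximal\<close>); and the first moment of
  \<open>\<integral>\<^sub>0\<^sup>T |W t - W 0|\<^sup>2 dt\<close> (\<open>integral_norm2_moment\<close>).
  Expectations of time integrals of \<open>W\<close> are always bounded through Riemann sums and Fatou's lemma, which
  avoids joint measurability and exchanges of expectation and time integral.
\<close>

section \<open>The matrix exponential and the coefficients of the scheme\<close>

lemma bounded_bilinear_matrix_matrix_mult:
  "bounded_bilinear ((**) :: real^'n^'m \<Rightarrow> real^'p^'n \<Rightarrow> real^'p^'m)"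
  unfolding bilinear_conv_bounded_bilinear[symmetric] bilinear_def
  by (auto intro!: linearI simp: matrix_add_ldistrib matrix_scalar_ac scalar_matrix_assoc
      matrix_matrix_mult_def vec_eq_iff sum.distrib sum_distrib_left algebra_simps)

lemma bounded_bilinear_matrix_vector_mult:
  "bounded_bilinear ((*v) :: real^'n^'m \<Rightarrow> real^'n \<Rightarrow> real^'m)"
  unfolding bilinear_conv_bounded_bilinear[symmetric] bilinear_def
  by (auto intro!: linearI simp: matrix_vector_mult_def vec_eq_iff sum.distrib sum_distrib_left algebra_simps)

interpretation mm: bounded_bilinear "(**) :: real^'n^'m \<Rightarrow> real^'p^'n \<Rightarrow> real^'p^'m"
  by (rule bounded_bilinear_matrix_matrix_mult)

interpretation mv: bounded_bilinear "(*v) :: real^'n^'m \<Rightarrow> real^'n \<Rightarrow> real^'m"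
  by (rule bounded_bilinear_matrix_vector_mult)

lemma matrix_power_scaleR: "matrix_power (t *\<^sub>R A) k = t ^ k *\<^sub>R matrix_power A k"
  by (induction k) (simp_all add: mm.scaleR_left mm.scaleR_right)

lemma matrix_power_commute: "A ** matrix_power A k = matrix_power A k ** A"
  by (induction k) (simp_all, metis matrix_mul_assoc)

lemma summable_matrix_exp_series:
  "summable (\<lambda>k. (1 / fact k) *\<^sub>R matrix_power (A :: real^'n^'n) k)"
proof -
  obtain K where "K \<ge> 0" and K: "norm (B ** C) \<le> norm B * norm C * K" for B C :: "real^'n^'n"
    using bounded_bilinear.nonneg_bounded[OF bounded_bilinear_matrix_matrix_mult] by blast
  have pow: "norm (matrix_power A k) \<le> norm (mat 1 :: real^'n^'n) * (norm A * K) ^ k" for k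
  proof (induction k)
    case (Suc k)
    have "norm (matrix_power A (Suc k)) \<le> norm A * norm (matrix_power A k) * K"
      using K by simp
    also have "\<dots> \<le> norm A * (norm (mat 1 :: real^'n^'n) * (norm A * K) ^ k) * K"
      using Suc \<open>K \<ge> 0\<close> by (intro mult_right_mono mult_left_mono) auto
    finally show ?case by (simp add: algebra_simps)
  qed simp
  have "summable (\<lambda>k. norm (mat 1 :: real^'n^'n) * ((norm A * K) ^ k /\<^sub>R fact k))"
    by (intro summable_mult summable_exp_generic)
  then show ?thesis
  proof (rule summable_comparison_test')
    show "norm ((1 / fact k) *\<^sub>R matrix_power A k)
      \<le> norm (mat 1 :: real^'n^'n) * ((norm A * K) ^ k /\<^sub>R fact k)" if "k \<ge> 0" for k
      using mult_left_mono[OF pow[of k], of "1 / fact k"] by (simp add: field_simps)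
  qed
qed

lemma matrix_exp_0: "matrix_exp 0 = (mat 1 :: real^'n^'n)"
proof -
  have "(1 / fact k) *\<^sub>R matrix_power (0 :: real^'n^'n) k = (if k = 0 then mat 1 else 0)" for k
    by (cases k) (simp_all add: mm.zero_left)
  then show ?thesis
    unfolding matrix_exp_def by (subst suminf_finite[of "{0::nat}"]) auto
qed

lemma matrix_exp_commute: "A ** matrix_exp (t *\<^sub>R A) = matrix_exp (t *\<^sub>R A) ** (A :: real^'n^'n)"
  unfolding matrix_exp_def
    bounded_linear.suminf[OF mm.bounded_linear_right summable_matrix_exp_series]
    bounded_linear.suminf[OF mm.bounded_linear_left summable_matrix_exp_series]
  by (simp add: mm.scaleR_left mm.scaleR_right matrix_power_scaleR matrix_power_commute)

text \<open>Every coordinate of \<open>t \<mapsto> matrix_exp (t *\<^sub>R A)\<close> is an everywhere convergent real power series,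
  which may be differentiated term by term.\<close>

lemma matrix_exp_has_vector_derivative:
  fixes A :: "real^'n^'n"
  shows "((\<lambda>t. matrix_exp (t *\<^sub>R A)) has_vector_derivative A ** matrix_exp (t *\<^sub>R A)) (at t)"
proof -
  have exp_inner: "(\<lambda>k. (matrix_power A k \<bullet> b / fact k) * s ^ k) sums (matrix_exp (s *\<^sub>R A) \<bullet> b)"
    for s b
    using bounded_linear.sums[OF bounded_linear_inner_left
        summable_sums[OF summable_matrix_exp_series[of "s *\<^sub>R A"]], of b]
    by (simp add: matrix_exp_def matrix_power_scaleR mult.commute)
  have D: "((\<lambda>s. matrix_exp (s *\<^sub>R A) \<bullet> b) has_real_derivative (A ** matrix_exp (t *\<^sub>R A)) \<bullet> b) (at t)" for b
  proof -
    let ?c = "\<lambda>k. matrix_power A k \<bullet> b / fact k"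
    have "((\<lambda>s. \<Sum>k. ?c k * s ^ k) has_real_derivative (\<Sum>k. diffs ?c k * t ^ k)) (at t)"
      by (rule termdiffs_strong_converges_everywhere) (rule sums_summable[OF exp_inner])
    moreover have "(\<lambda>k. diffs ?c k * t ^ k) sums ((A ** matrix_exp (t *\<^sub>R A)) \<bullet> b)"
    proof -
      have "(\<lambda>k. (A ** ((1 / fact k) *\<^sub>R matrix_power (t *\<^sub>R A) k)) \<bullet> b) sums
          ((A ** matrix_exp (t *\<^sub>R A)) \<bullet> b)"
        unfolding matrix_exp_def
        by (intro bounded_linear.sums[OF bounded_linear_inner_left]
            bounded_linear.sums[OF mm.bounded_linear_right] summable_sums summable_matrix_exp_series)
      moreover have "diffs ?c k * t ^ k = (A ** ((1 / fact k) *\<^sub>R matrix_power (t *\<^sub>R A) k)) \<bullet> b" for k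
        by (simp add: diffs_def matrix_power_scaleR mm.scaleR_right divide_simps)
      ultimately show ?thesis by simp
    qed
    ultimately show ?thesis
      using sums_unique[OF exp_inner, of _ b] by (simp add: sums_iff)
  qed
  show ?thesis
    unfolding has_vector_derivative_def
  proof (subst has_derivative_componentwise_within, rule)
    fix b :: "real^'n^'n"
    have "(\<lambda>s. (s *\<^sub>R (A ** matrix_exp (t *\<^sub>R A))) \<bullet> b) = (*) ((A ** matrix_exp (t *\<^sub>R A)) \<bullet> b)"
      by (simp add: fun_eq_iff)
    then show "((\<lambda>s. matrix_exp (s *\<^sub>R A) \<bullet> b) has_derivative
        (\<lambda>s. (s *\<^sub>R (A ** matrix_exp (t *\<^sub>R A))) \<bullet> b)) (at t)"
      using D[of b] by (simp add: has_field_derivative_def)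
  qed
qed

lemma matrix_inv_left: "invertible A \<Longrightarrow> matrix_inv A ** A = mat 1"
  unfolding invertible_def matrix_inv_def by (rule someI2_ex) auto

lemma svv_c0_0: "svv_c0 \<Gamma> 0 = mat 1"
  by (simp add: svv_c0_def matrix_exp_0)

lemma svv_c1_0: "svv_c1 \<Gamma> 0 = 0"
  by (simp add: svv_c1_def matrix_exp_0 mm.zero_right)

lemma svv_c0_commute: "\<Gamma> ** svv_c0 \<Gamma> t = svv_c0 \<Gamma> t ** \<Gamma>"
  using matrix_exp_commute[of "- \<Gamma>" t] by (simp add: svv_c0_def mm.minus_left mm.minus_right)

lemma svv_c0_has_vector_derivative:
  "(svv_c0 \<Gamma> has_vector_derivative - (\<Gamma> ** svv_c0 \<Gamma> t)) (at t within S)"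
  using matrix_exp_has_vector_derivative[of "- \<Gamma>" t]
  by (auto simp: svv_c0_def[abs_def] mm.minus_left intro: has_vector_derivative_at_within)

lemma svv_c1_has_vector_derivative:
  assumes "invertible \<Gamma>"
  shows "(svv_c1 \<Gamma> has_vector_derivative svv_c0 \<Gamma> t) (at t within S)"
proof -
  have "((\<lambda>t. matrix_inv \<Gamma> ** (mat 1 - svv_c0 \<Gamma> t)) has_vector_derivative
      matrix_inv \<Gamma> ** (0 - - (\<Gamma> ** svv_c0 \<Gamma> t))) (at t within S)"
    by (intro bounded_linear.has_vector_derivative[OF mm.bounded_linear_right]
        has_vector_derivative_diff has_vector_derivative_const svv_c0_has_vector_derivative)
  moreover have "matrix_inv \<Gamma> ** (\<Gamma> ** svv_c0 \<Gamma> t) = svv_c0 \<Gamma> t"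
    by (simp add: matrix_mul_assoc matrix_inv_left[OF assms])
  ultimately show ?thesis by (simp add: svv_c1_def[abs_def] svv_c0_def)
qed

lemma svv_c1_mult: "invertible \<Gamma> \<Longrightarrow> svv_c1 \<Gamma> t ** \<Gamma> = mat 1 - svv_c0 \<Gamma> t"
proof -
  assume "invertible \<Gamma>"
  have "svv_c1 \<Gamma> t ** \<Gamma> = matrix_inv \<Gamma> ** (\<Gamma> - svv_c0 \<Gamma> t ** \<Gamma>)"
    by (simp add: svv_c1_def svv_c0_def matrix_mul_assoc[symmetric] mm.diff_left)
  also have "\<dots> = matrix_inv \<Gamma> ** (\<Gamma> ** (mat 1 - svv_c0 \<Gamma> t))"
    by (simp add: svv_c0_commute[symmetric] mm.diff_right)
  finally show ?thesis
    by (simp add: matrix_mul_assoc matrix_inv_left[OF \<open>invertible \<Gamma>\<close>])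
qed

lemma has_vector_derivative_reversed:
  assumes "\<And>u. (g has_vector_derivative g' u) (at u)"
  shows "((\<lambda>s. g (t - s)) has_vector_derivative - g' (t - s)) (at s within S)"
proof -
  have "((\<lambda>s. t - s) has_vector_derivative - 1) (at s within S)"
    by (rule has_vector_derivative_eq_rhs, (rule derivative_intros)+) simp
  from vector_diff_chain_within[OF this has_vector_derivative_at_within[OF assms]]
  show ?thesis by (simp add: o_def)
qed

lemma svv_c0_reversed_derivative:
  "((\<lambda>s. svv_c0 \<Gamma> (t - s)) has_vector_derivative \<Gamma> ** svv_c0 \<Gamma> (t - s)) (at s within S)"
  by (rule has_vector_derivative_reversed[where g' = "\<lambda>u. - (\<Gamma> ** svv_c0 \<Gamma> u)", simplified])
    (rule svv_c0_has_vector_derivative)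

lemma svv_c1_reversed_derivative:
  assumes "invertible \<Gamma>"
  shows "((\<lambda>s. svv_c1 \<Gamma> (t - s)) has_vector_derivative - svv_c0 \<Gamma> (t - s)) (at s within S)"
  by (rule has_vector_derivative_reversed) (rule svv_c1_has_vector_derivative[OF assms])

lemma continuous_on_svv_c0 [continuous_intros]:
  assumes "continuous_on S g" shows "continuous_on S (\<lambda>s. svv_c0 \<Gamma> (g s))"
proof (rule continuous_on_compose2[OF _ assms])
  show "continuous_on UNIV (svv_c0 \<Gamma>)"
    unfolding continuous_on_eq_continuous_within
    by (blast intro: has_vector_derivative_continuous svv_c0_has_vector_derivative)
qed simp

lemma continuous_on_svv_c1 [continuous_intros]:
  assumes "invertible \<Gamma>" "continuous_on S g" shows "continuous_on S (\<lambda>s. svv_c1 \<Gamma> (g s))"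
proof (rule continuous_on_compose2[OF _ assms(2)])
  show "continuous_on UNIV (svv_c1 \<Gamma>)"
    unfolding continuous_on_eq_continuous_within
    by (blast intro: has_vector_derivative_continuous svv_c1_has_vector_derivative[OF assms(1)])
qed simp

lemmas continuous_on_matrix_vector_mult [continuous_intros] =
  bounded_bilinear.continuous_on[OF bounded_bilinear_matrix_vector_mult]

lemmas has_vector_derivative_matrix_vector_mult =
  bounded_bilinear.has_vector_derivative[OF bounded_bilinear_matrix_vector_mult]

text \<open>The group law \<open>e\<^bsup>-\<Gamma>(t-s)\<^esup> e\<^bsup>-\<Gamma>s\<^esup> = e\<^bsup>-\<Gamma>t\<^esup>\<close>: the left side has zero derivative in \<open>s\<close>.\<close>

lemma svv_c0_group: "svv_c0 \<Gamma> (t - s) ** svv_c0 \<Gamma> s = svv_c0 \<Gamma> t"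
proof -
  let ?F = "\<lambda>s. svv_c0 \<Gamma> (t - s) ** svv_c0 \<Gamma> s"
  have "(?F has_vector_derivative 0) (at s within UNIV)" for s
  proof -
    from bounded_bilinear.has_vector_derivative[OF bounded_bilinear_matrix_matrix_mult svv_c0_reversed_derivative
        svv_c0_has_vector_derivative[of \<Gamma> s UNIV]]
    have "(?F has_vector_derivative svv_c0 \<Gamma> (t - s) ** (- (\<Gamma> ** svv_c0 \<Gamma> s))
        + (\<Gamma> ** svv_c0 \<Gamma> (t - s)) ** svv_c0 \<Gamma> s) (at s)"
      by simp
    moreover have "(\<Gamma> ** svv_c0 \<Gamma> (t - s)) ** svv_c0 \<Gamma> s = svv_c0 \<Gamma> (t - s) ** (\<Gamma> ** svv_c0 \<Gamma> s)"
      by (metis svv_c0_commute matrix_mul_assoc)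
    ultimately show ?thesis by (simp add: mm.minus_right)
  qed
  then obtain c where "\<And>s. s \<in> UNIV \<Longrightarrow> ?F s = c"
    by (rule has_vector_derivative_zero_constant[OF convex_UNIV]) blast
  from this[of s] this[of 0] have "?F s = ?F 0" by simp
  then show ?thesis by (simp add: svv_c0_0)
qed

text \<open>The integral representations give the behaviour of the coefficients for small steps without any
  estimate of the exponential series.\<close>

lemma svv_c0_eq_integral:
  assumes "0 \<le> t"
  shows "svv_c0 \<Gamma> t - mat 1 = integral {0..t} (\<lambda>s. - (\<Gamma> ** svv_c0 \<Gamma> s))"
proof -
  have "((\<lambda>s. - (\<Gamma> ** svv_c0 \<Gamma> s)) has_integral svv_c0 \<Gamma> t - svv_c0 \<Gamma> 0) {0..t}"
    by (rule fundamental_theorem_of_calculus[OF assms svv_c0_has_vector_derivative])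
  then show ?thesis by (metis integral_unique svv_c0_0)
qed

lemma svv_c1_eq_integral:
  assumes "0 \<le> t" "invertible \<Gamma>"
  shows "svv_c1 \<Gamma> t = integral {0..t} (svv_c0 \<Gamma>)"
  using integral_unique[OF fundamental_theorem_of_calculus[OF assms(1) svv_c1_has_vector_derivative[OF assms(2)]]]
  by (simp add: svv_c1_0)

lemma svv_c2_eq_integral: "svv_c2 \<Gamma> t = integral {0..t} (svv_c1 \<Gamma>)"
  by (simp add: svv_c2_def svv_c1_def[abs_def])

lemma svv_coefficient_bounds:
  fixes \<Gamma> :: "real^'n^'n"
  assumes inv: "invertible \<Gamma>"
  obtains B where "B \<ge> 0"
    "\<And>t w. t \<in> {0..T} \<Longrightarrow> norm (svv_c0 \<Gamma> t *v w) \<le> B * norm w"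
    "\<And>t w. t \<in> {0..T} \<Longrightarrow> norm (svv_c0 \<Gamma> t *v w - w) \<le> B * t * norm w"
    "\<And>t w. t \<in> {0..T} \<Longrightarrow> norm (svv_c1 \<Gamma> t *v w) \<le> B * t * norm w"
    "\<And>t w. t \<in> {0..T} \<Longrightarrow> norm (svv_c2 \<Gamma> t *v w) \<le> B * t\<^sup>2 * norm w"
proof -
  obtain K where "K \<ge> 0" and K: "norm (A *v w) \<le> norm A * norm w * K" for A :: "real^'n^'n" and w
    using bounded_bilinear.nonneg_bounded[OF bounded_bilinear_matrix_vector_mult] by blast
  have cont: "continuous_on {0..T} (svv_c0 \<Gamma>)" "continuous_on {0..T} (\<lambda>s. \<Gamma> ** svv_c0 \<Gamma> s)"
    by (intro continuous_intros bounded_linear.continuous_on[OF mm.bounded_linear_right])+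
  obtain C where C: "\<forall>t\<in>{0..T}. norm (svv_c0 \<Gamma> t) \<le> C"
    using compact_imp_bounded[OF compact_continuous_image[OF cont(1) compact_Icc]]
    unfolding bounded_iff by blast
  obtain D where D: "\<forall>t\<in>{0..T}. norm (\<Gamma> ** svv_c0 \<Gamma> t) \<le> D"
    using compact_imp_bounded[OF compact_continuous_image[OF cont(2) compact_Icc]]
    unfolding bounded_iff by blast
  define E where "E = max 0 (max C D)"
  have E: "E \<ge> 0" "C \<le> E" "D \<le> E" by (auto simp: E_def)
  have c0: "norm (svv_c0 \<Gamma> t) \<le> E" if "t \<in> {0..T}" for t using C[rule_format, OF that] E(2) by simp
  have c0': "norm (svv_c0 \<Gamma> t - mat 1) \<le> E * t" if "t \<in> {0..T}" for t
  proof -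
    have "norm (integral {0..t} (\<lambda>s. - (\<Gamma> ** svv_c0 \<Gamma> s))) \<le> E * (t - 0)"
    proof (intro integral_bound)
      show "norm (- (\<Gamma> ** svv_c0 \<Gamma> s)) \<le> E" if "s \<in> {0..t}" for s
        using D[rule_format, of s] E(3) that \<open>t \<in> {0..T}\<close> by simp
    qed (use that in \<open>auto intro!: continuous_on_minus continuous_on_subset[OF cont(2)]\<close>)
    then show ?thesis using svv_c0_eq_integral[of t \<Gamma>] that by simp
  qed
  have c1: "norm (svv_c1 \<Gamma> t) \<le> E * t" if "t \<in> {0..T}" for t
  proof -
    have "norm (integral {0..t} (svv_c0 \<Gamma>)) \<le> E * (t - 0)"
      using that c0 by (intro integral_bound continuous_on_subset[OF cont(1)]) auto
    then show ?thesis using svv_c1_eq_integral[OF _ inv] that by auto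
  qed
  have c2: "norm (svv_c2 \<Gamma> t) \<le> E * t\<^sup>2" if "t \<in> {0..T}" for t
  proof -
    have "norm (integral {0..t} (svv_c1 \<Gamma>)) \<le> E * t * (t - 0)"
    proof (intro integral_bound)
      show "norm (svv_c1 \<Gamma> s) \<le> E * t" if "s \<in> {0..t}" for s
        using c1[of s] that \<open>t \<in> {0..T}\<close> mult_left_mono[of s t E] E(1) by auto
    qed (use that in \<open>auto intro!: continuous_intros inv\<close>)
    then show ?thesis by (simp add: svv_c2_eq_integral power2_eq_square algebra_simps)
  qed
  have bound: "norm (A *v w) \<le> K * E * r * norm w" if "norm A \<le> E * r" for A :: "real^'n^'n" and w r
  proof -
    have "norm A * norm w * K \<le> E * r * norm w * K"
      using that \<open>K \<ge> 0\<close> by (intro mult_right_mono) auto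
    then show ?thesis using K[of A w] by (simp add: algebra_simps)
  qed
  show ?thesis
  proof (rule that[of "K * E"])
    show "norm (svv_c0 \<Gamma> t *v w) \<le> K * E * norm w" if "t \<in> {0..T}" for t w
      using bound[of "svv_c0 \<Gamma> t" 1 w] c0[OF that] by simp
    show "norm (svv_c0 \<Gamma> t *v w - w) \<le> K * E * t * norm w" if "t \<in> {0..T}" for t w
      using bound[OF c0'[OF that], of w] by (simp add: mv.diff_left)
  qed (use bound c1 c2 \<open>K \<ge> 0\<close> E in auto)
qed

section \<open>Variation of constants\<close>

lemma integral_reversed:
  fixes g :: "real \<Rightarrow> 'a::euclidean_space"
  shows "integral {a..b} (\<lambda>s. g (b - s)) = integral {0..b - a} g"
proof -
  have "integral {a..b} (\<lambda>s. g (b - s)) = integral {a - b..0} (\<lambda>s. g (- s))"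
    using integral_shift_Icc_real[of "a - b" 0 "\<lambda>s. g (b - s)" b] by (simp add: o_def)
  also have "\<dots> = integral {0..b - a} g"
    using Henstock_Kurzweil_Integration.integral_reflect_real[of "b - a" 0 g] by simp
  finally show ?thesis .
qed

text \<open>The contribution of the noise to position and velocity on \<open>[a, t]\<close>: the solution of the linear
  equation \<open>dp = u dt, du = - \<Gamma> u dt + \<sigma> dw\<close> started at rest. Integrating by parts removes the stochastic
  integral, so that both are defined for every single continuous path \<open>w\<close>.\<close>

definition ou_position :: "real^'n^'n \<Rightarrow> real^'n^'n \<Rightarrow> (real \<Rightarrow> real^'n) \<Rightarrow> real \<Rightarrow> real \<Rightarrow> real^'n" where
  "ou_position \<Gamma> \<sigma> w a t = integral {a..t} (\<lambda>s. svv_c0 \<Gamma> (t - s) *v (\<sigma> *v (w s - w a)))"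

definition ou_velocity :: "real^'n^'n \<Rightarrow> real^'n^'n \<Rightarrow> (real \<Rightarrow> real^'n) \<Rightarrow> real \<Rightarrow> real \<Rightarrow> real^'n" where
  "ou_velocity \<Gamma> \<sigma> w a t = \<sigma> *v (w t - w a) - \<Gamma> *v ou_position \<Gamma> \<sigma> w a t"

lemma integral_matrix_vector_mult:
  fixes A :: "real^'n^'m"
  assumes "g integrable_on S"
  shows "integral S (\<lambda>s. A *v g s) = A *v integral S g"
  using integral_linear[OF assms matrix_vector_mul_bounded_linear, of A] by (simp add: o_def)

text \<open>By the group law the integral is \<open>e\<^bsup>-\<Gamma>t\<^esup> \<integral>\<^sub>a\<^sup>t e\<^bsup>\<Gamma>s\<^esup> \<sigma> (w s - w a) ds\<close>, a product
  to which the product rule applies.\<close>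

lemma ou_position_has_vector_derivative:
  assumes w: "continuous_on {a..b} w" and t: "t \<in> {a..b}"
  shows "(ou_position \<Gamma> \<sigma> w a has_vector_derivative ou_velocity \<Gamma> \<sigma> w a t) (at t within {a..b})"
proof -
  define g where "g s = svv_c0 \<Gamma> (- s) *v (\<sigma> *v (w s - w a))" for s
  have g: "continuous_on {a..b} g"
    unfolding g_def by (intro continuous_intros w)
  have eq: "ou_position \<Gamma> \<sigma> w a u = svv_c0 \<Gamma> u *v integral {a..u} g" if "u \<in> {a..b}" for u
  proof -
    have "svv_c0 \<Gamma> (u - s) = svv_c0 \<Gamma> u ** svv_c0 \<Gamma> (- s)" for s
      using svv_c0_group[of \<Gamma> "u - s" "- s"] by simp
    moreover have "g integrable_on {a..u}"
      using that by (intro integrable_continuous_real continuous_on_subset[OF g]) auto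
    ultimately show ?thesis
      unfolding ou_position_def
      by (simp add: integral_matrix_vector_mult[symmetric] g_def matrix_vector_mul_assoc[symmetric])
  qed
  have "((\<lambda>u. svv_c0 \<Gamma> u *v integral {a..u} g) has_vector_derivative
      svv_c0 \<Gamma> t *v g t + (- (\<Gamma> ** svv_c0 \<Gamma> t)) *v integral {a..t} g) (at t within {a..b})"
    by (intro has_vector_derivative_matrix_vector_mult svv_c0_has_vector_derivative
        integral_has_vector_derivative g t)
  moreover have "svv_c0 \<Gamma> t *v g t = \<sigma> *v (w t - w a)"
    using svv_c0_group[of \<Gamma> 0 "- t"]
    by (simp add: g_def matrix_vector_mul_assoc matrix_mul_assoc svv_c0_0)
  ultimately have "((\<lambda>u. svv_c0 \<Gamma> u *v integral {a..u} g) has_vector_derivative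
      ou_velocity \<Gamma> \<sigma> w a t) (at t within {a..b})"
    by (simp add: ou_velocity_def eq[OF t] mv.minus_left matrix_vector_mul_assoc[symmetric])
  then show ?thesis
    using eq by (rule has_vector_derivative_transform[OF t, rotated])
qed

lemma continuous_on_ou_velocity:
  assumes w: "continuous_on {a..b} w"
  shows "continuous_on {a..b} (ou_velocity \<Gamma> \<sigma> w a)"
proof -
  have "continuous_on {a..b} (ou_position \<Gamma> \<sigma> w a)"
    unfolding continuous_on_eq_continuous_within
    using has_vector_derivative_continuous[OF ou_position_has_vector_derivative[OF w]] by blast
  then show ?thesis
    unfolding ou_velocity_def by (intro continuous_intros w)
qed

lemma integral_ou_velocity:
  assumes w: "continuous_on {a..b} w" and "a \<le> b"
  shows "integral {a..b} (ou_velocity \<Gamma> \<sigma> w a) = ou_position \<Gamma> \<sigma> w a b"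
proof -
  have "(ou_velocity \<Gamma> \<sigma> w a has_integral ou_position \<Gamma> \<sigma> w a b - ou_position \<Gamma> \<sigma> w a a) {a..b}"
    by (intro fundamental_theorem_of_calculus \<open>a \<le> b\<close> ou_position_has_vector_derivative w)
  then show ?thesis by (simp add: integral_unique ou_position_def)
qed

context
  fixes \<Gamma> \<sigma> :: "real^'n^'n" and a b :: real and v F w :: "real \<Rightarrow> real^'n"
  assumes ab: "a \<le> b" and v: "continuous_on {a..b} v" and F: "continuous_on {a..b} F"
    and w: "continuous_on {a..b} w"
    and eq: "\<And>t. t \<in> {a..b} \<Longrightarrow> v t = v a + integral {a..t} F - integral {a..t} (\<lambda>s. \<Gamma> *v v s)
        + \<sigma> *v (w t - w a)"
begin

lemma velocity_minus_noise_derivative: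
  assumes t: "t \<in> {a..b}"
  shows "((\<lambda>t. v t - \<sigma> *v (w t - w a)) has_vector_derivative F t - \<Gamma> *v v t) (at t within {a..b})"
proof -
  have "((\<lambda>t. v a + integral {a..t} F - integral {a..t} (\<lambda>s. \<Gamma> *v v s)) has_vector_derivative
      0 + F t - \<Gamma> *v v t) (at t within {a..b})"
    by (intro derivative_intros integral_has_vector_derivative F t continuous_intros v)
  then have "((\<lambda>t. v a + integral {a..t} F - integral {a..t} (\<lambda>s. \<Gamma> *v v s)) has_vector_derivative
      F t - \<Gamma> *v v t) (at t within {a..b})" by simp
  then show ?thesis
    by (rule has_vector_derivative_transform[OF t, rotated]) (subst eq, simp_all)
qed

lemma variation_of_constants_velocity:
  "v b = svv_c0 \<Gamma> (b - a) *v v a + integral {a..b} (\<lambda>s. svv_c0 \<Gamma> (b - s) *v F s)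
    + ou_velocity \<Gamma> \<sigma> w a b"
proof -
  define g where "g s = \<sigma> *v (w s - w a)" for s
  have g: "continuous_on {a..b} g" unfolding g_def by (intro continuous_intros w)
  define y where "y s = v s - g s" for s
  have ftc: "((\<lambda>s. svv_c0 \<Gamma> (b - s) *v F s - \<Gamma> *v (svv_c0 \<Gamma> (b - s) *v g s)) has_integral
      svv_c0 \<Gamma> (b - b) *v y b - svv_c0 \<Gamma> (b - a) *v y a) {a..b}"
  proof (rule fundamental_theorem_of_calculus[OF ab])
    fix t assume t: "t \<in> {a..b}"
    have "((\<lambda>s. svv_c0 \<Gamma> (b - s) *v y s) has_vector_derivative
        svv_c0 \<Gamma> (b - t) *v (F t - \<Gamma> *v v t) + (\<Gamma> ** svv_c0 \<Gamma> (b - t)) *v y t) (at t within {a..b})"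
      unfolding y_def g_def
      by (intro has_vector_derivative_matrix_vector_mult svv_c0_reversed_derivative
          velocity_minus_noise_derivative t)
    moreover have "svv_c0 \<Gamma> (b - t) *v (\<Gamma> *v v t) = \<Gamma> *v (svv_c0 \<Gamma> (b - t) *v v t)"
      by (simp add: matrix_vector_mul_assoc svv_c0_commute)
    ultimately show "((\<lambda>s. svv_c0 \<Gamma> (b - s) *v y s) has_vector_derivative
        svv_c0 \<Gamma> (b - t) *v F t - \<Gamma> *v (svv_c0 \<Gamma> (b - t) *v g t)) (at t within {a..b})"
      by (simp add: mv.diff_right y_def matrix_vector_mul_assoc[symmetric])
  qed
  have int: "((\<lambda>s. svv_c0 \<Gamma> (b - s) *v F s - \<Gamma> *v (svv_c0 \<Gamma> (b - s) *v g s)) has_integral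
      integral {a..b} (\<lambda>s. svv_c0 \<Gamma> (b - s) *v F s)
      - integral {a..b} (\<lambda>s. \<Gamma> *v (svv_c0 \<Gamma> (b - s) *v g s))) {a..b}"
    by (intro has_integral_diff integrable_integral integrable_continuous_real continuous_intros F g)
  moreover have "integral {a..b} (\<lambda>s. \<Gamma> *v (svv_c0 \<Gamma> (b - s) *v g s)) = \<Gamma> *v ou_position \<Gamma> \<sigma> w a b"
    unfolding ou_position_def g_def[symmetric]
    by (intro integral_matrix_vector_mult integrable_continuous_real continuous_intros g)
  ultimately have "integral {a..b} (\<lambda>s. svv_c0 \<Gamma> (b - s) *v F s) - \<Gamma> *v ou_position \<Gamma> \<sigma> w a b
      = svv_c0 \<Gamma> (b - b) *v y b - svv_c0 \<Gamma> (b - a) *v y a"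
    using has_integral_unique[OF int ftc] by simp
  then show ?thesis
    by (simp add: y_def g_def svv_c0_0 ou_velocity_def algebra_simps)
qed

text \<open>The derivative of \<open>s \<mapsto> c\<^sub>1(b - s) (v s - \<sigma> (w s - w a))\<close> contains \<open>- v s\<close>, because
  \<open>c\<^sub>1' = c\<^sub>0\<close> and \<open>c\<^sub>1 \<Gamma> = I - c\<^sub>0\<close>; this gives the displacement without a double integral.\<close>

lemma variation_of_constants_position:
  assumes inv: "invertible \<Gamma>"
  shows "integral {a..b} v = svv_c1 \<Gamma> (b - a) *v v a + integral {a..b} (\<lambda>s. svv_c1 \<Gamma> (b - s) *v F s)
    + ou_position \<Gamma> \<sigma> w a b"
proof -
  define g where "g s = \<sigma> *v (w s - w a)" for s
  have g: "continuous_on {a..b} g" unfolding g_def by (intro continuous_intros w)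
  define y where "y s = v s - g s" for s
  have ftc: "((\<lambda>s. svv_c1 \<Gamma> (b - s) *v F s + svv_c0 \<Gamma> (b - s) *v g s - v s) has_integral
      svv_c1 \<Gamma> (b - b) *v y b - svv_c1 \<Gamma> (b - a) *v y a) {a..b}"
  proof (rule fundamental_theorem_of_calculus[OF ab])
    fix t assume t: "t \<in> {a..b}"
    have "((\<lambda>s. svv_c1 \<Gamma> (b - s) *v y s) has_vector_derivative
        svv_c1 \<Gamma> (b - t) *v (F t - \<Gamma> *v v t) + (- svv_c0 \<Gamma> (b - t)) *v y t) (at t within {a..b})"
      unfolding y_def g_def
      by (intro has_vector_derivative_matrix_vector_mult svv_c1_reversed_derivative inv
          velocity_minus_noise_derivative t)
    moreover have "svv_c1 \<Gamma> (b - t) *v (\<Gamma> *v v t) = v t - svv_c0 \<Gamma> (b - t) *v v t"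
      by (simp add: matrix_vector_mul_assoc svv_c1_mult[OF inv] mv.diff_left)
    ultimately show "((\<lambda>s. svv_c1 \<Gamma> (b - s) *v y s) has_vector_derivative
        svv_c1 \<Gamma> (b - t) *v F t + svv_c0 \<Gamma> (b - t) *v g t - v t) (at t within {a..b})"
      by (simp add: mv.diff_right mv.minus_left y_def algebra_simps)
  qed
  have int: "((\<lambda>s. svv_c1 \<Gamma> (b - s) *v F s + svv_c0 \<Gamma> (b - s) *v g s - v s) has_integral
      integral {a..b} (\<lambda>s. svv_c1 \<Gamma> (b - s) *v F s) + ou_position \<Gamma> \<sigma> w a b - integral {a..b} v) {a..b}"
    unfolding ou_position_def g_def[symmetric]
    by (intro has_integral_diff has_integral_add integrable_integral integrable_continuous_real
        continuous_intros F g v inv)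
  have "integral {a..b} (\<lambda>s. svv_c1 \<Gamma> (b - s) *v F s) + ou_position \<Gamma> \<sigma> w a b - integral {a..b} v
      = svv_c1 \<Gamma> (b - b) *v y b - svv_c1 \<Gamma> (b - a) *v y a"
    by (intro has_integral_unique[OF int ftc])
  then show ?thesis
    by (simp add: y_def g_def svv_c1_0 mv.zero_left algebra_simps)
qed

end

section \<open>Local errors\<close>

lemma norm_integral_le:
  fixes g :: "real \<Rightarrow> 'a::euclidean_space" and h :: "real \<Rightarrow> real"
  assumes "continuous_on {a..b} g" "continuous_on {a..b} h"
    "\<And>s. s \<in> {a..b} \<Longrightarrow> norm (g s) \<le> h s"
  shows "norm (integral {a..b} g) \<le> integral {a..b} h"
  by (rule Henstock_Kurzweil_Integration.integral_norm_bound_integral)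
    (use assms in \<open>auto intro: integrable_continuous_real\<close>)

lemma norm_integral_le_const:
  fixes g :: "real \<Rightarrow> 'a::euclidean_space"
  assumes "continuous_on {a..b} g" "a \<le> b" "\<And>s. s \<in> {a..b} \<Longrightarrow> norm (g s) \<le> c"
  shows "norm (integral {a..b} g) \<le> (b - a) * c"
  using norm_integral_le[of a b g "\<lambda>_. c"] assms by simp

text \<open>Cauchy--Schwarz, by expanding the integral of the squared deviation from the mean.\<close>

lemma integral_power2_le:
  fixes g :: "real \<Rightarrow> real"
  assumes g: "continuous_on {a..b} g" and ab: "a \<le> b"
  shows "(integral {a..b} g)\<^sup>2 \<le> (b - a) * integral {a..b} (\<lambda>s. (g s)\<^sup>2)"
proof (cases "a = b")
  case False
  define h where "h = b - a"
  have "h > 0" using False ab by (simp add: h_def)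
  define c where "c = integral {a..b} g / h"
  have int: "g integrable_on {a..b}" "(\<lambda>s. (g s)\<^sup>2) integrable_on {a..b}"
    by (intro integrable_continuous_real continuous_intros g)+
  have "((\<lambda>s. (g s - c)\<^sup>2) has_integral
      integral {a..b} (\<lambda>s. (g s)\<^sup>2) - (2 * c) * integral {a..b} g + h * c\<^sup>2) {a..b}"
  proof -
    have "((\<lambda>s. (g s)\<^sup>2 - (2 * c) * g s + c\<^sup>2) has_integral
      integral {a..b} (\<lambda>s. (g s)\<^sup>2) - (2 * c) * integral {a..b} g + h * c\<^sup>2) {a..b}"
      unfolding h_def using has_integral_const_real[of "c\<^sup>2" a b] ab
      by (intro has_integral_add has_integral_diff has_integral_mult_right integrable_integral int) auto
    then show ?thesis by (simp add: power2_eq_square algebra_simps)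
  qed
  then have "0 \<le> integral {a..b} (\<lambda>s. (g s)\<^sup>2) - (2 * c) * integral {a..b} g + h * c\<^sup>2"
    by (rule has_integral_nonneg) simp
  also have "\<dots> = integral {a..b} (\<lambda>s. (g s)\<^sup>2) - (integral {a..b} g)\<^sup>2 / h"
    using \<open>h > 0\<close> by (simp add: c_def power2_eq_square field_simps)
  finally show ?thesis using \<open>h > 0\<close> by (simp add: h_def field_simps)
qed simp

text \<open>Integration by parts; \<open>s \<mapsto> (a + b)/2 - s\<close> is the Peano kernel of the rule.\<close>

lemma trapezoidal_rule_error:
  fixes \<phi> :: "real \<Rightarrow> 'a::euclidean_space"
  assumes ab: "a \<le> b" and \<phi>: "continuous_on {a..b} \<phi>" and \<phi>': "continuous_on {a..b} \<phi>'"
    and deriv: "\<And>s. s \<in> {a..b} \<Longrightarrow> (\<phi> has_vector_derivative \<phi>' s) (at s within {a..b})"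
  shows "integral {a..b} \<phi> - ((b - a) / 2) *\<^sub>R (\<phi> a + \<phi> b)
    = integral {a..b} (\<lambda>s. ((a + b) / 2 - s) *\<^sub>R \<phi>' s)"
proof -
  have "((\<lambda>s. ((a + b) / 2 - s) *\<^sub>R \<phi>' s + (- 1) *\<^sub>R \<phi> s) has_integral
      ((a + b) / 2 - b) *\<^sub>R \<phi> b - ((a + b) / 2 - a) *\<^sub>R \<phi> a) {a..b}"
    by (rule fundamental_theorem_of_calculus[OF ab])
      (auto intro!: derivative_eq_intros deriv simp: has_real_derivative_iff_has_vector_derivative[symmetric])
  moreover have "((\<lambda>s. ((a + b) / 2 - s) *\<^sub>R \<phi>' s + (- 1) *\<^sub>R \<phi> s) has_integral
      integral {a..b} (\<lambda>s. ((a + b) / 2 - s) *\<^sub>R \<phi>' s) + (- 1) *\<^sub>R integral {a..b} \<phi>) {a..b}"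
    by (intro has_integral_add has_integral_cmul integrable_integral integrable_continuous_real
        continuous_intros \<phi> \<phi>')
  ultimately have *: "integral {a..b} (\<lambda>s. ((a + b) / 2 - s) *\<^sub>R \<phi>' s) + (- 1) *\<^sub>R integral {a..b} \<phi>
      = ((a + b) / 2 - b) *\<^sub>R \<phi> b - ((a + b) / 2 - a) *\<^sub>R \<phi> a"
    using has_integral_unique by blast
  have "((a + b) / 2 - b) *\<^sub>R \<phi> b - ((a + b) / 2 - a) *\<^sub>R \<phi> a = - (((b - a) / 2) *\<^sub>R (\<phi> a + \<phi> b))"
  proof -
    have "(a + b) / 2 - b = - ((b - a) / 2)" "(a + b) / 2 - a = (b - a) / 2"
      by (simp_all add: field_simps)
    then show ?thesis by (simp only: scaleR_add_right scaleR_minus_left) simp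
  qed
  moreover have "I + (- 1) *\<^sub>R P = - S \<Longrightarrow> P - S = I" for I P S :: 'a
    by (simp add: diff_eq_eq)
  ultimately show ?thesis using * by metis
qed

lemma integral_midpoint_kernel: 
  assumes "a \<le> b"
  shows "integral {a..b} (\<lambda>s. ((a + b) / 2 - s) *\<^sub>R (c :: 'a::euclidean_space)) = 0"
proof -
  have "((\<lambda>s. - ((a + b) / 2 - s)\<^sup>2 / 2) has_real_derivative (a + b) / 2 - t) (at t within {a..b})" for t
    by (auto intro!: derivative_eq_intros simp: field_simps)
  then have "((\<lambda>s. (- ((a + b) / 2 - s)\<^sup>2 / 2) *\<^sub>R c) has_vector_derivative ((a + b) / 2 - t) *\<^sub>R c)
      (at t within {a..b})" for t
    by (intro bounded_linear.has_vector_derivative[OF bounded_linear_scaleR_left])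
      (simp add: has_real_derivative_iff_has_vector_derivative)
  then
  have "((\<lambda>s. ((a + b) / 2 - s) *\<^sub>R c) has_integral
      (- ((a + b) / 2 - b)\<^sup>2 / 2) *\<^sub>R c - (- ((a + b) / 2 - a)\<^sup>2 / 2) *\<^sub>R c) {a..b}"
    by (intro fundamental_theorem_of_calculus[OF assms])
  moreover have "((a + b) / 2 - b)\<^sup>2 = ((a + b) / 2 - a)\<^sup>2"
    by (simp add: power2_eq_square field_simps)
  ultimately show ?thesis by (simp add: integral_unique)
qed

lemma svv_c1_mult_eq_integral:
  assumes inv: "invertible \<Gamma>" and ab: "a \<le> b"
  shows "svv_c1 \<Gamma> (b - a) *v z = integral {a..b} (\<lambda>s. svv_c0 \<Gamma> (b - s) *v z)"
proof -
  have "((\<lambda>s. - (svv_c0 \<Gamma> (b - s)) *v z) has_integral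
      svv_c1 \<Gamma> (b - b) *v z - svv_c1 \<Gamma> (b - a) *v z) {a..b}"
    by (intro fundamental_theorem_of_calculus ab svv_c1_reversed_derivative inv
        bounded_linear.has_vector_derivative[OF mv.bounded_linear_left])
  from has_integral_neg[OF this] show ?thesis
    by (simp add: svv_c1_0 mv.zero_left mv.minus_left integral_unique)
qed

lemma svv_c2_mult_eq_integral:
  assumes inv: "invertible \<Gamma>" and ab: "a \<le> b"
  shows "svv_c2 \<Gamma> (b - a) *v z = integral {a..b} (\<lambda>s. svv_c1 \<Gamma> (b - s) *v z)"
proof -
  have "svv_c1 \<Gamma> integrable_on {0..b - a}"
    using continuous_on_svv_c1[OF inv, of "{0..b-a}" "\<lambda>x. x"] 
    by (intro integrable_continuous_real) simp
  from integral_linear[OF this mv.bounded_linear_left, of z]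
  have "svv_c2 \<Gamma> (b - a) *v z = integral {0..b - a} (\<lambda>s. svv_c1 \<Gamma> s *v z)"
    by (simp add: svv_c2_eq_integral o_def)
  then show ?thesis using integral_reversed[of a b "\<lambda>s. svv_c1 \<Gamma> s *v z"] by simp
qed

text \<open>The coefficient \<open>c\<^sub>2/h\<close> integrates the linear interpolant of the force exactly.\<close>

lemma svv_c2_mult_eq_ramp_integral:
  assumes inv: "invertible \<Gamma>" and ab: "a \<le> b"
  shows "svv_c2 \<Gamma> (b - a) *v z = integral {a..b} (\<lambda>s. (s - a) *\<^sub>R (svv_c0 \<Gamma> (b - s) *v z))"
proof -
  have ftc: "((\<lambda>s. svv_c1 \<Gamma> (b - s) *v z - (s - a) *\<^sub>R (svv_c0 \<Gamma> (b - s) *v z)) has_integral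
      (b - a) *\<^sub>R (svv_c1 \<Gamma> (b - b) *v z) - (a - a) *\<^sub>R (svv_c1 \<Gamma> (b - a) *v z)) {a..b}"
  proof (rule fundamental_theorem_of_calculus[OF ab])
    fix t
    have "((\<lambda>s. svv_c1 \<Gamma> (b - s) *v z) has_vector_derivative - svv_c0 \<Gamma> (b - t) *v z) (at t within {a..b})"
      by (intro svv_c1_reversed_derivative inv
        bounded_linear.has_vector_derivative[OF mv.bounded_linear_left])
    then show "((\<lambda>s. (s - a) *\<^sub>R (svv_c1 \<Gamma> (b - s) *v z)) has_vector_derivative
        svv_c1 \<Gamma> (b - t) *v z - (t - a) *\<^sub>R (svv_c0 \<Gamma> (b - t) *v z)) (at t within {a..b})"
      by (auto intro!: derivative_eq_intros
          simp: has_real_derivative_iff_has_vector_derivative[symmetric] mv.minus_left)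
  qed
  have int: "((\<lambda>s. svv_c1 \<Gamma> (b - s) *v z - (s - a) *\<^sub>R (svv_c0 \<Gamma> (b - s) *v z)) has_integral
      integral {a..b} (\<lambda>s. svv_c1 \<Gamma> (b - s) *v z)
      - integral {a..b} (\<lambda>s. (s - a) *\<^sub>R (svv_c0 \<Gamma> (b - s) *v z))) {a..b}"
    by (intro has_integral_diff integrable_integral integrable_continuous_real continuous_intros inv)
  have "integral {a..b} (\<lambda>s. svv_c1 \<Gamma> (b - s) *v z)
      - integral {a..b} (\<lambda>s. (s - a) *\<^sub>R (svv_c0 \<Gamma> (b - s) *v z)) = 0"
    using has_integral_unique[OF int ftc] by (simp add: svv_c1_0 mv.zero_left)
  then show ?thesis by (simp add: svv_c2_mult_eq_integral[OF inv ab])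
qed

lemma integral_diff_diff:
  fixes g\<^sub>1 g\<^sub>2 g\<^sub>3 :: "real \<Rightarrow> 'a::euclidean_space"
  assumes "continuous_on {a..b} g\<^sub>1" "continuous_on {a..b} g\<^sub>2" "continuous_on {a..b} g\<^sub>3"
  shows "integral {a..b} g\<^sub>1 - integral {a..b} g\<^sub>2 - integral {a..b} g\<^sub>3
    = integral {a..b} (\<lambda>s. g\<^sub>1 s - g\<^sub>2 s - g\<^sub>3 s)"
  using assms
  by (simp add: Henstock_Kurzweil_Integration.integral_diff integrable_continuous_real continuous_on_diff)

text \<open>All constants are dominated by a single bound \<open>B\<close>, which keeps the final constant explicit.\<close>

locale langevin_coefficients =
  fixes f :: "real^'n \<Rightarrow> real^'n" and f' :: "real^'n \<Rightarrow> (real^'n) \<Rightarrow>\<^sub>L (real^'n)"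
    and \<Gamma> \<sigma> :: "real^'n^'n" and T B :: real
  assumes T_pos: "0 < T" and B_ge_1: "1 \<le> B" and invertible: "invertible \<Gamma>"
    and f_deriv: "\<And>y. (f has_derivative blinfun_apply (f' y)) (at y)"
    and f'_bound: "\<And>y. norm (f' y) \<le> B"
    and f'_lipschitz: "\<And>y z. norm (f' y - f' z) \<le> B * norm (y - z)"
    and f_0: "norm (f 0) \<le> B"
    and \<Gamma>_bound: "\<And>z. norm (\<Gamma> *v z) \<le> B * norm z"
    and \<sigma>_bound: "\<And>z. norm (\<sigma> *v z) \<le> B * norm z"
    and c0_bound: "\<And>t z. t \<in> {0..T} \<Longrightarrow> norm (svv_c0 \<Gamma> t *v z) \<le> B * norm z"
    and c0_minus_id_bound: "\<And>t z. t \<in> {0..T} \<Longrightarrow> norm (svv_c0 \<Gamma> t *v z - z) \<le> B * t * norm z"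
    and c1_bound: "\<And>t z. t \<in> {0..T} \<Longrightarrow> norm (svv_c1 \<Gamma> t *v z) \<le> B * t * norm z"
    and c2_bound: "\<And>t z. t \<in> {0..T} \<Longrightarrow> norm (svv_c2 \<Gamma> t *v z) \<le> B * t\<^sup>2 * norm z"
begin

lemma B_nonneg: "0 \<le> B" using B_ge_1 by simp

lemma f_lipschitz: "norm (f y - f z) \<le> B * norm (y - z)"
  by (rule differentiable_bound[of UNIV]) (auto intro: f_deriv simp: norm_blinfun.rep_eq[symmetric] f'_bound)

lemma f_growth: "norm (f y) \<le> B * (1 + norm y)"
proof -
  have "norm (f y) \<le> norm (f y - f 0) + norm (f 0)" by norm
  then show ?thesis using f_lipschitz[of y 0] f_0 by (simp add: algebra_simps)
qed

lemma f'_apply_bound: "norm (f' y z) \<le> B * norm z"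
  using norm_blinfun[of "f' y" z] mult_right_mono[OF f'_bound[of y], of "norm z"] by simp

lemma f'_apply_lipschitz: "norm (f' y u - f' z u) \<le> B * norm (y - z) * norm u"
  using norm_blinfun[of "f' y - f' z" u] mult_right_mono[OF f'_lipschitz[of y z], of "norm u"]
  by (simp add: blinfun.diff_left)

lemma continuous_f': "continuous_on UNIV f'"
proof -
  have "B-lipschitz_on UNIV f'"
    by (rule lipschitz_onI) (auto simp: dist_norm f'_lipschitz B_nonneg)
  then show ?thesis by (rule lipschitz_on_continuous_on)
qed

lemma continuous_f: "continuous_on UNIV f"
  by (rule has_derivative_continuous_on) (rule f_deriv)

text \<open>One step of the scheme, with the noise as an argument.\<close>

definition position_step :: "real \<Rightarrow> real^'n \<Rightarrow> real^'n \<Rightarrow> real^'n \<Rightarrow> real^'n" where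
  "position_step h X V p = X + svv_c1 \<Gamma> h *v V + svv_c2 \<Gamma> h *v f X + p"

definition velocity_step :: "real \<Rightarrow> real^'n \<Rightarrow> real^'n \<Rightarrow> real^'n \<Rightarrow> real^'n \<Rightarrow> real^'n" where
  "velocity_step h X X' V u = svv_c0 \<Gamma> h *v V + svv_c1 \<Gamma> h *v f X
     + ((1 / h) *\<^sub>R svv_c2 \<Gamma> h) *v (f X' - f X) + u"

end

text \<open>The noise enters the velocity error through the Peano kernel of the trapezoidal rule.\<close>

definition midpoint_moment :: "(real \<Rightarrow> real^'n) \<Rightarrow> real \<Rightarrow> real \<Rightarrow> real^'n" where
  "midpoint_moment w a b = integral {a..b} (\<lambda>s. ((a + b) / 2 - s) *\<^sub>R (w s - w a))"

locale langevin_path = langevin_coefficients f f' \<Gamma> \<sigma> T B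
  for f :: "real^'n \<Rightarrow> real^'n" and f' \<Gamma> \<sigma> T B +
  fixes x v w :: "real \<Rightarrow> real^'n"
  assumes cont_x: "continuous_on {0..T} x" and cont_v: "continuous_on {0..T} v"
    and cont_w: "continuous_on {0..T} w"
    and x_eq: "\<And>t. t \<in> {0..T} \<Longrightarrow> x t = x 0 + integral {0..t} v"
    and v_eq: "\<And>t. t \<in> {0..T} \<Longrightarrow> v t = v 0 + integral {0..t} (\<lambda>s. f (x s))
        - integral {0..t} (\<lambda>s. \<Gamma> *v v s) + \<sigma> *v (w t - w 0)"
begin

lemma continuous_on_subinterval:
  assumes "0 \<le> a" "b \<le> T"
  shows "continuous_on {a..b} x" "continuous_on {a..b} v" "continuous_on {a..b} w"
    "continuous_on {a..b} (\<lambda>s. f (x s))"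
proof -
  have sub: "{a..b} \<subseteq> {0..T}" using assms by auto
  show "continuous_on {a..b} x" "continuous_on {a..b} v" "continuous_on {a..b} w"
    using cont_x cont_v cont_w continuous_on_subset[OF _ sub] by blast+
  then show "continuous_on {a..b} (\<lambda>s. f (x s))"
    by (intro continuous_on_compose2[OF continuous_f]) auto
qed

lemma x_eq_from:
  assumes "0 \<le> a" "a \<le> t" "t \<le> T"
  shows "x t = x a + integral {a..t} v"
proof -
  have "v integrable_on {0..t}"
    using continuous_on_subinterval[of 0 t] assms by (intro integrable_continuous_real) auto
  from Henstock_Kurzweil_Integration.integral_combine[OF assms(1,2) this]
  show ?thesis using x_eq[of t] x_eq[of a] assms by (simp add: algebra_simps)
qed

lemma v_eq_from:
  assumes "0 \<le> a" "a \<le> t" "t \<le> T"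
  shows "v t = v a + integral {a..t} (\<lambda>s. f (x s)) - integral {a..t} (\<lambda>s. \<Gamma> *v v s) + \<sigma> *v (w t - w a)"
proof -
  have int: "(\<lambda>s. f (x s)) integrable_on {0..t}" "(\<lambda>s. \<Gamma> *v v s) integrable_on {0..t}"
    using continuous_on_subinterval[of 0 t] assms by (auto intro!: integrable_continuous_real continuous_intros)
  have "integral {0..t} (\<lambda>s. f (x s)) = integral {0..a} (\<lambda>s. f (x s)) + integral {a..t} (\<lambda>s. f (x s))"
    "integral {0..t} (\<lambda>s. \<Gamma> *v v s) = integral {0..a} (\<lambda>s. \<Gamma> *v v s) + integral {a..t} (\<lambda>s. \<Gamma> *v v s)"
    using Henstock_Kurzweil_Integration.integral_combine[OF assms(1,2) int(1)]
      Henstock_Kurzweil_Integration.integral_combine[OF assms(1,2) int(2)] by auto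
  then have "v t - v a = integral {a..t} (\<lambda>s. f (x s)) - integral {a..t} (\<lambda>s. \<Gamma> *v v s)
      + (\<sigma> *v (w t - w 0) - \<sigma> *v (w a - w 0))"
    using v_eq[of t] v_eq[of a] assms by simp
  also have "\<sigma> *v (w t - w 0) - \<sigma> *v (w a - w 0) = \<sigma> *v (w t - w a)"
    by (simp add: mv.diff_right[symmetric])
  finally show ?thesis by (simp add: algebra_simps)
qed

definition energy :: "real \<Rightarrow> real" where "energy s = 1 + (norm (x s))\<^sup>2 + (norm (v s))\<^sup>2"

lemma cont_energy: "0 \<le> a \<Longrightarrow> b \<le> T \<Longrightarrow> continuous_on {a..b} energy"
  unfolding energy_def by (intro continuous_intros continuous_on_subinterval)

lemma energy_bounds: "1 \<le> energy s" "norm (v s) \<le> energy s" "1 + norm (x s) + norm (v s) \<le> 2 * energy s" "(norm (v s))\<^sup>2 \<le> energy s"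
proof -
  have *: "y \<le> (1 + y\<^sup>2) / 2" for y :: real
    using sum_squares_bound[of y 1] by simp
  show "1 \<le> energy s" by (simp add: energy_def)
  show "(norm (v s))\<^sup>2 \<le> energy s" by (simp add: energy_def)
  have "0 \<le> (norm (x s))\<^sup>2" "0 \<le> (norm (v s))\<^sup>2" by simp_all
  then show "norm (v s) \<le> energy s" "1 + norm (x s) + norm (v s) \<le> 2 * energy s"
    using *[of "norm (v s)"] *[of "norm (x s)"] unfolding energy_def by argo+
qed

context
  fixes a b :: real
  assumes ab: "0 \<le> a" "a < b" "b \<le> T"
begin

abbreviation (input) "h \<equiv> b - a"
abbreviation (input) "vel \<equiv> integral {a..b} (\<lambda>s. norm (v s))"
abbreviation (input) "Q \<equiv> integral {a..b} energy"

lemma cont_step: "continuous_on {a..b} x" "continuous_on {a..b} v" "continuous_on {a..b} w"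
    "continuous_on {a..b} (\<lambda>s. f (x s))" "continuous_on {a..b} energy"
  using continuous_on_subinterval cont_energy ab by auto

lemma integral_speed_le: "vel \<le> Q" "vel\<^sup>2 \<le> h * Q"
proof -
  show "vel \<le> Q"
    by (intro integral_le integrable_continuous_real continuous_intros cont_step energy_bounds)
  have "vel\<^sup>2 \<le> h * integral {a..b} (\<lambda>s. (norm (v s))\<^sup>2)"
    using ab by (intro integral_power2_le continuous_intros cont_step) auto
  also have "\<dots> \<le> h * Q"
    using ab by (intro mult_left_mono integral_le integrable_continuous_real continuous_intros cont_step energy_bounds) auto
  finally show "vel\<^sup>2 \<le> h * Q" .
qed

lemma integral_initial_le:
  fixes g :: "real \<Rightarrow> real"
  assumes "continuous_on {a..b} g" "\<And>s. s \<in> {a..b} \<Longrightarrow> 0 \<le> g s" "t \<in> {a..b}"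
  shows "integral {a..t} g \<le> integral {a..b} g"
  using assms
  by (intro integral_subset_le integrable_continuous_real continuous_on_subset[OF assms(1)]) auto

lemma position_increment:
  assumes t: "t \<in> {a..b}" shows "norm (x t - x a) \<le> vel"
proof -
  have "norm (x t - x a) = norm (integral {a..t} v)"
    using x_eq_from[of a t] ab t by simp
  also have "\<dots> \<le> integral {a..t} (\<lambda>s. norm (v s))"
    using t by (intro norm_integral_le continuous_intros continuous_on_subset[OF cont_step(2)]) auto
  also have "\<dots> \<le> vel"
    by (intro integral_initial_le continuous_intros cont_step t) auto
  finally show ?thesis .
qed

lemma force_increment:
  assumes t: "t \<in> {a..b}" shows "norm (f (x t) - f (x a)) \<le> B * vel"
  using order_trans[OF f_lipschitz mult_left_mono[OF position_increment[OF t] B_nonneg]] .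

lemma drift_increment:
  assumes t: "t \<in> {a..b}"
  shows "norm (integral {a..t} (\<lambda>s. f (x s)) - integral {a..t} (\<lambda>s. \<Gamma> *v v s)) \<le> 2 * B * Q"
proof -
  have "t \<le> T" using t ab by simp
  note sub' = continuous_on_subinterval[OF ab(1) this] cont_energy[OF ab(1) this]
  have sub: "continuous_on {a..t} (\<lambda>s. f (x s))" "continuous_on {a..t} (\<lambda>s. \<Gamma> *v v s)"
    "continuous_on {a..t} energy"
    by (intro continuous_intros sub')+
  have "norm (integral {a..t} (\<lambda>s. f (x s)) - integral {a..t} (\<lambda>s. \<Gamma> *v v s))
      = norm (integral {a..t} (\<lambda>s. f (x s) - \<Gamma> *v v s))"
    by (subst Henstock_Kurzweil_Integration.integral_diff)
      (auto intro!: integrable_continuous_real sub)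
  also have "\<dots> \<le> integral {a..t} (\<lambda>s. 2 * B * energy s)"
  proof (intro norm_integral_le continuous_intros sub sub')
    fix s
    have "norm (f (x s) - \<Gamma> *v v s) \<le> B * (1 + norm (x s) + norm (v s))"
      using norm_triangle_ineq4[of "f (x s)" "\<Gamma> *v v s"] f_growth[of "x s"] \<Gamma>_bound[of "v s"]
      by (simp add: algebra_simps)
    also have "\<dots> \<le> B * (2 * energy s)"
      by (intro mult_left_mono energy_bounds B_nonneg)
    finally show "norm (f (x s) - \<Gamma> *v v s) \<le> 2 * B * energy s" by simp
  qed
  also have "\<dots> \<le> integral {a..b} (\<lambda>s. 2 * B * energy s)"
    using B_nonneg order_trans[OF zero_le_one energy_bounds(1)]
    by (intro integral_initial_le continuous_intros cont_step t) auto
  finally show ?thesis by simp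
qed

lemma remaining_time: "s \<in> {a..b} \<Longrightarrow> b - s \<in> {0..T}" "h \<in> {0..T}"
  using ab by auto

lemma position_local_error:
  "norm (x b - position_step h (x a) (v a) (ou_position \<Gamma> \<sigma> w a b)) \<le> B\<^sup>2 * h\<^sup>2 * Q"
proof -
  have "integral {a..b} v = svv_c1 \<Gamma> h *v v a + integral {a..b} (\<lambda>s. svv_c1 \<Gamma> (b - s) *v f (x s))
      + ou_position \<Gamma> \<sigma> w a b"
    using ab by (intro variation_of_constants_position cont_step invertible v_eq_from) auto
  then have "x b - position_step h (x a) (v a) (ou_position \<Gamma> \<sigma> w a b)
      = integral {a..b} (\<lambda>s. svv_c1 \<Gamma> (b - s) *v f (x s)) - integral {a..b} (\<lambda>s. svv_c1 \<Gamma> (b - s) *v f (x a))"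
    using x_eq_from[of a b] ab svv_c2_mult_eq_integral[OF invertible, of a b "f (x a)"]
    by (simp add: position_step_def)
  also have "\<dots> = integral {a..b} (\<lambda>s. svv_c1 \<Gamma> (b - s) *v (f (x s) - f (x a)))"
    unfolding mv.diff_right
    by (intro Henstock_Kurzweil_Integration.integral_diff[symmetric] integrable_continuous_real
        continuous_intros cont_step invertible)
  also have "norm \<dots> \<le> h * (B * h * (B * vel))"
  proof (intro norm_integral_le_const continuous_intros cont_step invertible)
    fix s assume s: "s \<in> {a..b}"
    have "norm (svv_c1 \<Gamma> (b - s) *v (f (x s) - f (x a))) \<le> B * (b - s) * norm (f (x s) - f (x a))"
      by (rule c1_bound[OF remaining_time(1)[OF s]])
    also have "\<dots> \<le> B * h * (B * vel)"
      using s ab B_nonneg by (intro mult_mono force_increment) auto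
    finally show "norm (svv_c1 \<Gamma> (b - s) *v (f (x s) - f (x a))) \<le> B * h * (B * vel)" .
  qed (use ab in auto)
  also have "\<dots> = B\<^sup>2 * h\<^sup>2 * vel" by (simp add: power2_eq_square)
  also have "\<dots> \<le> B\<^sup>2 * h\<^sup>2 * Q" by (intro mult_left_mono integral_speed_le) auto
  finally show ?thesis .
qed

text \<open>Up to \<open>O(h\<^sup>2) \<integral>(1 + |x|\<^sup>2 + |v|\<^sup>2)\<close> the velocity error is the error of the trapezoidal rule for
  \<open>s \<mapsto> f (x s)\<close>. Its derivative \<open>f' (x s) (v s)\<close> is only as rough as \<open>w\<close>, and the Peano kernel
  annihilates its value at \<open>a\<close>; what remains at order \<open>h\<^bsup>5/2\<^esup>\<close> is the noise in \<open>v s - v a\<close>.\<close>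

lemma velocity_local_error:
  "norm (v b - velocity_step h (x a) (x b) (v a) (ou_velocity \<Gamma> \<sigma> w a b)
      - f' (x a) (\<sigma> *v midpoint_moment w a b))
    \<le> 4 * B\<^sup>2 * h\<^sup>2 * Q" (is "norm (?E - _) \<le> _")
proof -
  have h: "h > 0" using ab by simp
  define \<Delta> where "\<Delta> = f (x b) - f (x a)"
  \<comment> \<open>the interpolation error of the force\<close>
  define g where "g s = f (x s) - f (x a) - ((s - a) / h) *\<^sub>R \<Delta>" for s
  have cont_g: "continuous_on {a..b} g"
    unfolding g_def using h by (intro continuous_intros cont_step) auto
  have g_bound: "norm (g s) \<le> 2 * B * vel" if s: "s \<in> {a..b}" for s
  proof -
    have "norm (((s - a) / h) *\<^sub>R \<Delta>) \<le> 1 * (B * vel)"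
      unfolding norm_scaleR \<Delta>_def using s h force_increment[of b] ab
      by (intro mult_mono) auto
    then show ?thesis
      using norm_triangle_ineq4[of "f (x s) - f (x a)" "((s - a) / h) *\<^sub>R \<Delta>"] force_increment[OF s]
      unfolding g_def by linarith
  qed
  have E: "?E = integral {a..b} (\<lambda>s. svv_c0 \<Gamma> (b - s) *v g s)"
  proof -
    have "v b = svv_c0 \<Gamma> h *v v a + integral {a..b} (\<lambda>s. svv_c0 \<Gamma> (b - s) *v f (x s))
        + ou_velocity \<Gamma> \<sigma> w a b"
      using ab by (intro variation_of_constants_velocity cont_step v_eq_from) auto
    moreover have "((1 / h) *\<^sub>R svv_c2 \<Gamma> h) *v \<Delta>
        = integral {a..b} (\<lambda>s. ((s - a) / h) *\<^sub>R (svv_c0 \<Gamma> (b - s) *v \<Delta>))"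
    proof -
      have "((1 / h) *\<^sub>R svv_c2 \<Gamma> h) *v \<Delta>
          = (1 / h) *\<^sub>R integral {a..b} (\<lambda>s. (s - a) *\<^sub>R (svv_c0 \<Gamma> (b - s) *v \<Delta>))"
        using svv_c2_mult_eq_ramp_integral[OF invertible, of a b \<Delta>] ab by (simp add: mv.scaleR_left)
      then show ?thesis
        by (simp only: integral_cmul[symmetric] scaleR_scaleR times_divide_eq_left mult_1_left)
    qed
    moreover have "svv_c1 \<Gamma> h *v f (x a) = integral {a..b} (\<lambda>s. svv_c0 \<Gamma> (b - s) *v f (x a))"
      using ab by (intro svv_c1_mult_eq_integral invertible) auto
    ultimately have "?E = integral {a..b} (\<lambda>s. svv_c0 \<Gamma> (b - s) *v f (x s))
        - integral {a..b} (\<lambda>s. svv_c0 \<Gamma> (b - s) *v f (x a))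
        - integral {a..b} (\<lambda>s. ((s - a) / h) *\<^sub>R (svv_c0 \<Gamma> (b - s) *v \<Delta>))"
      unfolding \<Delta>_def velocity_step_def by simp
    also have "\<dots> = integral {a..b} (\<lambda>s. svv_c0 \<Gamma> (b - s) *v f (x s) - svv_c0 \<Gamma> (b - s) *v f (x a)
        - ((s - a) / h) *\<^sub>R (svv_c0 \<Gamma> (b - s) *v \<Delta>))"
      using h by (intro integral_diff_diff continuous_intros cont_step) auto
    finally show ?thesis
      by (simp only: g_def mv.diff_right mv.scaleR_right)
  qed
  define D where "D s = integral {a..s} (\<lambda>u. f (x u)) - integral {a..s} (\<lambda>u. \<Gamma> *v v u)" for s
  define m where "m s = (a + b) / 2 - s" for s
  have cont_m: "continuous_on {a..b} m" unfolding m_def by (intro continuous_intros)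
  have m_bound: "\<bar>m s\<bar> \<le> h / 2" if "s \<in> {a..b}" for s
    using that unfolding m_def by (auto simp: abs_le_iff field_simps)
  have cont_D: "continuous_on {a..b} D"
    unfolding D_def
    by (intro continuous_intros indefinite_integral_continuous_1 integrable_continuous_real cont_step)
  have v_incr: "v s - v a = D s + \<sigma> *v (w s - w a)" if "s \<in> {a..b}" for s
    using v_eq_from[of a s] ab that by (simp add: D_def algebra_simps)
  \<comment> \<open>what is left of the derivative of \<open>s \<mapsto> f (x s)\<close> without its value at \<open>a\<close> and the noise\<close>
  define r where "r s = (f' (x s) (v s) - f' (x a) (v s)) + f' (x a) (D s)" for s
  have cont_f'x: "continuous_on {a..b} (\<lambda>s. f' (x s))"
    by (intro continuous_on_compose2[OF continuous_f'] cont_step) auto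
  have cont_r: "continuous_on {a..b} r"
    unfolding r_def by (intro continuous_intros cont_f'x cont_step cont_D)
  have trapezoid: "integral {a..b} g = integral {a..b} (\<lambda>s. m s *\<^sub>R f' (x s) (v s))"
  proof -
    have "((\<lambda>s. f (x s)) has_vector_derivative f' (x s) (v s)) (at s within {a..b})" if s: "s \<in> {a..b}" for s
    proof -
      have "((\<lambda>t. x a + integral {a..t} v) has_vector_derivative 0 + v s) (at s within {a..b})"
        by (intro has_vector_derivative_add has_vector_derivative_const integral_has_vector_derivative cont_step s)
      then have "(x has_vector_derivative v s) (at s within {a..b})"
        unfolding add_0_left
      proof (rule has_vector_derivative_transform[OF s, rotated])
        show "x t = x a + integral {a..t} v" if "t \<in> {a..b}" for t
          using that ab by (intro x_eq_from) auto
      qed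
      from vector_derivative_diff_chain_within[OF this has_derivative_at_withinI[OF f_deriv]]
      show ?thesis by (simp add: o_def)
    qed
    then have "integral {a..b} (\<lambda>s. f (x s)) - (h / 2) *\<^sub>R (f (x a) + f (x b))
        = integral {a..b} (\<lambda>s. m s *\<^sub>R f' (x s) (v s))"
      unfolding m_def using ab
      by (intro trapezoidal_rule_error cont_step continuous_intros cont_f'x) auto
    moreover have "integral {a..b} g = integral {a..b} (\<lambda>s. f (x s)) - (h / 2) *\<^sub>R (f (x a) + f (x b))"
    proof -
      have ramp: "((\<lambda>s. (s - a)\<^sup>2 / (2 * k)) has_real_derivative (t - a) / k) (at t within {a..b})"
        if "k \<noteq> 0" for k t
        using that by (auto intro!: derivative_eq_intros simp: divide_simps)
      have "((\<lambda>s. (s - a) / h) has_integral (b - a)\<^sup>2 / (2 * h) - (a - a)\<^sup>2 / (2 * h)) {a..b}"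
        by (rule fundamental_theorem_of_calculus)
          (use ab ramp[of h] in \<open>simp_all add: has_real_derivative_iff_has_vector_derivative\<close>)
      moreover have "k\<^sup>2 / (2 * k) - (a - a)\<^sup>2 / (2 * k) = k / 2" for k
        by (simp add: power2_eq_square)
      ultimately have "((\<lambda>s. (s - a) / h) has_integral h / 2) {a..b}"
        by (simp only:)
      then have "((\<lambda>s. ((s - a) / h) *\<^sub>R \<Delta>) has_integral (h / 2) *\<^sub>R \<Delta>) {a..b}"
        by (rule has_integral_scaleR_left)
      moreover have "((\<lambda>s. f (x a)) has_integral h *\<^sub>R f (x a)) {a..b}"
        using has_integral_const_real[of "f (x a)" a b] ab by simp
      ultimately have "(g has_integral integral {a..b} (\<lambda>s. f (x s)) - h *\<^sub>R f (x a) - (h / 2) *\<^sub>R \<Delta>) {a..b}"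
        unfolding g_def
        by (intro has_integral_diff integrable_integral integrable_continuous_real cont_step)
      moreover have "h *\<^sub>R f (x a) = (h / 2) *\<^sub>R f (x a) + (h / 2) *\<^sub>R f (x a)"
        by (simp add: scaleR_add_left[symmetric])
      ultimately show ?thesis
        by (simp add: integral_unique \<Delta>_def scaleR_diff_right scaleR_add_right)
    qed
    ultimately show ?thesis by simp
  qed
  have g_split: "integral {a..b} g - f' (x a) (\<sigma> *v midpoint_moment w a b) = integral {a..b} (\<lambda>s. m s *\<^sub>R r s)"
  proof -
    have "f' (x a) (\<sigma> *v midpoint_moment w a b) = integral {a..b} (\<lambda>s. m s *\<^sub>R f' (x a) (\<sigma> *v (w s - w a)))"
    proof -
      have "bounded_linear (\<lambda>z. f' (x a) (\<sigma> *v z))"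
        by (intro bounded_linear_compose[OF blinfun.bounded_linear_right] matrix_vector_mul_bounded_linear)
      from integral_linear[OF _ this, of "\<lambda>s. m s *\<^sub>R (w s - w a)" "{a..b}"]
      have "integral {a..b} ((\<lambda>z. f' (x a) (\<sigma> *v z)) \<circ> (\<lambda>s. m s *\<^sub>R (w s - w a)))
        = f' (x a) (\<sigma> *v integral {a..b} (\<lambda>s. m s *\<^sub>R (w s - w a)))"
        by (simp add: integrable_continuous_real continuous_intros cont_m cont_step)
      then show ?thesis
        by (simp add: midpoint_moment_def m_def o_def mv.scaleR_right blinfun.scaleR_right)
    qed
    moreover have "integral {a..b} (\<lambda>s. m s *\<^sub>R f' (x a) (v a)) = 0"
      unfolding m_def using ab by (intro integral_midpoint_kernel) auto
    ultimately have "integral {a..b} g - f' (x a) (\<sigma> *v midpoint_moment w a b)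
        = integral {a..b} (\<lambda>s. m s *\<^sub>R f' (x s) (v s))
          - integral {a..b} (\<lambda>s. m s *\<^sub>R f' (x a) (v a))
          - integral {a..b} (\<lambda>s. m s *\<^sub>R f' (x a) (\<sigma> *v (w s - w a)))"
      by (simp add: trapezoid)
    also have "\<dots> = integral {a..b} (\<lambda>s. m s *\<^sub>R f' (x s) (v s) - m s *\<^sub>R f' (x a) (v a)
          - m s *\<^sub>R f' (x a) (\<sigma> *v (w s - w a)))"
      by (intro integral_diff_diff continuous_intros cont_step cont_m cont_f'x)
    also have "\<dots> = integral {a..b} (\<lambda>s. m s *\<^sub>R r s)"
    proof (rule Henstock_Kurzweil_Integration.integral_cong)
      fix s assume s: "s \<in> {a..b}"
      have "f' (x a) (v s) = f' (x a) (v a) + f' (x a) (D s) + f' (x a) (\<sigma> *v (w s - w a))"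
        using v_incr[OF s] by (simp add: blinfun.add_right[symmetric] diff_eq_eq add_ac)
      then show "m s *\<^sub>R f' (x s) (v s) - m s *\<^sub>R f' (x a) (v a) - m s *\<^sub>R f' (x a) (\<sigma> *v (w s - w a)) = m s *\<^sub>R r s"
        by (simp add: r_def scaleR_diff_right[symmetric])
    qed
    finally show ?thesis .
  qed
  have "norm (integral {a..b} (\<lambda>s. m s *\<^sub>R r s)) \<le> integral {a..b} (\<lambda>s. (h / 2) * (B * vel * norm (v s) + B * (2 * B * Q)))"
  proof (intro norm_integral_le continuous_intros cont_step cont_m cont_r)
    fix s assume s: "s \<in> {a..b}"
    have "norm (f' (x s) (v s) - f' (x a) (v s)) \<le> B * vel * norm (v s)"
      using position_increment[OF s] B_nonneg
      by (intro order_trans[OF f'_apply_lipschitz] mult_right_mono mult_left_mono) auto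
    moreover have "norm (f' (x a) (D s)) \<le> B * (2 * B * Q)"
      using drift_increment[OF s] B_nonneg unfolding D_def
      by (intro order_trans[OF f'_apply_bound] mult_left_mono) auto
    ultimately have "norm (r s) \<le> B * vel * norm (v s) + B * (2 * B * Q)"
      unfolding r_def by (intro order_trans[OF norm_triangle_ineq] add_mono)
    then show "norm (m s *\<^sub>R r s) \<le> (h / 2) * (B * vel * norm (v s) + B * (2 * B * Q))"
      using m_bound[OF s] h by (simp only: norm_scaleR real_norm_def) (intro mult_mono, auto)
  qed
  also have "\<dots> = (h / 2) * (B * vel\<^sup>2 + h * (2 * B\<^sup>2 * Q))"
  proof -
    have "integral {a..b} (\<lambda>s. B * vel * norm (v s) + B * (2 * B * Q)) = B * vel * vel + h * (B * (2 * B * Q))"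
      using ab by (subst Henstock_Kurzweil_Integration.integral_add)
        (auto intro!: integrable_continuous_real continuous_intros cont_step)
    then show ?thesis by (simp add: power2_eq_square)
  qed
  also have "\<dots> \<le> (h / 2) * (B\<^sup>2 * (h * Q) + h * (2 * B\<^sup>2 * Q))"
  proof -
    have "B \<le> B\<^sup>2" using B_ge_1 by (simp add: power2_eq_square)
    then have "B * vel\<^sup>2 \<le> B\<^sup>2 * (h * Q)"
      by (intro mult_mono integral_speed_le) auto
    then show ?thesis using h by (intro mult_left_mono add_right_mono) auto
  qed
  also have "\<dots> = (3 / 2) * B\<^sup>2 * h\<^sup>2 * Q"
  proof -
    have "(k / 2) * (c * (k * y) + k * (2 * c * y)) = (3 / 2) * c * k\<^sup>2 * y" for k c y :: real
      by (simp add: power2_eq_square algebra_simps)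
    then show ?thesis .
  qed
  finally have second: "norm (integral {a..b} (\<lambda>s. m s *\<^sub>R r s)) \<le> (3 / 2) * B\<^sup>2 * h\<^sup>2 * Q" .
  \<comment> \<open>replacing \<open>c\<^sub>0\<close> by the identity gains a factor \<open>h\<close>\<close>
  have "norm (integral {a..b} (\<lambda>s. svv_c0 \<Gamma> (b - s) *v g s - g s)) \<le> h * (B * h * (2 * B * vel))"
  proof (intro norm_integral_le_const continuous_intros cont_g)
    fix s assume s: "s \<in> {a..b}"
    have "norm (svv_c0 \<Gamma> (b - s) *v g s - g s) \<le> B * (b - s) * norm (g s)"
      by (rule c0_minus_id_bound[OF remaining_time(1)[OF s]])
    also have "\<dots> \<le> B * h * (2 * B * vel)"
      using s ab B_nonneg by (intro mult_mono g_bound) auto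
    finally show "norm (svv_c0 \<Gamma> (b - s) *v g s - g s) \<le> B * h * (2 * B * vel)" .
  qed (use ab in auto)
  also have "\<dots> = 2 * B\<^sup>2 * h\<^sup>2 * vel" by (simp add: power2_eq_square)
  also have "\<dots> \<le> 2 * B\<^sup>2 * h\<^sup>2 * Q" by (intro mult_left_mono integral_speed_le) auto
  finally have first: "norm (integral {a..b} (\<lambda>s. svv_c0 \<Gamma> (b - s) *v g s - g s)) \<le> 2 * B\<^sup>2 * h\<^sup>2 * Q" .
  have "?E - f' (x a) (\<sigma> *v midpoint_moment w a b)
      = integral {a..b} (\<lambda>s. svv_c0 \<Gamma> (b - s) *v g s - g s) + integral {a..b} (\<lambda>s. m s *\<^sub>R r s)"
    unfolding g_split[symmetric] E
    by (subst Henstock_Kurzweil_Integration.integral_diff)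
      (auto intro!: integrable_continuous_real continuous_intros cont_g)
  also have "norm \<dots> \<le> 2 * B\<^sup>2 * h\<^sup>2 * Q + (3 / 2) * B\<^sup>2 * h\<^sup>2 * Q"
    by (intro order_trans[OF norm_triangle_ineq] add_mono first second)
  also have "\<dots> = (7 / 2) * (B\<^sup>2 * h\<^sup>2 * Q)" by (simp add: algebra_simps)
  also have "\<dots> \<le> 4 * (B\<^sup>2 * h\<^sup>2 * Q)"
  proof -
    have "0 \<le> Q"
      using order_trans[OF zero_le_one energy_bounds(1)] by (intro integral_nonneg integrable_continuous_real cont_step) auto
    then show ?thesis by (intro mult_right_mono mult_nonneg_nonneg) auto
  qed
  finally show ?thesis by (simp add: algebra_simps)
qed

end


end

section \<open>Partitions of an interval\<close>

definition is_partition :: "real \<Rightarrow> real \<Rightarrow> nat \<Rightarrow> (nat \<Rightarrow> real) \<Rightarrow> bool" where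
  "is_partition a b m p \<longleftrightarrow> p 0 = a \<and> p m = b \<and> (\<forall>i<m. p i \<le> p (Suc i))"

lemma is_partition_bounds:
  assumes "is_partition a b m p" "i \<le> m"
  shows "a \<le> p i" "p i \<le> b"
proof -
  have mono: "p j \<le> p k" if "j \<le> k" "k \<le> m" for j k
    using that
  proof (induction k rule: dec_induct)
    case (step k)
    then have "p j \<le> p k" "p k \<le> p (Suc k)"
      using assms(1) by (auto simp: is_partition_def)
    then show ?case by simp
  qed simp
  show "a \<le> p i" "p i \<le> b"
    using mono[of 0 i] mono[of i m] assms by (auto simp: is_partition_def)
qed

lemma is_partition_step:
  assumes "is_partition a b m p" "i < m"
  shows "p i \<le> p (Suc i)"
  using assms by (auto simp: is_partition_def)

lemma sum_integral_partition:
  fixes g :: "real \<Rightarrow> 'a::euclidean_space"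
  assumes p: "is_partition a b m p" and g: "continuous_on {a..b} g"
  shows "(\<Sum>i<m. integral {p i..p (Suc i)} g) = integral {a..b} g"
proof -
  have "(\<Sum>i<k. integral {p i..p (Suc i)} g) = integral {a..p k} g" if "k \<le> m" for k
    using that
  proof (induction k)
    case 0
    then show ?case using p by (simp add: is_partition_def)
  next
    case (Suc k)
    have "g integrable_on {a..p (Suc k)}"
      using is_partition_bounds[OF p Suc.prems]
      by (intro integrable_continuous_real continuous_on_subset[OF g]) auto
    then have "integral {a..p k} g + integral {p k..p (Suc k)} g = integral {a..p (Suc k)} g"
      using is_partition_bounds[OF p, of k] is_partition_step[OF p, of k] Suc.prems
      by (intro Henstock_Kurzweil_Integration.integral_combine) auto
    then show ?case using Suc by simp
  qed
  from this[of m] show ?thesis using p by (simp add: is_partition_def)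
qed


section \<open>Error propagation along a path\<close>

text \<open>The bound is on the integral of \<open>q\<close> and not on \<open>q\<close> itself: \<open>\<beta>\<close> will contain \<open>|w t|\<^sup>2\<close>, and its
  time integral has a finite expectation by elementary means, unlike its supremum.\<close>

lemma gronwall_integral:
  fixes q \<beta> :: "real \<Rightarrow> real"
  assumes T: "0 \<le> T" and q: "continuous_on {0..T} q" and \<beta>: "continuous_on {0..T} \<beta>"
    and D: "0 \<le> D" and \<beta>_nonneg: "\<And>t. t \<in> {0..T} \<Longrightarrow> 0 \<le> \<beta> t"
    and le: "\<And>t. t \<in> {0..T} \<Longrightarrow> q t \<le> \<beta> t + D * integral {0..t} q"
  shows "integral {0..T} q \<le> exp (D * T) * integral {0..T} \<beta>"
proof -
  define \<psi> where "\<psi> t = integral {0..t} q" for t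
  have \<psi>: "(\<psi> has_vector_derivative q t) (at t within {0..T})" if "t \<in> {0..T}" for t
    unfolding \<psi>_def by (rule integral_has_vector_derivative[OF q that])
  have cont_\<psi>: "continuous_on {0..T} \<psi>"
    unfolding \<psi>_def by (intro indefinite_integral_continuous_1 integrable_continuous_real q)
  have "((\<lambda>t. exp (- D * t) * (q t - D * \<psi> t)) has_integral
      exp (- D * T) * \<psi> T - exp (- D * 0) * \<psi> 0) {0..T}"
  proof (rule fundamental_theorem_of_calculus[OF T])
    fix t assume t: "t \<in> {0..T}"
    have "((\<lambda>t. exp (- D * t)) has_real_derivative exp (- D * t) * (- D)) (at t within {0..T})"
      by (auto intro!: derivative_eq_intros)
    from has_vector_derivative_mult[OF this[unfolded has_real_derivative_iff_has_vector_derivative] \<psi>[OF t]]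
    show "((\<lambda>t. exp (- D * t) * \<psi> t) has_vector_derivative exp (- D * t) * (q t - D * \<psi> t)) (at t within {0..T})"
      by (simp add: algebra_simps)
  qed
  then have "exp (- D * T) * \<psi> T = integral {0..T} (\<lambda>t. exp (- D * t) * (q t - D * \<psi> t))"
    by (simp add: integral_unique \<psi>_def)
  also have "\<dots> \<le> integral {0..T} \<beta>"
  proof (intro integral_le integrable_continuous_real continuous_intros q \<beta> cont_\<psi>)
    fix t assume t: "t \<in> {0..T}"
    have "exp (- D * t) * (q t - D * \<psi> t) \<le> exp (- D * t) * \<beta> t"
      using le[OF t] by (intro mult_left_mono) (auto simp: \<psi>_def)
    also have "\<dots> \<le> 1 * \<beta> t"
      using t D by (intro mult_right_mono \<beta>_nonneg) auto
    finally show "exp (- D * t) * (q t - D * \<psi> t) \<le> \<beta> t" by simp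
  qed
  finally have "exp (D * T) * (exp (- D * T) * \<psi> T) \<le> exp (D * T) * integral {0..T} \<beta>"
    by (rule mult_left_mono) simp
  then show ?thesis by (simp add: \<psi>_def exp_minus field_simps)
qed

lemma gronwall_sum:
  fixes d :: "nat \<Rightarrow> real"
  assumes c: "0 \<le> c" and A: "0 \<le> A" and le: "\<And>k. k \<le> N \<Longrightarrow> d k \<le> A + c * (\<Sum>j<k. d j)"
    and k: "k \<le> N"
  shows "d k \<le> A * exp (c * real N)"
proof -
  have sum: "A + c * (\<Sum>j<k. d j) \<le> A * (1 + c) ^ k" if "k \<le> N" for k
    using that
  proof (induction k)
    case (Suc k)
    have "A + c * (\<Sum>j<Suc k. d j) = (A + c * (\<Sum>j<k. d j)) + c * d k"
      by (simp add: algebra_simps)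
    also have "\<dots> \<le> (A + c * (\<Sum>j<k. d j)) + c * (A + c * (\<Sum>j<k. d j))"
      using le[of k] Suc.prems c by (intro add_left_mono mult_left_mono) auto
    also have "\<dots> = (1 + c) * (A + c * (\<Sum>j<k. d j))" by (simp add: algebra_simps)
    also have "\<dots> \<le> (1 + c) * (A * (1 + c) ^ k)"
      using Suc c by (intro mult_left_mono) auto
    finally show ?case by (simp add: algebra_simps)
  qed simp
  have "d k \<le> A * (1 + c) ^ k" using le[OF k] sum[OF k] by linarith
  also have "\<dots> \<le> A * (1 + c) ^ N"
    using A c k by (intro mult_left_mono power_increasing) auto
  also have "\<dots> \<le> A * exp c ^ N"
    using A c by (intro mult_left_mono power_mono) (auto simp: exp_ge_add_one_self)
  finally show ?thesis by (simp add: exp_of_nat_mult[symmetric] mult.commute)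
qed

context langevin_path
begin

text \<open>Linear growth of the force bounds the squared norms at time \<open>t\<close> by their integral up to \<open>t\<close> and
  by the driving path, which is the situation of \<open>gronwall_integral\<close>.\<close>

lemma integral_energy_le:
  "integral {0..T} energy \<le> exp ((2 * T + 9 * B\<^sup>2 * T) * T)
     * (T * (1 + 3 * (norm (x 0))\<^sup>2 + 3 * (norm (v 0))\<^sup>2)
        + 3 * B\<^sup>2 * integral {0..T} (\<lambda>t. (norm (w t - w 0))\<^sup>2))"
proof -
  define c where "c = 1 + 3 * (norm (x 0))\<^sup>2 + 3 * (norm (v 0))\<^sup>2"
  define \<beta> where "\<beta> t = c + 3 * B\<^sup>2 * (norm (w t - w 0))\<^sup>2" for t
  have cont_energy_T: "continuous_on {0..T} energy" by (intro cont_energy) auto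
  have "energy t \<le> \<beta> t + (2 * T + 9 * B\<^sup>2 * T) * integral {0..t} energy" if t: "t \<in> {0..T}" for t
  proof -
    have tT: "t \<le> T" "0 \<le> t" using t by auto
    have cont: "continuous_on {0..t} x" "continuous_on {0..t} v" "continuous_on {0..t} energy"
      "continuous_on {0..t} (\<lambda>s. f (x s))"
      using continuous_on_subinterval[of 0 t] cont_energy[of 0 t] tT by auto
    have Q: "0 \<le> integral {0..t} energy"
      using order_trans[OF zero_le_one energy_bounds(1)]
      by (intro integral_nonneg integrable_continuous_real cont) auto
    have *: "(integral {0..t} g)\<^sup>2 \<le> T * (c * integral {0..t} energy)"
      if "continuous_on {0..t} g" "\<And>s. s \<in> {0..t} \<Longrightarrow> (g s)\<^sup>2 \<le> c * energy s" "0 \<le> c" for g :: "real \<Rightarrow> real" and c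
    proof -
      have "(integral {0..t} g)\<^sup>2 \<le> (t - 0) * integral {0..t} (\<lambda>s. (g s)\<^sup>2)"
        using tT by (intro integral_power2_le that) auto
      also have "\<dots> \<le> t * integral {0..t} (\<lambda>s. c * energy s)"
        unfolding diff_0_right using tT that
        by (intro mult_left_mono integral_le integrable_continuous_real continuous_intros cont) auto
      also have "\<dots> \<le> T * (c * integral {0..t} energy)"
        using tT Q that by (simp, intro mult_right_mono mult_nonneg_nonneg) auto
      finally show ?thesis .
    qed
    have "norm (x t) \<le> norm (x 0) + integral {0..t} (\<lambda>s. norm (v s))"
    proof -
      have "norm (integral {0..t} v) \<le> integral {0..t} (\<lambda>s. norm (v s))"
        by (intro norm_integral_le continuous_intros cont) auto
      then show ?thesis using x_eq[OF t] norm_triangle_ineq[of "x 0" "integral {0..t} v"] by simp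
    qed
    then have "(norm (x t))\<^sup>2 \<le> (norm (x 0) + integral {0..t} (\<lambda>s. norm (v s)))\<^sup>2"
      by (intro power_mono) auto
    also have "\<dots> \<le> 2 * (norm (x 0))\<^sup>2 + 2 * (integral {0..t} (\<lambda>s. norm (v s)))\<^sup>2"
      using sum_squares_bound[of "norm (x 0)" "integral {0..t} (\<lambda>s. norm (v s))"]
      by (simp add: power2_sum)
    also have "\<dots> \<le> 2 * (norm (x 0))\<^sup>2 + 2 * (T * (1 * integral {0..t} energy))"
      by (intro add_left_mono mult_left_mono * continuous_intros cont) (auto simp: energy_bounds)
    finally have X: "(norm (x t))\<^sup>2 \<le> 3 * (norm (x 0))\<^sup>2 + 2 * T * integral {0..t} energy"
      using zero_le_power2[of "norm (x 0)"] by linarith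
    define I where "I = integral {0..t} (\<lambda>s. 1 + norm (x s) + norm (v s))"
    have "norm (v t) \<le> norm (v 0) + B * I + B * norm (w t - w 0)"
    proof -
      have "norm (integral {0..t} (\<lambda>s. f (x s)) - integral {0..t} (\<lambda>s. \<Gamma> *v v s))
          = norm (integral {0..t} (\<lambda>s. f (x s) - \<Gamma> *v v s))"
        by (subst Henstock_Kurzweil_Integration.integral_diff)
          (intro integrable_continuous_real continuous_intros cont refl)+
      also have "\<dots> \<le> integral {0..t} (\<lambda>s. B * (1 + norm (x s) + norm (v s)))"
      proof (intro norm_integral_le continuous_intros cont)
        fix s
        show "norm (f (x s) - \<Gamma> *v v s) \<le> B * (1 + norm (x s) + norm (v s))"
          using norm_triangle_ineq4[of "f (x s)" "\<Gamma> *v v s"] f_growth[of "x s"] \<Gamma>_bound[of "v s"]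
          by (simp add: algebra_simps)
      qed
      finally have "norm (integral {0..t} (\<lambda>s. f (x s)) - integral {0..t} (\<lambda>s. \<Gamma> *v v s)) \<le> B * I"
        by (simp add: I_def)
      moreover have "v t = v 0 + (integral {0..t} (\<lambda>s. f (x s)) - integral {0..t} (\<lambda>s. \<Gamma> *v v s))
          + \<sigma> *v (w t - w 0)"
        using v_eq[OF t] by simp
      ultimately show ?thesis
        using \<sigma>_bound[of "w t - w 0"] norm_triangle_ineq
        by (smt (verit) norm_triangle_le)
    qed
    then have "(norm (v t))\<^sup>2 \<le> (norm (v 0) + B * I + B * norm (w t - w 0))\<^sup>2"
      by (intro power_mono) auto
    also have "\<dots> \<le> 3 * (norm (v 0))\<^sup>2 + 3 * (B * I)\<^sup>2 + 3 * (B * norm (w t - w 0))\<^sup>2"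
    proof -
      have "(a + b + c)\<^sup>2 \<le> 3 * a\<^sup>2 + 3 * b\<^sup>2 + 3 * c\<^sup>2" for a b c :: real
        using sum_squares_bound[of a b] sum_squares_bound[of a c] sum_squares_bound[of b c]
        by (simp add: power2_sum algebra_simps)
      then show ?thesis .
    qed
    also have "\<dots> \<le> 3 * (norm (v 0))\<^sup>2 + 3 * (B\<^sup>2 * (T * (3 * integral {0..t} energy))) + 3 * (B * norm (w t - w 0))\<^sup>2"
    proof -
      have "I\<^sup>2 \<le> T * (3 * integral {0..t} energy)"
        unfolding I_def
      proof (intro * continuous_intros cont)
        fix s
        show "(1 + norm (x s) + norm (v s))\<^sup>2 \<le> 3 * energy s"
          using sum_squares_bound[of 1 "norm (x s)"] sum_squares_bound[of 1 "norm (v s)"]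
            sum_squares_bound[of "norm (x s)" "norm (v s)"]
          by (simp add: energy_def power2_sum algebra_simps)
      qed auto
      then show ?thesis
        unfolding power_mult_distrib by (intro add_mono mult_left_mono order_refl) auto
    qed
    finally show ?thesis
      using X unfolding energy_def[of t] \<beta>_def c_def by (simp add: power_mult_distrib algebra_simps)
  qed
  then have "integral {0..T} energy \<le> exp ((2 * T + 9 * B\<^sup>2 * T) * T) * integral {0..T} \<beta>"
    unfolding \<beta>_def c_def using T_pos
    by (intro gronwall_integral cont_energy_T continuous_intros cont_w) auto
  also have "integral {0..T} \<beta> = T * c + 3 * B\<^sup>2 * integral {0..T} (\<lambda>t. (norm (w t - w 0))\<^sup>2)"
    unfolding \<beta>_def using T_pos
    by (subst Henstock_Kurzweil_Integration.integral_add)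
      (auto intro!: integrable_continuous_real continuous_intros cont_w)
  finally show ?thesis unfolding c_def .
qed

text \<open>Summing the one-step errors expresses the error at step \<open>k\<close> as a sum of drift terms of size \<open>h\<close>
  times earlier errors, of the accumulated noise, and of the remainders. The accumulated noise enters as
  a whole, through \<open>S\<close>, so that its cancellations are not lost. The last drift term contains the error at
  step \<open>k\<close> itself, because the scheme evaluates the force at the new position; the bound on \<open>h\<close> absorbs it.\<close>

lemma global_error:
  fixes X V :: "nat \<Rightarrow> real^'n" and h S :: real
  assumes h: "0 < h" "real N * h = T" "12 * B\<^sup>2 * h \<le> 1"
    and init: "X 0 = x 0" "V 0 = v 0"
    and X_step: "\<And>k. k < N \<Longrightarrow> 
        X (Suc k) = position_step h (X k) (V k) (ou_position \<Gamma> \<sigma> w (real k * h) (real (Suc k) * h))"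
    and V_step: "\<And>k. k < N \<Longrightarrow> 
        V (Suc k) = velocity_step h (X k) (X (Suc k)) (V k)
          (ou_velocity \<Gamma> \<sigma> w (real k * h) (real (Suc k) * h))"
    and S: "\<And>k. k \<le> N \<Longrightarrow> norm (\<Sum>j<k. f' (x (real j * h)) (\<sigma> *v midpoint_moment w (real j * h) (real (Suc j) * h))) \<le> S"
    and k: "k \<le> N"
  shows "norm (x (real k * h) - X k, v (real k * h) - V k)
    \<le> 2 * exp (12 * B\<^sup>2 * T) * (S + 5 * B\<^sup>2 * h\<^sup>2 * integral {0..T} energy)"
proof -
  define t where "t k = real k * h" for k
  define ex where "ex k = x (t k) - X k" for k
  define ev where "ev k = v (t k) - V k" for k
  define d where "d k = norm (ex k) + norm (ev k)" for k
  define \<xi> where "\<xi> j = f' (x (t j)) (\<sigma> *v midpoint_moment w (t j) (t (Suc j)))" for j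
  define Q where "Q j = integral {t j..t (Suc j)} energy" for j
  have t_props: "0 \<le> t j" "t j < t (Suc j)" "t (Suc j) \<le> T" "t (Suc j) - t j = h" if "j < N" for j
  proof -
    show "0 \<le> t j" "t j < t (Suc j)" "t (Suc j) - t j = h"
      using h by (auto simp: t_def algebra_simps)
    have "real (Suc j) * h \<le> real N * h"
      using that h by (intro mult_right_mono) auto
    then show "t (Suc j) \<le> T" using h by (simp add: t_def)
  qed
  have hT: "h \<in> {0..T}" if "N > 0"
    using t_props[OF that] h by auto
  have B2: "B \<le> B\<^sup>2" "0 \<le> B" "0 \<le> B\<^sup>2" using B_ge_1 by (auto simp: power2_eq_square)
  have "1 \<le> B\<^sup>2" using B_ge_1 by simp
  then have h1: "h \<le> 1"
    using h mult_right_mono[of 1 "B\<^sup>2" h] by linarith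
  have c1: "norm (svv_c1 \<Gamma> h *v z) \<le> B * h * norm z"
    and c2: "norm (svv_c2 \<Gamma> h *v z) \<le> B * h * norm z"
    and c0: "norm (svv_c0 \<Gamma> h *v z - z) \<le> B * h * norm z"
    and c2': "norm (((1 / h) *\<^sub>R svv_c2 \<Gamma> h) *v z) \<le> B * h * norm z" if "N > 0" for z
  proof -
    show "norm (svv_c1 \<Gamma> h *v z) \<le> B * h * norm z" "norm (svv_c0 \<Gamma> h *v z - z) \<le> B * h * norm z"
      using c1_bound c0_minus_id_bound hT[OF that] by auto
    have *: "norm (svv_c2 \<Gamma> h *v z) \<le> B * h\<^sup>2 * norm z" using c2_bound hT[OF that] by auto
    also have "\<dots> \<le> B * h * norm z"
      using h h1 B2 by (intro mult_right_mono mult_left_mono) (auto simp: power2_eq_square mult_left_le)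
    finally show "norm (svv_c2 \<Gamma> h *v z) \<le> B * h * norm z" .
    show "norm (((1 / h) *\<^sub>R svv_c2 \<Gamma> h) *v z) \<le> B * h * norm z"
      using * h by (simp add: mv.scaleR_left power2_eq_square field_simps)
  qed
  have lip: "norm (f (x (t j)) - f (X j)) \<le> B * norm (ex j)" for j
    unfolding ex_def by (rule f_lipschitz)
  have lip': "norm (A *v (f (x (t j)) - f (X j))) \<le> B\<^sup>2 * h * norm (ex j)"
    if "norm (A *v (f (x (t j)) - f (X j))) \<le> B * h * norm (f (x (t j)) - f (X j))" for A j
  proof -
    have "B * h * norm (f (x (t j)) - f (X j)) \<le> B * h * (B * norm (ex j))"
      using h B2 lip by (intro mult_left_mono) auto
    then show ?thesis using that by (simp add: power2_eq_square algebra_simps)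
  qed
  have Bev: "B * h * norm z \<le> B\<^sup>2 * h * norm z" for z :: "real^'n"
    using h B2 by (intro mult_right_mono) auto
  have step_x: "norm (ex (Suc j) - ex j) \<le> B\<^sup>2 * h * (norm (ex j) + norm (ev j)) + B\<^sup>2 * h\<^sup>2 * Q j" if j: "j < N" for j
  proof -
    have N: "N > 0" using j by simp
    define R where "R = x (t (Suc j)) - position_step h (x (t j)) (v (t j)) (ou_position \<Gamma> \<sigma> w (t j) (t (Suc j)))"
    define z1 where "z1 = svv_c1 \<Gamma> h *v ev j"
    define z2 where "z2 = svv_c2 \<Gamma> h *v (f (x (t j)) - f (X j))"
    have "norm R \<le> B\<^sup>2 * h\<^sup>2 * Q j"
      using position_local_error[OF t_props(1-3)[OF j]] unfolding t_props(4)[OF j] R_def Q_def .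
    moreover have eq: "ex (Suc j) - ex j = z1 + z2 + R"
      using X_step[OF j] unfolding position_step_def ex_def ev_def R_def t_def z1_def z2_def by (simp add: mv.diff_right)
    moreover have "norm z1 \<le> B\<^sup>2 * h * norm (ev j)"
      using c1[OF N, of "ev j"] Bev[of "ev j"] unfolding z1_def by linarith
    moreover have "norm z2 \<le> B\<^sup>2 * h * norm (ex j)" unfolding z2_def by (intro lip' c2 N)
    moreover have "norm (z1 + z2 + R) \<le> norm z1 + norm z2 + norm R" by norm
    ultimately show ?thesis unfolding eq by (simp add: distrib_left mult.assoc)
  qed
  have step_v: "norm (ev (Suc j) - ev j - \<xi> j)
      \<le> B\<^sup>2 * h * (norm (ev j) + 2 * norm (ex j) + norm (ex (Suc j))) + 4 * B\<^sup>2 * h\<^sup>2 * Q j" if j: "j < N" for j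
  proof -
    have N: "N > 0" using j by simp
    define R where "R = v (t (Suc j)) - velocity_step h (x (t j)) (x (t (Suc j))) (v (t j))
        (ou_velocity \<Gamma> \<sigma> w (t j) (t (Suc j))) - \<xi> j"
    define z0 where "z0 = svv_c0 \<Gamma> h *v ev j - ev j"
    define z1 where "z1 = svv_c1 \<Gamma> h *v (f (x (t j)) - f (X j))"
    define z2 where "z2 = ((1 / h) *\<^sub>R svv_c2 \<Gamma> h) *v (f (x (t (Suc j))) - f (X (Suc j)))"
    define z3 where "z3 = ((1 / h) *\<^sub>R svv_c2 \<Gamma> h) *v (f (x (t j)) - f (X j))"
    have "norm R \<le> 4 * B\<^sup>2 * h\<^sup>2 * Q j"
      using velocity_local_error[OF t_props(1-3)[OF j]] unfolding t_props(4)[OF j] R_def Q_def \<xi>_def .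
    moreover have eq: "ev (Suc j) - ev j - \<xi> j = z0 + z1 + z2 - z3 + R"
      using V_step[OF j] unfolding velocity_step_def ev_def R_def t_def z0_def z1_def z2_def z3_def
      by (simp add: mv.diff_right)
    moreover have "norm z0 \<le> B\<^sup>2 * h * norm (ev j)"
      using c0[OF N, of "ev j"] Bev[of "ev j"] unfolding z0_def by linarith
    moreover have "norm z1 \<le> B\<^sup>2 * h * norm (ex j)" unfolding z1_def by (intro lip' c1 N)
    moreover have "norm z2 \<le> B\<^sup>2 * h * norm (ex (Suc j))" unfolding z2_def by (intro lip' c2' N)
    moreover have "norm z3 \<le> B\<^sup>2 * h * norm (ex j)" unfolding z3_def by (intro lip' c2' N)
    moreover have "norm (z0 + z1 + z2 - z3 + R) \<le> norm z0 + norm z1 + norm z2 + norm z3 + norm R"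
      by norm
    ultimately show ?thesis unfolding eq by (simp add: distrib_left mult.assoc)
  qed
  have Q_nonneg: "0 \<le> Q j" if "j < N" for j
    unfolding Q_def using order_trans[OF zero_le_one energy_bounds(1)] t_props[OF that]
    by (intro integral_nonneg integrable_continuous_real cont_energy) auto
  have Q_sum: "(\<Sum>j<k. Q j) \<le> integral {0..T} energy" if "k \<le> N" for k
  proof -
    have "(\<Sum>j<k. Q j) \<le> (\<Sum>j<N. Q j)"
      using that Q_nonneg by (intro sum_mono2) auto
    also have "\<dots> = integral {0..T} energy"
    proof -
      have "is_partition 0 T N t"
        using h t_props(2) by (auto simp: is_partition_def t_def)
      then show ?thesis unfolding Q_def by (rule sum_integral_partition) (intro cont_energy order_refl)
    qed
    finally show ?thesis .
  qed
  define A where "A = S + 5 * B\<^sup>2 * h\<^sup>2 * integral {0..T} energy"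
  have S_nonneg: "0 \<le> S" using S[of 0] by simp
  have Q0: "0 \<le> integral {0..T} energy" using Q_sum[of 0] by simp
  have A_nonneg: "0 \<le> A" unfolding A_def using S_nonneg Q0 by simp
  have d_bound: "d k \<le> 2 * A + 12 * B\<^sup>2 * h * (\<Sum>j<k. d j)" if k: "k \<le> N" for k
  proof -
    have ex0: "ex 0 = 0" "ev 0 = 0" using init by (simp_all add: ex_def ev_def t_def)
    have "ex k = (\<Sum>j<k. ex (Suc j) - ex j)" using ex0 by (simp add: sum_lessThan_telescope)
    then have nx: "norm (ex k) \<le> (\<Sum>j<k. norm (ex (Suc j) - ex j))" by (metis norm_sum)
    have "ev k = (\<Sum>j<k. ev (Suc j) - ev j - \<xi> j) + (\<Sum>j<k. \<xi> j)"
      using ex0 sum_lessThan_telescope[of ev k] by (simp add: sum_subtractf)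
    then have "norm (ev k) \<le> norm (\<Sum>j<k. ev (Suc j) - ev j - \<xi> j) + norm (\<Sum>j<k. \<xi> j)"
      by (metis norm_triangle_ineq)
    then have nv: "norm (ev k) \<le> (\<Sum>j<k. norm (ev (Suc j) - ev j - \<xi> j)) + S"
      using S[OF k] norm_sum[of "\<lambda>j. ev (Suc j) - ev j - \<xi> j" "{..<k}"]
      unfolding \<xi>_def t_def by linarith
    have "d k \<le> (\<Sum>j<k. norm (ex (Suc j) - ex j) + norm (ev (Suc j) - ev j - \<xi> j)) + S"
      using nx nv by (simp add: d_def sum.distrib)
    also have "(\<Sum>j<k. norm (ex (Suc j) - ex j) + norm (ev (Suc j) - ev j - \<xi> j))
        \<le> (\<Sum>j<k. 3 * B\<^sup>2 * h * (d j + d (Suc j)) + 5 * B\<^sup>2 * h\<^sup>2 * Q j)"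
    proof (rule sum_mono)
      fix j assume "j \<in> {..<k}"
      then have j: "j < N" using k by simp
      have "0 \<le> B\<^sup>2 * h" using h B2 by simp
      then have "0 \<le> B\<^sup>2 * h * norm (ev j)" "0 \<le> B\<^sup>2 * h * norm (ev (Suc j))"
        "0 \<le> B\<^sup>2 * h * norm (ex j)" "0 \<le> B\<^sup>2 * h * norm (ex (Suc j))" by simp_all
      then show "norm (ex (Suc j) - ex j) + norm (ev (Suc j) - ev j - \<xi> j)
          \<le> 3 * B\<^sup>2 * h * (d j + d (Suc j)) + 5 * B\<^sup>2 * h\<^sup>2 * Q j"
        using step_x[OF j] step_v[OF j] unfolding d_def by (simp add: algebra_simps)
    qed
    also have "\<dots> = 3 * B\<^sup>2 * h * ((\<Sum>j<k. d j) + (\<Sum>j<k. d (Suc j))) + 5 * B\<^sup>2 * h\<^sup>2 * (\<Sum>j<k. Q j)"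
      by (simp only: sum.distrib sum_distrib_left[symmetric])
    also have "\<dots> \<le> 3 * B\<^sup>2 * h * (2 * (\<Sum>j<k. d j) + d k) + 5 * B\<^sup>2 * h\<^sup>2 * integral {0..T} energy"
    proof -
      have "(\<Sum>j<k. d (Suc j)) = (\<Sum>j<k. d j) + d k - d 0"
        using sum_lessThan_telescope[of d k] by (simp add: sum_subtractf)
      moreover have "0 \<le> d 0" by (simp add: d_def)
      ultimately have le: "(\<Sum>j<k. d j) + (\<Sum>j<k. d (Suc j)) \<le> 2 * (\<Sum>j<k. d j) + d k" by simp
      show ?thesis
        by (intro add_mono mult_left_mono le Q_sum[OF k]) (use h in auto)
    qed
    finally have "d k \<le> 6 * B\<^sup>2 * h * (\<Sum>j<k. d j) + 3 * B\<^sup>2 * h * d k + A"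
      unfolding A_def by (simp add: algebra_simps)
    moreover have "3 * B\<^sup>2 * h * d k \<le> (1 / 2) * d k"
      using h by (intro mult_right_mono) (auto simp: d_def)
    ultimately show ?thesis by linarith
  qed
  have "d k \<le> 2 * A * exp (12 * B\<^sup>2 * h * real N)"
    using h B2 A_nonneg by (intro gronwall_sum[OF _ _ d_bound k]) auto
  moreover have exp_arg: "12 * B\<^sup>2 * h * real N = 12 * B\<^sup>2 * T"
    unfolding h(2)[symmetric] by (simp only: mult_ac)
  moreover have "norm (ex k, ev k) \<le> d k"
    unfolding d_def norm_Pair by (rule sqrt_sum_squares_le_sum) auto
  ultimately show ?thesis
    unfolding exp_arg unfolding ex_def ev_def t_def A_def by (simp only: mult_ac)
qed

end

section \<open>Square integrable random vectors\<close>

definition square_integrable :: "'a measure \<Rightarrow> ('a \<Rightarrow> 'b::euclidean_space) \<Rightarrow> bool" where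
  "square_integrable M X \<longleftrightarrow> X \<in> borel_measurable M \<and> integrable M (\<lambda>\<omega>. (norm (X \<omega>))\<^sup>2)"

lemma square_integrableD:
  assumes "square_integrable M X"
  shows "X \<in> borel_measurable M" "integrable M (\<lambda>\<omega>. (norm (X \<omega>))\<^sup>2)"
  using assms by (auto simp: square_integrable_def)

lemma square_integrable_bounded:
  assumes X: "square_integrable M X" and Y: "Y \<in> borel_measurable M"
    and le: "\<And>\<omega>. norm (Y \<omega>) \<le> c * norm (X \<omega>)"
  shows "square_integrable M Y"
  unfolding square_integrable_def
proof
  show "integrable M (\<lambda>\<omega>. (norm (Y \<omega>))\<^sup>2)"
  proof (rule Bochner_Integration.integrable_bound)
    show "integrable M (\<lambda>\<omega>. c\<^sup>2 * (norm (X \<omega>))\<^sup>2)"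
      using square_integrableD[OF X] by simp
    show "AE \<omega> in M. norm ((norm (Y \<omega>))\<^sup>2) \<le> norm (c\<^sup>2 * (norm (X \<omega>))\<^sup>2)"
      using power_mono[OF le norm_ge_zero, of _ 2] by (auto simp: power_mult_distrib)
  qed (use Y in measurable)
qed fact

lemma square_integrable_add:
  assumes X: "square_integrable M X" and Y: "square_integrable M Y"
  shows "square_integrable M (\<lambda>\<omega>. X \<omega> + Y \<omega>)"
  unfolding square_integrable_def
proof
  note [measurable] = square_integrableD(1)[OF X] square_integrableD(1)[OF Y]
  show "(\<lambda>\<omega>. X \<omega> + Y \<omega>) \<in> borel_measurable M" by measurable
  show "integrable M (\<lambda>\<omega>. (norm (X \<omega> + Y \<omega>))\<^sup>2)"
  proof (rule Bochner_Integration.integrable_bound)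
    show "integrable M (\<lambda>\<omega>. 2 * (norm (X \<omega>))\<^sup>2 + 2 * (norm (Y \<omega>))\<^sup>2)"
      using square_integrableD(2)[OF X] square_integrableD(2)[OF Y] by simp
    have "(norm (x + y))\<^sup>2 \<le> 2 * (norm x)\<^sup>2 + 2 * (norm y)\<^sup>2" for x y :: 'b
    proof -
      have "(norm (x + y))\<^sup>2 \<le> (norm x + norm y)\<^sup>2"
        by (intro power_mono norm_triangle_ineq) auto
      then show ?thesis
        using sum_squares_bound[of "norm x" "norm y"] by (simp add: power2_sum)
    qed
    then show "AE \<omega> in M. norm ((norm (X \<omega> + Y \<omega>))\<^sup>2) \<le> norm (2 * (norm (X \<omega>))\<^sup>2 + 2 * (norm (Y \<omega>))\<^sup>2)"
      by (intro AE_I2) simp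
  qed measurable
qed

lemma square_integrable_zero: "square_integrable M (\<lambda>_. 0)"
  by (simp add: square_integrable_def)

lemma square_integrable_sum:
  assumes "\<And>i. i \<in> I \<Longrightarrow> square_integrable M (X i)"
  shows "square_integrable M (\<lambda>\<omega>. \<Sum>i\<in>I. X i \<omega>)"
  using assms
  by (induction I rule: infinite_finite_induct) (auto intro: square_integrable_add square_integrable_zero)

lemma square_integrable_scaleR:
  assumes "square_integrable M X" shows "square_integrable M (\<lambda>\<omega>. c *\<^sub>R X \<omega>)"
proof (rule square_integrable_bounded[OF assms, of _ "\<bar>c\<bar>"])
  show "(\<lambda>\<omega>. c *\<^sub>R X \<omega>) \<in> borel_measurable M"
    using square_integrableD(1)[OF assms] by measurable
qed simp

lemma square_integrable_diff:
  assumes "square_integrable M X" "square_integrable M Y"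
  shows "square_integrable M (\<lambda>\<omega>. X \<omega> - Y \<omega>)"
  using square_integrable_add[OF assms(1) square_integrable_scaleR[OF assms(2), of "-1"]] by simp

lemma integrable_inner_square_integrable:
  assumes X: "square_integrable M X" and Y: "square_integrable M Y"
  shows "integrable M (\<lambda>\<omega>. X \<omega> \<bullet> Y \<omega>)"
proof (rule Bochner_Integration.integrable_bound)
  show "integrable M (\<lambda>\<omega>. (norm (X \<omega>))\<^sup>2 + (norm (Y \<omega>))\<^sup>2)"
    using square_integrableD(2)[OF X] square_integrableD(2)[OF Y] by simp
  have "\<bar>x \<bullet> y\<bar> \<le> (norm x)\<^sup>2 + (norm y)\<^sup>2" for x y :: 'b
  proof -
    have "\<bar>x \<bullet> y\<bar> \<le> norm x * norm y" by (rule Cauchy_Schwarz_ineq2)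
    moreover have "0 \<le> norm x * norm y" by simp
    ultimately show ?thesis using sum_squares_bound[of "norm x" "norm y"] by linarith
  qed
  then show "AE \<omega> in M. norm (X \<omega> \<bullet> Y \<omega>) \<le> norm ((norm (X \<omega>))\<^sup>2 + (norm (Y \<omega>))\<^sup>2)"
    by (intro AE_I2) simp
  show "(\<lambda>\<omega>. X \<omega> \<bullet> Y \<omega>) \<in> borel_measurable M"
    using square_integrableD(1)[OF X] square_integrableD(1)[OF Y] by measurable
qed


section \<open>Doob's maximal inequality\<close>

primrec running_max :: "(nat \<Rightarrow> real) \<Rightarrow> nat \<Rightarrow> real" where
  "running_max s 0 = s 0"
| "running_max s (Suc n) = max (running_max s n) (s (Suc n))"

lemma running_max_eq_Max: "running_max s n = (MAX k\<in>{..n}. s k)"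
  by (induction n) (simp_all add: atMost_Suc max.commute)

lemma running_max_ge: "s n \<le> running_max s n"
  by (cases n) auto

text \<open>A deterministic inequality behind the maximal inequality. With
  \<open>m = running_max s\<close>, the quantity \<open>2 m n * s n - (m n)\<^sup>2 - 2 * (\<Sum>k<n. m k * (s (k + 1) - s k))\<close> is
  unchanged by a step that sets no new maximum and grows by \<open>(s (n + 1) - m n)\<^sup>2\<close> otherwise.\<close>

lemma pathwise_doob:
  assumes nonneg: "\<And>k. 0 \<le> s k"
  shows "(running_max s n)\<^sup>2 \<le> 4 * (s n)\<^sup>2 - 4 * (\<Sum>k<n. running_max s k * (s (Suc k) - s k))"
proof -
  define m where "m = running_max s"
  have "m n * m n + 2 * (\<Sum>k<n. m k * (s (Suc k) - s k)) \<le> 2 * (m n * s n)"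
  proof (induction n)
    case 0
    then show ?case using nonneg[of 0] by (simp add: m_def)
  next
    case (Suc n)
    show ?case
    proof (cases "s (Suc n) \<le> m n")
      case True
      then have "m (Suc n) = m n" by (simp add: m_def max_absorb1)
      then show ?thesis using Suc by (simp add: algebra_simps)
    next
      case False
      then have "m (Suc n) = s (Suc n)" by (simp add: m_def max_absorb2)
      moreover have "0 \<le> (s (Suc n) - m n) * (s (Suc n) - m n)" by simp
      ultimately show ?thesis using Suc by (simp add: algebra_simps)
    qed
  qed
  moreover have "0 \<le> (m n - 2 * s n)\<^sup>2" by simp
  ultimately show ?thesis by (simp add: m_def power2_eq_square algebra_simps)
qed

lemma norm_increment_ge:
  fixes x y :: "'b::euclidean_space"
  shows "sgn x \<bullet> y \<le> norm (x + y) - norm x"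
proof (cases "x = 0")
  case False
  have "sgn x \<bullet> (x + y) \<le> norm (sgn x) * norm (x + y)" by (rule norm_cauchy_schwarz)
  moreover have "sgn x \<bullet> x = norm x"
    using False by (simp add: sgn_div_norm dot_square_norm power2_eq_square)
  ultimately show ?thesis using False by (simp add: norm_sgn inner_add_right)
qed simp

text \<open>The martingale property is stated as orthogonality of each increment to square integrable random
  vectors of the past. It is used twice: for the past vector \<open>running maximum\<close> times \<open>sgn\<close> of the partial
  sum, which linearizes the growth of the norm, and for the partial sum itself, which gives the
  additivity of the second moments.\<close>

lemma doob_maximal_inequality:
  fixes \<xi> :: "nat \<Rightarrow> 'a \<Rightarrow> 'b::euclidean_space"
  assumes sub: "\<And>k. k \<le> N \<Longrightarrow> subalgebra M (G k)"
    and mono: "\<And>j k. j \<le> k \<Longrightarrow> k \<le> N \<Longrightarrow> sets (G j) \<subseteq> sets (G k)"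
    and adapted: "\<And>k. k < N \<Longrightarrow> \<xi> k \<in> borel_measurable (G (Suc k))"
    and sq: "\<And>k. k < N \<Longrightarrow> square_integrable M (\<xi> k)"
    and orth: "\<And>k Y. k < N \<Longrightarrow> Y \<in> borel_measurable (G k) \<Longrightarrow> square_integrable M Y
      \<Longrightarrow> (\<integral>\<omega>. Y \<omega> \<bullet> \<xi> k \<omega> \<partial>M) = 0"
  shows "(\<integral>\<^sup>+\<omega>. ennreal ((MAX k\<in>{..N}. norm (\<Sum>j<k. \<xi> j \<omega>))\<^sup>2) \<partial>M)
    \<le> ennreal (4 * (\<Sum>j<N. \<integral>\<omega>. (norm (\<xi> j \<omega>))\<^sup>2 \<partial>M))"
proof -
  define S where "S k \<omega> = (\<Sum>j<k. \<xi> j \<omega>)" for k \<omega>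
  define m where "m k \<omega> = running_max (\<lambda>k. norm (S k \<omega>)) k" for k \<omega>
  have sub_mono: "subalgebra (G k) (G j)" if "j \<le> k" "k \<le> N" for j k
    using sub[of j] sub[of k] mono[OF that] that by (auto simp: subalgebra_def)
  have S_meas: "S k \<in> borel_measurable (G l)" if "k \<le> l" "l \<le> N" for k l
    unfolding S_def
  proof (rule borel_measurable_sum)
    fix j assume "j \<in> {..<k}"
    then show "\<xi> j \<in> borel_measurable (G l)"
      using that by (intro measurable_from_subalg[OF sub_mono[of "Suc j" l] adapted]) auto
  qed
  have m_meas: "m k \<in> borel_measurable (G l)" if "k \<le> l" "l \<le> N" for k l
    using that
  proof (induction k)
    case 0
    then show ?case using S_meas[of 0 l] unfolding m_def by (simp add: S_def)
  next
    case (Suc k)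
    then have [measurable]: "m k \<in> borel_measurable (G l)" "S (Suc k) \<in> borel_measurable (G l)"
      using S_meas[of "Suc k" l] by auto
    have "m (Suc k) = (\<lambda>\<omega>. max (m k \<omega>) (norm (S (Suc k) \<omega>)))" by (simp add: m_def fun_eq_iff)
    then show ?case by simp
  qed
  have S_sq: "square_integrable M (S k)" if "k \<le> N" for k
    unfolding S_def using that by (intro square_integrable_sum sq) auto
  have m_nonneg: "0 \<le> m k \<omega>" for k \<omega>
    unfolding m_def using order_trans[OF norm_ge_zero running_max_ge] .
  \<comment> \<open>the integrand of the martingale transform\<close>
  define Y where "Y k \<omega> = m k \<omega> *\<^sub>R sgn (S k \<omega>)" for k \<omega>
  have Y_meas: "Y k \<in> borel_measurable (G k)" if "k \<le> N" for k
    using m_meas[OF order_refl that] S_meas[OF order_refl that]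
    unfolding Y_def sgn_div_norm by measurable
  have m_sq: "square_integrable M (m k)" if "k \<le> N" for k
    using that
  proof (induction k)
    case 0
    then show ?case by (simp add: m_def[abs_def] S_def square_integrable_zero)
  next
    case (Suc k)
    have meas: "(\<lambda>\<omega>. norm (S (Suc k) \<omega>)) \<in> borel_measurable M"
      using square_integrableD(1)[OF S_sq[OF Suc.prems]] by measurable
    have nS: "square_integrable M (\<lambda>\<omega>. norm (S (Suc k) \<omega>))"
      by (rule square_integrable_bounded[OF S_sq[OF Suc.prems] meas, of 1]) simp
    have meas': "m (Suc k) \<in> borel_measurable M"
      using measurable_from_subalg[OF sub[OF Suc.prems] m_meas[OF order_refl Suc.prems]] .
    show ?case
    proof (rule square_integrable_bounded[OF _ meas', of _ 1])
      show "square_integrable M (\<lambda>\<omega>. m k \<omega> + norm (S (Suc k) \<omega>))"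
        using Suc by (intro square_integrable_add nS) auto
      show "norm (m (Suc k) \<omega>) \<le> 1 * norm (m k \<omega> + norm (S (Suc k) \<omega>))" for \<omega>
        using m_nonneg[of k \<omega>] m_nonneg[of "Suc k" \<omega>] unfolding m_def by simp
    qed
  qed
  have Y_sq: "square_integrable M (Y k)" if "k \<le> N" for k
  proof (rule square_integrable_bounded[OF m_sq[OF that], of _ 1])
    show "Y k \<in> borel_measurable M"
      by (rule measurable_from_subalg[OF sub[OF that] Y_meas[OF that]])
    show "norm (Y k \<omega>) \<le> 1 * norm (m k \<omega>)" for \<omega>
      by (simp add: Y_def norm_sgn)
  qed
  have energy: "(\<integral>\<omega>. (norm (S k \<omega>))\<^sup>2 \<partial>M) = (\<Sum>j<k. \<integral>\<omega>. (norm (\<xi> j \<omega>))\<^sup>2 \<partial>M)" if "k \<le> N" for k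
    using that
  proof (induction k)
    case 0
    then show ?case by (simp add: S_def)
  next
    case (Suc k)
    have k: "k < N" "k \<le> N" using Suc.prems by auto
    have "(norm (S (Suc k) \<omega>))\<^sup>2 = (norm (S k \<omega>))\<^sup>2 + (norm (\<xi> k \<omega>))\<^sup>2 + 2 * (S k \<omega> \<bullet> \<xi> k \<omega>)" for \<omega>
      by (simp add: S_def power2_norm_eq_inner inner_add_left inner_add_right inner_commute)
    then have "(\<integral>\<omega>. (norm (S (Suc k) \<omega>))\<^sup>2 \<partial>M) = (\<integral>\<omega>. (norm (S k \<omega>))\<^sup>2 \<partial>M)
        + (\<integral>\<omega>. (norm (\<xi> k \<omega>))\<^sup>2 \<partial>M) + 2 * (\<integral>\<omega>. S k \<omega> \<bullet> \<xi> k \<omega> \<partial>M)"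
      using square_integrableD(2)[OF S_sq[OF k(2)]] square_integrableD(2)[OF sq[OF k(1)]]
        integrable_inner_square_integrable[OF S_sq[OF k(2)] sq[OF k(1)]]
      by simp
    then show ?case
      using Suc.IH[OF k(2)] orth[OF k(1) S_meas[OF order_refl k(2)] S_sq[OF k(2)]] by simp
  qed
  have path: "(m N \<omega>)\<^sup>2 \<le> 4 * (norm (S N \<omega>))\<^sup>2 - 4 * (\<Sum>k<N. Y k \<omega> \<bullet> \<xi> k \<omega>)" for \<omega>
  proof -
    have "(m N \<omega>)\<^sup>2 \<le> 4 * (norm (S N \<omega>))\<^sup>2
        - 4 * (\<Sum>k<N. m k \<omega> * (norm (S (Suc k) \<omega>) - norm (S k \<omega>)))"
      unfolding m_def by (rule pathwise_doob) simp
    moreover have "(\<Sum>k<N. Y k \<omega> \<bullet> \<xi> k \<omega>) \<le> (\<Sum>k<N. m k \<omega> * (norm (S (Suc k) \<omega>) - norm (S k \<omega>)))"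
    proof (rule sum_mono)
      show "Y k \<omega> \<bullet> \<xi> k \<omega> \<le> m k \<omega> * (norm (S (Suc k) \<omega>) - norm (S k \<omega>))" for k
        using mult_left_mono[OF norm_increment_ge[of "S k \<omega>" "\<xi> k \<omega>"] m_nonneg[of k \<omega>]]
        by (simp add: Y_def S_def)
    qed
    ultimately show ?thesis by linarith
  qed
  have int: "integrable M (\<lambda>\<omega>. 4 * (norm (S N \<omega>))\<^sup>2 - 4 * (\<Sum>k<N. Y k \<omega> \<bullet> \<xi> k \<omega>))"
    using square_integrableD(2)[OF S_sq[of N]] integrable_inner_square_integrable[OF Y_sq sq]
    by (intro Bochner_Integration.integrable_diff integrable_mult_right Bochner_Integration.integrable_sum) auto
  have "(\<integral>\<^sup>+\<omega>. ennreal ((MAX k\<in>{..N}. norm (\<Sum>j<k. \<xi> j \<omega>))\<^sup>2) \<partial>M) = (\<integral>\<^sup>+\<omega>. ennreal ((m N \<omega>)\<^sup>2) \<partial>M)"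
    by (simp add: m_def running_max_eq_Max S_def)
  also have "\<dots> \<le> (\<integral>\<^sup>+\<omega>. ennreal (4 * (norm (S N \<omega>))\<^sup>2 - 4 * (\<Sum>k<N. Y k \<omega> \<bullet> \<xi> k \<omega>)) \<partial>M)"
    by (intro nn_integral_mono ennreal_leI path)
  also have "\<dots> = ennreal (\<integral>\<omega>. 4 * (norm (S N \<omega>))\<^sup>2 - 4 * (\<Sum>k<N. Y k \<omega> \<bullet> \<xi> k \<omega>) \<partial>M)"
    using order_trans[OF zero_le_power2 path] by (intro nn_integral_eq_integral int AE_I2) auto
  also have "(\<integral>\<omega>. 4 * (norm (S N \<omega>))\<^sup>2 - 4 * (\<Sum>k<N. Y k \<omega> \<bullet> \<xi> k \<omega>) \<partial>M)
      = 4 * (\<integral>\<omega>. (norm (S N \<omega>))\<^sup>2 \<partial>M) - 4 * (\<Sum>k<N. \<integral>\<omega>. Y k \<omega> \<bullet> \<xi> k \<omega> \<partial>M)"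
    using square_integrableD(2)[OF S_sq[of N]] integrable_inner_square_integrable[OF Y_sq sq]
    by (subst Bochner_Integration.integral_diff)
      (auto intro!: Bochner_Integration.integrable_sum simp: Bochner_Integration.integral_sum)
  also have "(\<Sum>k<N. \<integral>\<omega>. Y k \<omega> \<bullet> \<xi> k \<omega> \<partial>M) = 0"
    by (intro sum.neutral ballI orth Y_meas Y_sq) auto
  finally show ?thesis using energy[of N] by simp
qed

section \<open>Increments of Brownian motion\<close>

lemma borel_measurable_vec_nth [measurable (raw)]:
  fixes X :: "'a \<Rightarrow> real^'n"
  assumes [measurable]: "X \<in> borel_measurable M"
  shows "(\<lambda>\<omega>. X \<omega> $ i) \<in> borel_measurable M"
  unfolding cart_eq_inner_axis by measurable

lemma (in prob_space) integrable_of_square_integrable: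
  fixes X :: "'a \<Rightarrow> real"
  assumes "square_integrable M X" shows "integrable M X"
proof -
  have "square_integrable M (\<lambda>_. 1 :: real)" by (simp add: square_integrable_def)
  from integrable_inner_square_integrable[OF assms this] show ?thesis by simp
qed

lemma square_integrable_component:
  fixes X :: "'a \<Rightarrow> real^'n"
  assumes "square_integrable M X" shows "square_integrable M (\<lambda>\<omega>. X \<omega> $ i)"
proof (rule square_integrable_bounded[OF assms, of _ 1])
  show "(\<lambda>\<omega>. X \<omega> $ i) \<in> borel_measurable M"
    by (rule borel_measurable_vec_nth[OF square_integrableD(1)[OF assms]])
qed (simp add: component_le_norm_cart)

lemma square_integrable_real_iff:
  fixes X :: "'a \<Rightarrow> real"
  shows "square_integrable M X \<longleftrightarrow> X \<in> borel_measurable M \<and> integrable M (\<lambda>\<omega>. (X \<omega>)\<^sup>2)"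
  by (simp add: square_integrable_def)

lemma square_integrable_mult_integrable:
  fixes X Y :: "'a \<Rightarrow> real"
  assumes "square_integrable M X" "square_integrable M Y"
  shows "integrable M (\<lambda>\<omega>. X \<omega> * Y \<omega>)"
  using integrable_inner_square_integrable[OF assms] by simp

context brownian_motion
begin

lemma W_measurable: "0 \<le> t \<Longrightarrow> W t \<in> borel_measurable M"
  using measurable_from_subalg[OF filtration_subalgebra adapted] by blast

lemma W_measurable_past: "0 \<le> s \<Longrightarrow> s \<le> t \<Longrightarrow> W s \<in> borel_measurable (F t)"
proof -
  assume "0 \<le> s" "s \<le> t"
  then have "subalgebra (F t) (F s)"
    using filtration_subalgebra[of s] filtration_subalgebra[of t] filtration_mono[of s t]
    by (auto simp: subalgebra_def)
  then show ?thesis using adapted[OF \<open>0 \<le> s\<close>] by (rule measurable_from_subalg)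
qed

lemma component_increment:
  assumes st: "0 \<le> s" "s < t"
  shows "square_integrable M (\<lambda>\<omega>. W t \<omega> $ i - W s \<omega> $ i)"
    and "expectation (\<lambda>\<omega>. W t \<omega> $ i - W s \<omega> $ i) = 0"
    and "expectation (\<lambda>\<omega>. (W t \<omega> $ i - W s \<omega> $ i)\<^sup>2) = t - s"
proof -
  have pos: "0 < sqrt (t - s)" using st by simp
  note D = increment_normal[OF st, of i]
  show E0: "expectation (\<lambda>\<omega>. W t \<omega> $ i - W s \<omega> $ i) = 0"
    by (rule normal_distributed_expectation[OF pos D])
  show "expectation (\<lambda>\<omega>. (W t \<omega> $ i - W s \<omega> $ i)\<^sup>2) = t - s"
    using normal_distributed_variance[OF pos D] st unfolding E0 by simp
  have [measurable]: "W t \<in> borel_measurable M" "W s \<in> borel_measurable M"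
    using st by (auto intro: W_measurable)
  have "integrable lborel (\<lambda>x. normal_density 0 (sqrt (t - s)) x * x\<^sup>2)"
    using integrable_normal_moment[OF pos, of 0 2] by simp
  then have "integrable M (\<lambda>\<omega>. (W t \<omega> $ i - W s \<omega> $ i)\<^sup>2)"
    by (subst (asm) distributed_integrable[OF D]) auto
  moreover have "(\<lambda>\<omega>. W t \<omega> $ i - W s \<omega> $ i) \<in> borel_measurable M" by measurable
  ultimately show "square_integrable M (\<lambda>\<omega>. W t \<omega> $ i - W s \<omega> $ i)"
    unfolding square_integrable_real_iff by simp
qed

lemma increment_square_integrable:
  assumes st: "0 \<le> s" "s \<le> t"
  shows "square_integrable M (\<lambda>\<omega>. W t \<omega> - W s \<omega>)"
proof (cases "s = t")
  case True
  then show ?thesis by (simp add: square_integrable_zero)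
next
  case False
  then have "s < t" using st by simp
  note c = component_increment[OF st(1) this]
  have [measurable]: "W t \<in> borel_measurable M" "W s \<in> borel_measurable M"
    using st by (auto intro: W_measurable)
  have norm2: "(norm (W t \<omega> - W s \<omega>))\<^sup>2 = (\<Sum>i\<in>UNIV. (W t \<omega> $ i - W s \<omega> $ i)\<^sup>2)" for \<omega>
    by (simp add: norm_vec_def L2_set_def sum_nonneg)
  have "integrable M (\<lambda>\<omega>. (norm (W t \<omega> - W s \<omega>))\<^sup>2)"
    unfolding norm2 using c(1) by (auto simp: square_integrable_real_iff)
  then show ?thesis unfolding square_integrable_def by simp
qed

text \<open>Independence of the past is only given for single increments, and only this orthogonality is
  extracted from it. Linear combinations of increments from a common starting time inherit it.\<close>

lemma past_increment_component:
  assumes st: "0 \<le> s" "s \<le> t" and Y: "Y \<in> borel_measurable (F s)" "square_integrable M Y"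
  shows "expectation (\<lambda>\<omega>. Y \<omega> * (W t \<omega> $ i - W s \<omega> $ i)) = 0"
proof (cases "s = t")
  case False
  then have "s < t" using st by simp
  note c = component_increment[OF st(1) this, of i]
  have [measurable]: "W t \<in> borel_measurable M" "W s \<in> borel_measurable M" "Y \<in> borel_measurable M"
    using st Y by (auto intro: W_measurable square_integrableD)
  define P where "P = {(\<lambda>\<omega>. W t \<omega> - W s \<omega>) -` B \<inter> space M | B. B \<in> sets borel}"
  have P_sub: "sigma_sets (space M) {(\<lambda>\<omega>. W t \<omega> $ i - W s \<omega> $ i) -` A \<inter> space M | A. A \<in> sets borel} \<subseteq> P"
  proof -
    have P_eq: "sigma_sets (space M) P = P"
    proof -
      have "P = sets (vimage_algebra (space M) (\<lambda>\<omega>. W t \<omega> - W s \<omega>) borel)"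
        unfolding P_def by (rule sets_vimage_algebra2[symmetric]) simp
      then show ?thesis
        using sets.sigma_sets_eq[of "vimage_algebra (space M) (\<lambda>\<omega>. W t \<omega> - W s \<omega>) borel"] by simp
    qed
    have sub: "{(\<lambda>\<omega>. W t \<omega> $ i - W s \<omega> $ i) -` A \<inter> space M | A. A \<in> sets borel} \<subseteq> P"
    proof
      fix E assume "E \<in> {(\<lambda>\<omega>. W t \<omega> $ i - W s \<omega> $ i) -` A \<inter> space M | A. A \<in> sets borel}"
      then obtain A where A: "A \<in> sets borel" and E: "E = (\<lambda>\<omega>. W t \<omega> $ i - W s \<omega> $ i) -` A \<inter> space M"
        by blast
      have "(\<lambda>z. z $ i) -` A \<inter> space borel \<in> sets (borel :: (real^'n) measure)"
        by (intro measurable_sets[OF _ A]) measurable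
      moreover have "E = (\<lambda>\<omega>. W t \<omega> - W s \<omega>) -` ((\<lambda>z. z $ i) -` A \<inter> space borel) \<inter> space M"
        unfolding E by auto
      ultimately show "E \<in> P" unfolding P_def by blast
    qed
    show ?thesis using sigma_sets_mono'[OF sub, of "space M"] unfolding P_eq .
  qed
  have F_sub: "sigma_sets (space M) {Y -` A \<inter> space M | A. A \<in> sets borel} \<subseteq> sets (F s)"
  proof -
    have sp: "space (F s) = space M"
      using filtration_subalgebra[OF st(1)] by (simp add: subalgebra_def)
    have "{Y -` A \<inter> space M | A. A \<in> sets borel} \<subseteq> sets (F s)"
      using measurable_sets[OF Y(1)] by (auto simp: sp)
    from sets.sigma_sets_subset[OF this] show ?thesis unfolding sp .
  qed
  have indep: "indep_var borel Y borel (\<lambda>\<omega>. W t \<omega> $ i - W s \<omega> $ i)"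
    unfolding indep_var_eq
  proof (intro conjI)
    show "Y \<in> borel_measurable M" by fact
    show "(\<lambda>\<omega>. W t \<omega> $ i - W s \<omega> $ i) \<in> borel_measurable M" by measurable
    show "indep_set (sigma_sets (space M) {Y -` A \<inter> space M | A. A \<in> sets borel})
        (sigma_sets (space M) {(\<lambda>\<omega>. W t \<omega> $ i - W s \<omega> $ i) -` A \<inter> space M | A. A \<in> sets borel})"
      using increment_indep_past[OF st(1) \<open>s < t\<close>] unfolding indep_sets2_eq P_def[symmetric]
      by (blast dest: subsetD[OF F_sub] subsetD[OF P_sub])
  qed
  show ?thesis
    using indep_var_lebesgue_integral[OF indep integrable_of_square_integrable[OF Y(2)]
        integrable_of_square_integrable[OF c(1)]] unfolding c(2) by simp
qed simp

lemma past_increment: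
  assumes st: "0 \<le> s" "s \<le> t" and Y: "Y \<in> borel_measurable (F s)" "square_integrable M Y"
  shows "expectation (\<lambda>\<omega>. Y \<omega> \<bullet> (W t \<omega> - W s \<omega>)) = 0"
proof -
  have Yi: "square_integrable M (\<lambda>\<omega>. Y \<omega> $ i)" "(\<lambda>\<omega>. Y \<omega> $ i) \<in> borel_measurable (F s)" for i
    by (intro square_integrable_component[OF Y(2)] borel_measurable_vec_nth[OF Y(1)])+
  have int: "integrable M (\<lambda>\<omega>. Y \<omega> $ i * (W t \<omega> $ i - W s \<omega> $ i))" for i
    using square_integrable_mult_integrable[OF Yi(1)
        square_integrable_component[OF increment_square_integrable[OF st]], of i i] by simp
  have "expectation (\<lambda>\<omega>. Y \<omega> \<bullet> (W t \<omega> - W s \<omega>))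
      = (\<Sum>i\<in>UNIV. expectation (\<lambda>\<omega>. Y \<omega> $ i * (W t \<omega> $ i - W s \<omega> $ i)))"
    by (simp add: inner_vec_def Bochner_Integration.integral_sum[OF int])
  also have "\<dots> = 0" by (intro sum.neutral ballI past_increment_component st Yi)
  finally show ?thesis .
qed

lemma increment_covariance_same:
  assumes st: "0 \<le> s" "s \<le> t"
  shows "expectation (\<lambda>\<omega>. (W t \<omega> $ i - W s \<omega> $ i) * (W t \<omega> $ j - W s \<omega> $ j)) = (if i = j then t - s else 0)"
proof (cases "s = t")
  case False
  then have st': "s < t" using st by simp
  note c = component_increment[OF st(1) this]
  show ?thesis
  proof (cases "i = j")
    case True
    then show ?thesis using c(3)[of j] by (simp add: power2_eq_square)
  next
    case False
    have "indep_vars (\<lambda>_. borel) (\<lambda>k \<omega>. W t \<omega> $ k - W s \<omega> $ k) {i, j}"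
      by (rule indep_vars_subset[OF increment_components_indep[OF st(1) st']]) simp
    from indep_vars_lebesgue_integral[OF _ this] False
    show ?thesis
      using c(2) integrable_of_square_integrable[OF c(1)] by simp
  qed
qed simp

lemma increment_norm2:
  assumes st: "0 \<le> s" "s \<le> t"
  shows "expectation (\<lambda>\<omega>. (norm (W t \<omega> - W s \<omega>))\<^sup>2) = real CARD('n) * (t - s)"
proof -
  have norm2: "(norm (W t \<omega> - W s \<omega>))\<^sup>2 = (\<Sum>i\<in>UNIV. (W t \<omega> $ i - W s \<omega> $ i) * (W t \<omega> $ i - W s \<omega> $ i))" for \<omega>
    by (simp add: norm_vec_def L2_set_def sum_nonneg power2_eq_square)
  have sq: "square_integrable M (\<lambda>\<omega>. W t \<omega> $ i - W s \<omega> $ i)" for i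
    using square_integrable_component[OF increment_square_integrable[OF st], of i] by simp
  show ?thesis
    unfolding norm2 by (simp only: Bochner_Integration.integral_sum[OF square_integrable_mult_integrable[OF sq sq]]
        increment_covariance_same[OF st]) simp
qed

lemma covariance_from_start:
  assumes "0 \<le> s" "0 \<le> t"
  shows "expectation (\<lambda>\<omega>. (W s \<omega> $ i - W 0 \<omega> $ i) * (W t \<omega> $ j - W 0 \<omega> $ j)) = (if i = j then min s t else 0)"
proof -
  have *: "expectation (\<lambda>\<omega>. (W s \<omega> $ i - W 0 \<omega> $ i) * (W t \<omega> $ j - W 0 \<omega> $ j)) = (if i = j then s else 0)"
    if st: "0 \<le> s" "s \<le> t" for s t i j
  proof -
    have sq: "square_integrable M (\<lambda>\<omega>. W v \<omega> $ i - W u \<omega> $ i)" if "0 \<le> u" "u \<le> v" for u v i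
      using square_integrable_component[OF increment_square_integrable[OF that], of i] by simp
    have meas: "(\<lambda>\<omega>. W s \<omega> $ i - W 0 \<omega> $ i) \<in> borel_measurable (F s)"
      using st by (intro borel_measurable_diff borel_measurable_vec_nth W_measurable_past) auto
    have "expectation (\<lambda>\<omega>. (W s \<omega> $ i - W 0 \<omega> $ i) * (W t \<omega> $ j - W 0 \<omega> $ j))
        = expectation (\<lambda>\<omega>. (W s \<omega> $ i - W 0 \<omega> $ i) * (W s \<omega> $ j - W 0 \<omega> $ j)
          + (W s \<omega> $ i - W 0 \<omega> $ i) * (W t \<omega> $ j - W s \<omega> $ j))"
      by (intro Bochner_Integration.integral_cong refl) (simp add: algebra_simps)
    also have "\<dots> = expectation (\<lambda>\<omega>. (W s \<omega> $ i - W 0 \<omega> $ i) * (W s \<omega> $ j - W 0 \<omega> $ j))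
        + expectation (\<lambda>\<omega>. (W s \<omega> $ i - W 0 \<omega> $ i) * (W t \<omega> $ j - W s \<omega> $ j))"
      using st by (intro Bochner_Integration.integral_add square_integrable_mult_integrable sq) auto
    also have "expectation (\<lambda>\<omega>. (W s \<omega> $ i - W 0 \<omega> $ i) * (W t \<omega> $ j - W s \<omega> $ j)) = 0"
      using st by (intro past_increment_component meas sq) auto
    finally show ?thesis using increment_covariance_same[of 0 s i j] st by simp
  qed
  show ?thesis
  proof (cases "s \<le> t")
    case True
    then show ?thesis using *[OF assms(1) True] by simp
  next
    case False
    then have "expectation (\<lambda>\<omega>. (W t \<omega> $ j - W 0 \<omega> $ j) * (W s \<omega> $ i - W 0 \<omega> $ i)) = (if i = j then t else 0)"
      using *[of t s j i] assms by auto
    then show ?thesis using False by (subst mult.commute) simp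
  qed
qed

text \<open>Both increments are differences of values of the path \<open>W t - W 0\<close>, whose covariance is \<open>min s t\<close>.\<close>

lemma increment_covariance:
  assumes pq: "0 \<le> p" "p \<le> q" and pq': "0 \<le> p'" "p' \<le> q'"
  shows "expectation (\<lambda>\<omega>. (W q \<omega> $ i - W p \<omega> $ i) * (W q' \<omega> $ j - W p' \<omega> $ j))
    = (if i = j then measure lborel ({p<..q} \<inter> {p'<..q'}) else 0)"
proof -
  define Z where "Z t k \<omega> = W t \<omega> $ k - W 0 \<omega> $ k" for t k \<omega>
  have sq: "square_integrable M (Z t k)" if "0 \<le> t" for t k
    unfolding Z_def using square_integrable_component[OF increment_square_integrable[of 0 t], of k] that by simp
  have int: "integrable M (\<lambda>\<omega>. Z s k \<omega> * Z t l \<omega>)" if "0 \<le> s" "0 \<le> t" for s t k l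
    by (intro square_integrable_mult_integrable sq that)
  have cov: "expectation (\<lambda>\<omega>. Z s k \<omega> * Z t l \<omega>) = (if k = l then min s t else 0)" if "0 \<le> s" "0 \<le> t" for s t k l
    unfolding Z_def by (rule covariance_from_start[OF that])
  have "expectation (\<lambda>\<omega>. (W q \<omega> $ i - W p \<omega> $ i) * (W q' \<omega> $ j - W p' \<omega> $ j))
      = expectation (\<lambda>\<omega>. (Z q i \<omega> * Z q' j \<omega> - Z q i \<omega> * Z p' j \<omega>) - (Z p i \<omega> * Z q' j \<omega> - Z p i \<omega> * Z p' j \<omega>))"
    by (intro Bochner_Integration.integral_cong refl) (simp add: Z_def algebra_simps)
  also have "\<dots> = (expectation (\<lambda>\<omega>. Z q i \<omega> * Z q' j \<omega>) - expectation (\<lambda>\<omega>. Z q i \<omega> * Z p' j \<omega>))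
      - (expectation (\<lambda>\<omega>. Z p i \<omega> * Z q' j \<omega>) - expectation (\<lambda>\<omega>. Z p i \<omega> * Z p' j \<omega>))"
    using pq pq' int by simp
  also have "\<dots> = (if i = j then (min q q' - min q p') - (min p q' - min p p') else 0)"
    using pq pq' cov by simp
  also have "(min q q' - min q p') - (min p q' - min p p') = measure lborel ({p<..q} \<inter> {p'<..q'})"
  proof -
    have "{p<..q} \<inter> {p'<..q'} = {max p p'<..min q q'}" by auto
    moreover have "measure lborel {max p p'<..min q q'} = max 0 (min q q' - max p p')"
      by (cases "max p p' \<le> min q q'") auto
    ultimately have "measure lborel ({p<..q} \<inter> {p'<..q'}) = max 0 (min q q' - max p p')" by (simp only:)
    then show ?thesis using pq pq' by linarith
  qed
  finally show ?thesis .
qed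

end

section \<open>The Ito isometry for step functions\<close>

lemma step_function_outside:
  assumes "is_partition a b m p" "s \<notin> {a..b}"
  shows "step_function m p A s = 0"
  unfolding step_function_def
proof (rule sum.neutral, rule)
  fix i assume "i \<in> {..<m}"
  then have "a \<le> p i" "p (Suc i) \<le> b"
    using is_partition_bounds[OF assms(1), of i] is_partition_bounds[OF assms(1), of "Suc i"] by auto
  then show "indicat_real {p i<..p (Suc i)} s *\<^sub>R A i = 0"
    using assms(2) by (auto simp: indicator_def)
qed

lemma inner_matrix_vector_mult:
  fixes A B :: "real^'m^'d"
  shows "(A *v x) \<bullet> (B *v y) = (\<Sum>k\<in>UNIV. \<Sum>i\<in>UNIV. \<Sum>j\<in>UNIV. (A $ k $ i * B $ k $ j) * (x $ i * y $ j))"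
  unfolding inner_vec_def matrix_vector_mult_def
  by (simp add: sum_product algebra_simps)

lemma square_integrable_matrix_vector_mult:
  fixes A :: "real^'m^'d"
  assumes "square_integrable M X"
  shows "square_integrable M (\<lambda>\<omega>. A *v X \<omega>)"
proof (rule square_integrable_bounded[OF assms])
  show "(\<lambda>\<omega>. A *v X \<omega>) \<in> borel_measurable M"
    by (rule borel_measurable_continuous_on[OF matrix_vector_mult_linear_continuous_on
        square_integrableD(1)[OF assms]])
  show "norm (A *v X \<omega>) \<le> onorm ((*v) A) * norm (X \<omega>)" for \<omega>
    by (rule onorm) (rule matrix_vector_mul_bounded_linear)
qed

lemma integral_double_sum:
  fixes f :: "'i \<Rightarrow> 'j \<Rightarrow> 'a \<Rightarrow> real"
  assumes "\<And>i j. i \<in> I \<Longrightarrow> j \<in> J \<Longrightarrow> integrable M (f i j)"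
  shows "(\<integral>\<omega>. (\<Sum>i\<in>I. \<Sum>j\<in>J. f i j \<omega>) \<partial>M) = (\<Sum>i\<in>I. \<Sum>j\<in>J. \<integral>\<omega>. f i j \<omega> \<partial>M)"
proof -
  have "(\<integral>\<omega>. (\<Sum>i\<in>I. \<Sum>j\<in>J. f i j \<omega>) \<partial>M) = (\<Sum>i\<in>I. \<integral>\<omega>. (\<Sum>j\<in>J. f i j \<omega>) \<partial>M)"
    by (intro Bochner_Integration.integral_sum Bochner_Integration.integrable_sum assms)
  also have "\<dots> = (\<Sum>i\<in>I. \<Sum>j\<in>J. \<integral>\<omega>. f i j \<omega> \<partial>M)"
    by (intro sum.cong refl Bochner_Integration.integral_sum assms)
  finally show ?thesis .
qed

context brownian_motion
begin

lemma inner_increments: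
  fixes A B :: "real^'n^'d"
  assumes pq: "0 \<le> p" "p \<le> q" and pq': "0 \<le> p'" "p' \<le> q'"
  shows "expectation (\<lambda>\<omega>. (A *v (W q \<omega> - W p \<omega>)) \<bullet> (B *v (W q' \<omega> - W p' \<omega>)))
    = (A \<bullet> B) * measure lborel ({p<..q} \<inter> {p'<..q'})"
proof -
  let ?len = "measure lborel ({p<..q} \<inter> {p'<..q'})"
  have sq: "square_integrable M (\<lambda>\<omega>. W t \<omega> $ i - W s \<omega> $ i)" if "0 \<le> s" "s \<le> t" for s t i
    using square_integrable_component[OF increment_square_integrable[OF that], of i] by simp
  have int: "integrable M (\<lambda>\<omega>. c * ((W q \<omega> $ i - W p \<omega> $ i) * (W q' \<omega> $ j - W p' \<omega> $ j)))" for i j c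
    by (intro integrable_mult_right square_integrable_mult_integrable sq pq pq')
  have "expectation (\<lambda>\<omega>. (A *v (W q \<omega> - W p \<omega>)) \<bullet> (B *v (W q' \<omega> - W p' \<omega>)))
      = (\<Sum>k\<in>UNIV. \<Sum>i\<in>UNIV. \<Sum>j\<in>UNIV. (A $ k $ i * B $ k $ j) * (if i = j then ?len else 0))"
    by (simp only: inner_matrix_vector_mult vector_minus_component Bochner_Integration.integral_sum
        Bochner_Integration.integrable_sum int integral_mult_right_zero increment_covariance[OF pq pq'])
  also have "\<dots> = (\<Sum>k\<in>UNIV. \<Sum>i\<in>UNIV. (A $ k $ i * B $ k $ i) * ?len)"
    by (intro sum.cong refl) (simp add: if_distrib cong: if_cong)
  also have "\<dots> = (A \<bullet> B) * ?len"
    by (simp add: inner_vec_def sum_distrib_right)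
  finally show ?thesis .
qed

lemma step_integral_square_integrable:
  assumes "0 \<le> a" "is_partition a b m p"
  shows "square_integrable M (step_integral W m p A)"
  unfolding step_integral_def[abs_def]
  using is_partition_bounds[OF assms(2)] is_partition_step[OF assms(2)] assms(1)
  by (intro square_integrable_sum square_integrable_matrix_vector_mult increment_square_integrable)
    (auto intro: order_trans)

text \<open>Bilinearity reduces the isometry to pairs of intervals, so that the two step functions need
  no common refinement of their partitions.\<close>

lemma ito_isometry_inner:
  fixes A B :: "nat \<Rightarrow> real^'n^'d"
  assumes a: "0 \<le> a" "0 \<le> a'" and p: "is_partition a b m p" and p': "is_partition a' b' m' p'"
  shows "integrable lborel (\<lambda>s. step_function m p A s \<bullet> step_function m' p' B s)"
    and "expectation (\<lambda>\<omega>. step_integral W m p A \<omega> \<bullet> step_integral W m' p' B \<omega>)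
      = (\<integral>s. step_function m p A s \<bullet> step_function m' p' B s \<partial>lborel)"
proof -
  have ind: "step_function m p A s \<bullet> step_function m' p' B s
      = (\<Sum>i<m. \<Sum>j<m'. (A i \<bullet> B j) * indicat_real ({p i<..p (Suc i)} \<inter> {p' j<..p' (Suc j)}) s)" for s
    unfolding step_function_def inner_sum_left unfolding inner_sum_right
    by (intro sum.cong refl) (auto simp: indicator_def)
  have fin: "emeasure lborel ({p i<..p (Suc i)} \<inter> {p' j<..p' (Suc j)}) < \<infinity>" for i j
  proof -
    have "emeasure lborel ({p i<..p (Suc i)} \<inter> {p' j<..p' (Suc j)}) \<le> emeasure lborel {p i..p (Suc i)}"
      by (rule emeasure_mono) auto
    also have "\<dots> < \<infinity>" by (simp add: emeasure_lborel_cbox_eq[where 'a=real, simplified] emeasure_lborel_Icc_eq)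
    finally show ?thesis .
  qed
  have int_ind: "integrable lborel (\<lambda>s. (A i \<bullet> B j) * indicat_real ({p i<..p (Suc i)} \<inter> {p' j<..p' (Suc j)}) s)" for i j
    using fin by (intro integrable_mult_right integrable_real_indicator) auto
  show "integrable lborel (\<lambda>s. step_function m p A s \<bullet> step_function m' p' B s)"
    unfolding ind by (intro Bochner_Integration.integrable_sum int_ind)
  have pq: "0 \<le> p i" "p i \<le> p (Suc i)" if "i < m" for i
    using is_partition_bounds[OF p, of i] is_partition_step[OF p that] a that by auto
  have pq': "0 \<le> p' i" "p' i \<le> p' (Suc i)" if "i < m'" for i
    using is_partition_bounds[OF p', of i] is_partition_step[OF p' that] a that by auto
  have int_incr: "integrable M (\<lambda>\<omega>. (A i *v (W (p (Suc i)) \<omega> - W (p i) \<omega>)) \<bullet> (B j *v (W (p' (Suc j)) \<omega> - W (p' j) \<omega>)))"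
    if "i < m" "j < m'" for i j
    by (intro integrable_inner_square_integrable square_integrable_matrix_vector_mult
        increment_square_integrable pq pq' that)
  have "expectation (\<lambda>\<omega>. step_integral W m p A \<omega> \<bullet> step_integral W m' p' B \<omega>)
      = expectation (\<lambda>\<omega>. \<Sum>i<m. \<Sum>j<m'. (A i *v (W (p (Suc i)) \<omega> - W (p i) \<omega>)) \<bullet> (B j *v (W (p' (Suc j)) \<omega> - W (p' j) \<omega>)))"
    unfolding step_integral_def inner_sum_left unfolding inner_sum_right ..
  also have "\<dots> = (\<Sum>i<m. \<Sum>j<m'. expectation (\<lambda>\<omega>. (A i *v (W (p (Suc i)) \<omega> - W (p i) \<omega>)) \<bullet> (B j *v (W (p' (Suc j)) \<omega> - W (p' j) \<omega>))))"
    by (intro integral_double_sum int_incr) auto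
  also have "\<dots> = (\<Sum>i<m. \<Sum>j<m'. (A i \<bullet> B j) * measure lborel ({p i<..p (Suc i)} \<inter> {p' j<..p' (Suc j)}))"
    by (intro sum.cong refl inner_increments pq pq') auto
  also have "\<dots> = (\<integral>s. step_function m p A s \<bullet> step_function m' p' B s \<partial>lborel)"
  proof -
    have "(\<integral>s. (A i \<bullet> B j) * indicat_real ({p i<..p (Suc i)} \<inter> {p' j<..p' (Suc j)}) s \<partial>lborel)
        = (A i \<bullet> B j) * measure lborel ({p i<..p (Suc i)} \<inter> {p' j<..p' (Suc j)})" for i j
      by simp
    then show ?thesis
      unfolding ind integral_double_sum[OF int_ind] by (simp only:)
  qed
  finally show "expectation (\<lambda>\<omega>. step_integral W m p A \<omega> \<bullet> step_integral W m' p' B \<omega>)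
      = (\<integral>s. step_function m p A s \<bullet> step_function m' p' B s \<partial>lborel)" .
qed

lemma ito_isometry_diff:
  fixes A B :: "nat \<Rightarrow> real^'n^'d"
  assumes a: "0 \<le> a" and p: "is_partition a b m p" and p': "is_partition a b m' p'"
  shows "(\<integral>\<^sup>+\<omega>. ennreal ((norm (step_integral W m p A \<omega> - step_integral W m' p' B \<omega>))\<^sup>2) \<partial>M)
    = (\<integral>\<^sup>+s\<in>{a..b}. ennreal ((norm (step_function m p A s - step_function m' p' B s))\<^sup>2) \<partial>lborel)"
proof -
  let ?I = "step_integral W m p A" and ?J = "step_integral W m' p' B"
  let ?g = "step_function m p A" and ?h = "step_function m' p' B"
  have expand: "(norm (y - z))\<^sup>2 = y \<bullet> y - 2 * (y \<bullet> z) + z \<bullet> z" for y z :: "'x::real_inner"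
    by (simp add: power2_norm_eq_inner inner_diff_left inner_diff_right inner_commute)
  note sq = step_integral_square_integrable[OF a p, of A] step_integral_square_integrable[OF a p', of B]
  note int = integrable_inner_square_integrable[OF sq(1) sq(1)]
    integrable_inner_square_integrable[OF sq(1) sq(2)] integrable_inner_square_integrable[OF sq(2) sq(2)]
  note iso = ito_isometry_inner[OF a a p p, of A A] ito_isometry_inner[OF a a p p', of A B]
    ito_isometry_inner[OF a a p' p', of B B]
  have "(\<integral>\<^sup>+\<omega>. ennreal ((norm (?I \<omega> - ?J \<omega>))\<^sup>2) \<partial>M) = ennreal (expectation (\<lambda>\<omega>. (norm (?I \<omega> - ?J \<omega>))\<^sup>2))"
    by (intro nn_integral_eq_integral square_integrableD(2) square_integrable_diff sq) auto
  also have "expectation (\<lambda>\<omega>. (norm (?I \<omega> - ?J \<omega>))\<^sup>2) = (\<integral>s. (norm (?g s - ?h s))\<^sup>2 \<partial>lborel)"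
    unfolding expand using int iso by simp
  also have "ennreal \<dots> = (\<integral>\<^sup>+s. ennreal ((norm (?g s - ?h s))\<^sup>2) \<partial>lborel)"
    unfolding expand using iso
    by (intro nn_integral_eq_integral[symmetric] Bochner_Integration.integrable_add
        Bochner_Integration.integrable_diff integrable_mult_right AE_I2) (auto simp: expand[symmetric])
  also have "\<dots> = (\<integral>\<^sup>+s\<in>{a..b}. ennreal ((norm (?g s - ?h s))\<^sup>2) \<partial>lborel)"
  proof (intro nn_integral_cong)
    fix s
    show "ennreal ((norm (?g s - ?h s))\<^sup>2) = ennreal ((norm (?g s - ?h s))\<^sup>2) * indicator {a..b} s"
      using step_function_outside[OF p, of s A] step_function_outside[OF p', of s B]
      by (cases "s \<in> {a..b}") auto
  qed
  finally show ?thesis .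
qed

end

lemma norm_diff_power2_le:
  fixes x y z :: "'a::real_normed_vector"
  shows "(norm (x - z))\<^sup>2 \<le> 2 * (norm (x - y))\<^sup>2 + 2 * (norm (y - z))\<^sup>2"
proof -
  have "(norm (x - z))\<^sup>2 \<le> (norm (x - y) + norm (y - z))\<^sup>2"
    by (intro power_mono norm_diff_triangle_ineq[THEN order_trans] norm_ge_zero) norm
  then show ?thesis
    using sum_squares_bound[of "norm (x - y)" "norm (y - z)"] by (simp add: power2_sum)
qed

lemma nn_integral_norm_diff_power2_le:
  fixes X Y Z :: "'a \<Rightarrow> 'b::euclidean_space"
  assumes [measurable]: "X \<in> borel_measurable M" "Y \<in> borel_measurable M" "Z \<in> borel_measurable M"
  shows "(\<integral>\<^sup>+s. ennreal ((norm (X s - Z s))\<^sup>2) \<partial>M)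
    \<le> 2 * (\<integral>\<^sup>+s. ennreal ((norm (X s - Y s))\<^sup>2) \<partial>M) + 2 * (\<integral>\<^sup>+s. ennreal ((norm (Y s - Z s))\<^sup>2) \<partial>M)"
proof -
  have "(\<integral>\<^sup>+s. ennreal ((norm (X s - Z s))\<^sup>2) \<partial>M)
      \<le> (\<integral>\<^sup>+s. 2 * ennreal ((norm (X s - Y s))\<^sup>2) + 2 * ennreal ((norm (Y s - Z s))\<^sup>2) \<partial>M)"
  proof (intro nn_integral_mono)
    fix s
    have "ennreal ((norm (X s - Z s))\<^sup>2) \<le> ennreal (2 * (norm (X s - Y s))\<^sup>2 + 2 * (norm (Y s - Z s))\<^sup>2)"
      by (intro ennreal_leI norm_diff_power2_le)
    then show "ennreal ((norm (X s - Z s))\<^sup>2) \<le> 2 * ennreal ((norm (X s - Y s))\<^sup>2) + 2 * ennreal ((norm (Y s - Z s))\<^sup>2)"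
      by (simp add: ennreal_plus ennreal_mult)
  qed
  also have "\<dots> = 2 * (\<integral>\<^sup>+s. ennreal ((norm (X s - Y s))\<^sup>2) \<partial>M) + 2 * (\<integral>\<^sup>+s. ennreal ((norm (Y s - Z s))\<^sup>2) \<partial>M)"
    by (subst nn_integral_add) (auto simp: nn_integral_cmult)
  finally show ?thesis .
qed

lemma step_function_measurable: "step_function m p A \<in> borel_measurable borel"
  unfolding step_function_def[abs_def] by measurable

lemma set_nn_integral_norm_diff_power2_le:
  fixes X Y Z :: "real \<Rightarrow> 'b::euclidean_space"
  assumes "X \<in> borel_measurable borel" "Y \<in> borel_measurable borel" "Z \<in> borel_measurable borel"
  shows "(\<integral>\<^sup>+s\<in>{a..b}. ennreal ((norm (X s - Z s))\<^sup>2) \<partial>lborel)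
    \<le> 2 * (\<integral>\<^sup>+s\<in>{a..b}. ennreal ((norm (X s - Y s))\<^sup>2) \<partial>lborel)
      + 2 * (\<integral>\<^sup>+s\<in>{a..b}. ennreal ((norm (Y s - Z s))\<^sup>2) \<partial>lborel)"
  using nn_integral_norm_diff_power2_le[of X "restrict_space lborel {a..b}" Y Z] assms
  by (simp add: nn_integral_restrict_space measurable_restrict_space1)

context brownian_motion
begin

text \<open>The defining sequence of the integral and any other approximating sequence have the same
  limit, by the isometry; Fatou's lemma transfers this to almost sure limits.\<close>

lemma stochastic_integral_eq_limit:
  fixes G :: "real \<Rightarrow> real^'n^'d"
  assumes a: "0 \<le> a" and I: "is_stochastic_integral M W a b G I"
    and p: "\<And>k. is_partition a b (m k) (p k)"
    and approx: "(\<lambda>k. \<integral>\<^sup>+s\<in>{a..b}. ennreal ((norm (G s - step_function (m k) (p k) (A k) s))\<^sup>2) \<partial>lborel) \<longlonglongrightarrow> 0"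
    and lim: "AE \<omega> in M. (\<lambda>k. step_integral W (m k) (p k) (A k) \<omega>) \<longlonglongrightarrow> Z \<omega>"
  shows "AE \<omega> in M. I \<omega> = Z \<omega>"
proof -
  define e where "e k = (\<integral>\<^sup>+s\<in>{a..b}. ennreal ((norm (G s - step_function (m k) (p k) (A k) s))\<^sup>2) \<partial>lborel)" for k
  obtain m' p' A' where p': "\<And>j. is_partition a b (m' j) (p' j)"
    and e': "(\<lambda>j. \<integral>\<^sup>+s\<in>{a..b}. ennreal ((norm (G s - step_function (m' j) (p' j) (A' j) s))\<^sup>2) \<partial>lborel) \<longlonglongrightarrow> 0"
    and d': "(\<lambda>j. \<integral>\<^sup>+\<omega>. ennreal ((norm (I \<omega> - step_integral W (m' j) (p' j) (A' j) \<omega>))\<^sup>2) \<partial>M) \<longlonglongrightarrow> 0"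
    and G: "G \<in> borel_measurable borel" and I_meas: "I \<in> borel_measurable M"
    using I unfolding is_stochastic_integral_def is_partition_def by blast
  let ?S = "\<lambda>k. step_integral W (m k) (p k) (A k)" and ?S' = "\<lambda>j. step_integral W (m' j) (p' j) (A' j)"
  let ?g = "\<lambda>k. step_function (m k) (p k) (A k)" and ?g' = "\<lambda>j. step_function (m' j) (p' j) (A' j)"
  have S_meas: "?S k \<in> borel_measurable M" "?S' k \<in> borel_measurable M" for k
    using square_integrableD(1)[OF step_integral_square_integrable[OF a p]]
      square_integrableD(1)[OF step_integral_square_integrable[OF a p']] by auto
  have bound: "(\<integral>\<^sup>+\<omega>. ennreal ((norm (I \<omega> - ?S k \<omega>))\<^sup>2) \<partial>M) \<le> 4 * e k" for k
  proof (rule LIMSEQ_le_const)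
    let ?d = "\<lambda>j. \<integral>\<^sup>+\<omega>. ennreal ((norm (I \<omega> - ?S' j \<omega>))\<^sup>2) \<partial>M"
    let ?e = "\<lambda>j. \<integral>\<^sup>+s\<in>{a..b}. ennreal ((norm (G s - ?g' j s))\<^sup>2) \<partial>lborel"
    have "(\<lambda>j. 2 * ?d j + 2 * (2 * ?e j + 2 * e k)) \<longlonglongrightarrow> 2 * 0 + 2 * (2 * 0 + 2 * e k)"
      by (intro tendsto_add ennreal_tendsto_cmult d' e' tendsto_const) auto
    moreover have "2 * (2 * e k) = 4 * e k" by (simp add: mult.assoc[symmetric])
    ultimately show "(\<lambda>j. 2 * ?d j + 2 * (2 * ?e j + 2 * e k)) \<longlonglongrightarrow> 4 * e k" by simp
    show "\<exists>N. \<forall>j\<ge>N. (\<integral>\<^sup>+\<omega>. ennreal ((norm (I \<omega> - ?S k \<omega>))\<^sup>2) \<partial>M) \<le> 2 * ?d j + 2 * (2 * ?e j + 2 * e k)"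
    proof (intro exI allI impI)
      fix j
      have "(\<integral>\<^sup>+\<omega>. ennreal ((norm (I \<omega> - ?S k \<omega>))\<^sup>2) \<partial>M)
          \<le> 2 * ?d j + 2 * (\<integral>\<^sup>+\<omega>. ennreal ((norm (?S' j \<omega> - ?S k \<omega>))\<^sup>2) \<partial>M)"
        by (intro nn_integral_norm_diff_power2_le I_meas S_meas)
      also have "(\<integral>\<^sup>+\<omega>. ennreal ((norm (?S' j \<omega> - ?S k \<omega>))\<^sup>2) \<partial>M)
          = (\<integral>\<^sup>+s\<in>{a..b}. ennreal ((norm (?g' j s - ?g k s))\<^sup>2) \<partial>lborel)"
        by (rule ito_isometry_diff[OF a p' p])
      also have "\<dots> \<le> 2 * (\<integral>\<^sup>+s\<in>{a..b}. ennreal ((norm (?g' j s - G s))\<^sup>2) \<partial>lborel) + 2 * e k"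
        unfolding e_def by (intro set_nn_integral_norm_diff_power2_le step_function_measurable G)
      also have "(\<integral>\<^sup>+s\<in>{a..b}. ennreal ((norm (?g' j s - G s))\<^sup>2) \<partial>lborel) = ?e j"
        by (simp add: norm_minus_commute)
      finally show "(\<integral>\<^sup>+\<omega>. ennreal ((norm (I \<omega> - ?S k \<omega>))\<^sup>2) \<partial>M) \<le> 2 * ?d j + 2 * (2 * ?e j + 2 * e k)"
        by (simp add: mult_left_mono add_left_mono)
    qed
  qed
  let ?D = "\<lambda>k \<omega>. ennreal ((norm (I \<omega> - ?S k \<omega>))\<^sup>2)"
  have D_meas: "?D k \<in> borel_measurable M" for k
    using I_meas S_meas(1)[of k] by measurable
  have "(\<integral>\<^sup>+\<omega>. liminf (\<lambda>k. ?D k \<omega>) \<partial>M) \<le> liminf (\<lambda>k. \<integral>\<^sup>+\<omega>. ?D k \<omega> \<partial>M)"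
    by (rule nn_integral_liminf) (rule D_meas)
  also have "\<dots> \<le> liminf (\<lambda>k. 4 * e k)"
    by (intro Liminf_mono always_eventually allI bound)
  also have "\<dots> = 0"
  proof -
    have "(\<lambda>k. 4 * e k) \<longlonglongrightarrow> 4 * 0"
      by (intro ennreal_tendsto_cmult approx[folded e_def]) auto
    then show ?thesis by (intro lim_imp_Liminf) auto
  qed
  finally have "(\<integral>\<^sup>+\<omega>. liminf (\<lambda>k. ?D k \<omega>) \<partial>M) = 0" by simp
  then have "AE \<omega> in M. liminf (\<lambda>k. ?D k \<omega>) = 0"
    using D_meas by (subst (asm) nn_integral_0_iff_AE) auto
  then show ?thesis
    using lim
  proof eventually_elim
    case (elim \<omega>)
    have "(\<lambda>k. ?D k \<omega>) \<longlonglongrightarrow> ennreal ((norm (I \<omega> - Z \<omega>))\<^sup>2)"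
      by (intro tendsto_ennrealI tendsto_intros elim)
    then have "liminf (\<lambda>k. ?D k \<omega>) = ennreal ((norm (I \<omega> - Z \<omega>))\<^sup>2)"
      by (intro lim_imp_Liminf) auto
    then show ?case using elim(1) by simp
  qed
qed

end

section \<open>Sampling on uniform partitions\<close>

definition uniform_partition :: "real \<Rightarrow> real \<Rightarrow> nat \<Rightarrow> nat \<Rightarrow> real" where
  "uniform_partition a b m i = a + real i * ((b - a) / real m)"

lemma uniform_partition_Suc:
  "uniform_partition a b m (Suc i) - uniform_partition a b m i = (b - a) / real m"
  by (simp add: uniform_partition_def distrib_right add_divide_distrib)

lemma is_partition_uniform:
  assumes "a \<le> b" "0 < m" shows "is_partition a b m (uniform_partition a b m)"
  unfolding is_partition_def
proof (intro conjI allI impI)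
  show "uniform_partition a b m i \<le> uniform_partition a b m (Suc i)" for i
    using uniform_partition_Suc[of a b m i] assms divide_nonneg_nonneg[of "b - a" "real m"] by linarith
qed (use assms in \<open>simp_all add: uniform_partition_def\<close>)

lemma step_function_value:
  assumes "is_partition a b m p" "s \<in> {a<..b}"
  shows "\<exists>i<m. s \<in> {p i<..p (Suc i)} \<and> step_function m p A s = A i"
proof -
  have "\<exists>i<k. s \<in> {p i<..p (Suc i)} \<and> step_function k p A s = A i" if "k \<le> m" "s \<le> p k" for k
    using that
  proof (induction k)
    case 0
    then show ?case using assms by (auto simp: is_partition_def)
  next
    case (Suc k)
    show ?case
    proof (cases "s \<le> p k")
      case True
      then obtain i where "i < k" "s \<in> {p i<..p (Suc i)}" "step_function k p A s = A i"
        using Suc by auto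
      then show ?thesis using True by (intro exI[of _ i]) (simp add: step_function_def)
    next
      case False
      have "step_function k p A s = 0"
      proof -
        have "is_partition a (p k) k p"
          using assms(1) Suc.prems by (auto simp: is_partition_def)
        then show ?thesis using False by (intro step_function_outside) auto
      qed
      then show ?thesis
        using False Suc.prems by (intro exI[of _ k]) (simp add: step_function_def)
    qed
  qed
  from this[of m] show ?thesis using assms by (auto simp: is_partition_def)
qed

text \<open>Sampling one factor at an endpoint of each cell costs at most the modulus of continuity of
  that factor. Both Riemann sums and summation by parts of left-point sums are instances.\<close>

lemma sampled_integral_tendsto:
  fixes prod :: "'a::euclidean_space \<Rightarrow> 'b::euclidean_space \<Rightarrow> 'c::euclidean_space"
  assumes prod: "bounded_bilinear prod" and ab: "a \<le> b"
    and H: "continuous_on {a..b} H" and w: "continuous_on {a..b} w" and e: "e \<le> Suc 0"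
  shows "(\<lambda>k. \<Sum>i<Suc k. integral {uniform_partition a b (Suc k) i..uniform_partition a b (Suc k) (Suc i)}
      (\<lambda>s. prod (H s) (w (uniform_partition a b (Suc k) (i + e))))) \<longlonglongrightarrow> integral {a..b} (\<lambda>s. prod (H s) (w s))"
proof -
  interpret bounded_bilinear prod by fact
  obtain K where K: "0 \<le> K" "\<And>y z. norm (prod y z) \<le> norm y * norm z * K"
    using nonneg_bounded by blast
  obtain C where C: "\<forall>s\<in>{a..b}. norm (H s) \<le> C"
    using compact_imp_bounded[OF compact_continuous_image[OF H compact_Icc]]
    unfolding bounded_iff by blast
  have C_nonneg: "0 \<le> C" using C ab order_trans[OF norm_ge_zero[of "H a"]] by auto
  have uc: "uniformly_continuous_on {a..b} w"
    using compact_uniformly_continuous[OF w compact_Icc] .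
  show ?thesis
  proof (rule LIMSEQ_I)
    fix r :: real assume r: "0 < r"
    define L where "L = C * K * (b - a) + 1"
    have L: "0 < L" unfolding L_def using C_nonneg K ab by (simp add: add_nonneg_pos)
    define \<epsilon> where "\<epsilon> = r / (2 * L)"
    have \<epsilon>: "0 < \<epsilon>" using r L by (simp add: \<epsilon>_def)
    obtain \<delta> where \<delta>: "0 < \<delta>" "\<And>s t. s \<in> {a..b} \<Longrightarrow> t \<in> {a..b} \<Longrightarrow> dist t s < \<delta> \<Longrightarrow> dist (w t) (w s) < \<epsilon>"
      using uc \<epsilon> unfolding uniformly_continuous_on_def by blast
    obtain k0 where k0: "(b - a) / \<delta> < real k0" using reals_Archimedean2 by blast
    show "\<exists>k0. \<forall>k\<ge>k0. norm ((\<Sum>i<Suc k. integral {uniform_partition a b (Suc k) i..uniform_partition a b (Suc k) (Suc i)}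
      (\<lambda>s. prod (H s) (w (uniform_partition a b (Suc k) (i + e))))) - integral {a..b} (\<lambda>s. prod (H s) (w s))) < r"
    proof (intro exI allI impI)
      fix k assume "k \<ge> k0"
      then have "(b - a) / \<delta> < real (Suc k)" using k0 by linarith
      then have mesh: "(b - a) / real (Suc k) < \<delta>"
        using \<delta>(1) by (simp add: field_simps)
      define p where "p = uniform_partition a b (Suc k)"
      have p: "is_partition a b (Suc k) p" unfolding p_def by (rule is_partition_uniform[OF ab]) simp
      have p_Suc: "p (Suc i) - p i = (b - a) / real (Suc k)" for i
        unfolding p_def by (rule uniform_partition_Suc)
      have cell: "norm (integral {p i..p (Suc i)} (\<lambda>s. prod (H s) (w (p (i + e)))) - integral {p i..p (Suc i)} (\<lambda>s. prod (H s) (w s)))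
          \<le> (p (Suc i) - p i) * (C * \<epsilon> * K)" if i: "i < Suc k" for i
      proof -
        have bnd: "a \<le> p i" "p i \<le> p (Suc i)" "p (Suc i) \<le> b"
          using is_partition_bounds[OF p, of i] is_partition_bounds[OF p, of "Suc i"] is_partition_step[OF p i] i by auto
        then have sub: "{p i..p (Suc i)} \<subseteq> {a..b}" by auto
        have cont: "continuous_on {p i..p (Suc i)} H" "continuous_on {p i..p (Suc i)} w"
          using continuous_on_subset[OF H sub] continuous_on_subset[OF w sub] by auto
        have tag: "p (i + e) \<in> {p i, p (Suc i)}" using e by (cases e) auto
        have "norm (integral {p i..p (Suc i)} (\<lambda>s. prod (H s) (w (p (i + e)))) - integral {p i..p (Suc i)} (\<lambda>s. prod (H s) (w s)))
            = norm (integral {p i..p (Suc i)} (\<lambda>s. prod (H s) (w (p (i + e)) - w s)))"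
          by (simp add: diff_right Henstock_Kurzweil_Integration.integral_diff integrable_continuous_real
              continuous_on[OF cont(1) continuous_on_const] continuous_on[OF cont])
        also have "\<dots> \<le> (p (Suc i) - p i) * (C * \<epsilon> * K)"
        proof (rule norm_integral_le_const)
          show "continuous_on {p i..p (Suc i)} (\<lambda>s. prod (H s) (w (p (i + e)) - w s))"
            by (intro continuous_on continuous_on_diff continuous_on_const cont)
          fix s assume s: "s \<in> {p i..p (Suc i)}"
          have "dist (p (i + e)) s \<le> p (Suc i) - p i" using tag s bnd by (auto simp: dist_real_def)
          then have "dist (w (p (i + e))) (w s) < \<epsilon>"
            using p_Suc[of i] mesh s bnd tag by (intro \<delta>(2)) auto
          then have "norm (w (p (i + e)) - w s) \<le> \<epsilon>" by (simp add: dist_norm)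
          moreover have "norm (H s) \<le> C" using C sub s by blast
          ultimately have "norm (H s) * norm (w (p (i + e)) - w s) * K \<le> C * \<epsilon> * K"
            using K C_nonneg by (intro mult_right_mono mult_mono) auto
          then show "norm (prod (H s) (w (p (i + e)) - w s)) \<le> C * \<epsilon> * K"
            using K(2) order_trans by blast
        qed (use bnd in auto)
        finally show ?thesis .
      qed
      have "integral {a..b} (\<lambda>s. prod (H s) (w s)) = (\<Sum>i<Suc k. integral {p i..p (Suc i)} (\<lambda>s. prod (H s) (w s)))"
        by (rule sum_integral_partition[OF p continuous_on[OF H w], symmetric])
      then have "norm ((\<Sum>i<Suc k. integral {p i..p (Suc i)} (\<lambda>s. prod (H s) (w (p (i + e))))) - integral {a..b} (\<lambda>s. prod (H s) (w s)))
          = norm (\<Sum>i<Suc k. integral {p i..p (Suc i)} (\<lambda>s. prod (H s) (w (p (i + e)))) - integral {p i..p (Suc i)} (\<lambda>s. prod (H s) (w s)))"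
        by (simp only: sum_subtractf)
      also have "\<dots> \<le> (\<Sum>i<Suc k. (p (Suc i) - p i) * (C * \<epsilon> * K))"
        by (rule order_trans[OF norm_sum sum_mono]) (rule cell, simp)
      also have "\<dots> = (b - a) * (C * \<epsilon> * K)"
        by (simp add: p_Suc)
      also have "\<dots> \<le> L * \<epsilon>" using \<epsilon> by (simp add: L_def algebra_simps)
      also have "\<dots> < r" using L r by (simp add: \<epsilon>_def)
      finally show "norm ((\<Sum>i<Suc k. integral {uniform_partition a b (Suc k) i..uniform_partition a b (Suc k) (Suc i)}
          (\<lambda>s. prod (H s) (w (uniform_partition a b (Suc k) (i + e))))) - integral {a..b} (\<lambda>s. prod (H s) (w s))) < r"
        unfolding p_def .
    qed
  qed
qed

lemma riemann_sum_tendsto: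
  fixes g :: "real \<Rightarrow> 'a::euclidean_space"
  assumes ab: "a \<le> b" and g: "continuous_on {a..b} g"
  shows "(\<lambda>k. \<Sum>i<Suc k. ((b - a) / real (Suc k)) *\<^sub>R g (uniform_partition a b (Suc k) i)) \<longlonglongrightarrow> integral {a..b} g"
proof -
  have "(\<lambda>k. \<Sum>i<Suc k. integral {uniform_partition a b (Suc k) i..uniform_partition a b (Suc k) (Suc i)}
      (\<lambda>s. (1 :: real) *\<^sub>R g (uniform_partition a b (Suc k) (i + 0)))) \<longlonglongrightarrow> integral {a..b} (\<lambda>s. (1 :: real) *\<^sub>R g s)"
    by (rule sampled_integral_tendsto[OF bounded_bilinear_scaleR ab continuous_on_const g]) simp
  moreover have "integral {uniform_partition a b (Suc k) i..uniform_partition a b (Suc k) (Suc i)}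
      (\<lambda>s. (1 :: real) *\<^sub>R g (uniform_partition a b (Suc k) (i + 0)))
      = ((b - a) / real (Suc k)) *\<^sub>R g (uniform_partition a b (Suc k) i)" for k i
  proof -
    have "uniform_partition a b (Suc k) i \<le> uniform_partition a b (Suc k) (Suc i)"
      using uniform_partition_Suc[of a b "Suc k" i] ab divide_nonneg_nonneg[of "b - a" "real (Suc k)"] by linarith
    then show ?thesis using uniform_partition_Suc[of a b "Suc k" i] by simp
  qed
  moreover have "integral {a..b} (\<lambda>s. (1 :: real) *\<^sub>R g s) = integral {a..b} g" by simp
  ultimately show ?thesis by (simp only:)
qed

section \<open>Pathwise form of the stochastic integrals of the scheme\<close>

lemma matrix_increment_eq_integral:
  fixes G :: "real \<Rightarrow> real^'n^'d"
  assumes "a \<le> u" "u \<le> s" "s \<le> b"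
    and G: "\<And>s. s \<in> {a..b} \<Longrightarrow> (G has_vector_derivative G' s) (at s within {a..b})"
  shows "(G' has_integral G s - G u) {u..s}"
proof (rule fundamental_theorem_of_calculus[OF assms(2)])
  show "(G has_vector_derivative G' x) (at x within {u..s})" if "x \<in> {u..s}" for x
    using assms(1,3) that by (intro has_vector_derivative_within_subset[OF G]) auto
qed

text \<open>Summation by parts turns left-point sums against \<open>w\<close> into sums of \<open>w\<close> against increments of
  \<open>G\<close>, which converge path by path because \<open>G\<close> is continuously differentiable.\<close>

lemma left_point_sum_tendsto:
  fixes G :: "real \<Rightarrow> real^'n^'d" and w :: "real \<Rightarrow> real^'n"
  assumes ab: "a \<le> b" and w: "continuous_on {a..b} w" and G': "continuous_on {a..b} G'"
    and G: "\<And>s. s \<in> {a..b} \<Longrightarrow> (G has_vector_derivative G' s) (at s within {a..b})"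
  shows "(\<lambda>k. \<Sum>i<Suc k. G (uniform_partition a b (Suc k) i) *v
      (w (uniform_partition a b (Suc k) (Suc i)) - w (uniform_partition a b (Suc k) i)))
    \<longlonglongrightarrow> G b *v w b - G a *v w a - integral {a..b} (\<lambda>s. G' s *v w s)"
proof -
  let ?p = "\<lambda>k. uniform_partition a b (Suc k)"
  have parts: "(\<Sum>i<Suc k. G (?p k i) *v (w (?p k (Suc i)) - w (?p k i)))
      = G b *v w b - G a *v w a - (\<Sum>i<Suc k. integral {?p k i..?p k (Suc i)} (\<lambda>s. G' s *v w (?p k (i + 1))))" for k
  proof -
    have p: "is_partition a b (Suc k) (?p k)" by (rule is_partition_uniform[OF ab]) simp
    have ends: "?p k 0 = a" "?p k (Suc k) = b" using p by (auto simp: is_partition_def)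
    have "integral {?p k i..?p k (Suc i)} (\<lambda>s. G' s *v w (?p k (i + 1))) = (G (?p k (Suc i)) - G (?p k i)) *v w (?p k (Suc i))"
      if i: "i < Suc k" for i
    proof -
      have "(G' has_integral G (?p k (Suc i)) - G (?p k i)) {?p k i..?p k (Suc i)}"
        using is_partition_bounds[OF p, of i] is_partition_bounds[OF p, of "Suc i"] is_partition_step[OF p i] i
        by (intro matrix_increment_eq_integral[OF _ _ _ G]) auto
      from has_integral_linear[OF this mv.bounded_linear_left, of "w (?p k (Suc i))"]
      show ?thesis by (simp add: o_def integral_unique)
    qed
    then have "(\<Sum>i<Suc k. G (?p k i) *v (w (?p k (Suc i)) - w (?p k i)))
        + (\<Sum>i<Suc k. integral {?p k i..?p k (Suc i)} (\<lambda>s. G' s *v w (?p k (i + 1))))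
        = (\<Sum>i<Suc k. G (?p k (Suc i)) *v w (?p k (Suc i)) - G (?p k i) *v w (?p k i))"
      unfolding sum.distrib[symmetric] by (intro sum.cong refl) (simp add: mv.diff_left mv.diff_right)
    also have "\<dots> = G b *v w b - G a *v w a"
      using sum_lessThan_telescope[of "\<lambda>i. G (?p k i) *v w (?p k i)" "Suc k"] by (simp only: ends)
    finally show ?thesis by (simp only: eq_diff_eq)
  qed
  have "(\<lambda>k. \<Sum>i<Suc k. integral {?p k i..?p k (Suc i)} (\<lambda>s. G' s *v w (?p k (i + 1))))
      \<longlonglongrightarrow> integral {a..b} (\<lambda>s. G' s *v w s)"
    by (rule sampled_integral_tendsto[OF bounded_bilinear_matrix_vector_mult ab G' w]) simp
  then show ?thesis unfolding parts by (intro tendsto_intros)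
qed

text \<open>The values at the left end point \<open>a\<close> differ, as step functions live on half-open cells, but a
  point is a null set.\<close>

lemma left_point_step_functions_tendsto:
  fixes G :: "real \<Rightarrow> real^'n^'d"
  assumes ab: "a \<le> b" and G': "continuous_on {a..b} G'"
    and G: "\<And>s. s \<in> {a..b} \<Longrightarrow> (G has_vector_derivative G' s) (at s within {a..b})"
  shows "(\<lambda>k. \<integral>\<^sup>+s\<in>{a..b}. ennreal ((norm (G s - step_function (Suc k) (uniform_partition a b (Suc k))
      (\<lambda>i. G (uniform_partition a b (Suc k) i)) s))\<^sup>2) \<partial>lborel) \<longlonglongrightarrow> 0"
proof -
  obtain D where D: "\<forall>s\<in>{a..b}. norm (G' s) \<le> D"
    using compact_imp_bounded[OF compact_continuous_image[OF G' compact_Icc]]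
    unfolding bounded_iff by blast
  have D_nonneg: "0 \<le> D" using D ab order_trans[OF norm_ge_zero[of "G' a"]] by auto
  let ?p = "\<lambda>k. uniform_partition a b (Suc k)"
  define \<epsilon> where "\<epsilon> k = (b - a) / real (Suc k) * D" for k
  have le: "(\<integral>\<^sup>+s\<in>{a..b}. ennreal ((norm (G s - step_function (Suc k) (?p k) (\<lambda>i. G (?p k i)) s))\<^sup>2) \<partial>lborel)
      \<le> ennreal ((\<epsilon> k)\<^sup>2 * (b - a))" for k
  proof -
    have p: "is_partition a b (Suc k) (?p k)" by (rule is_partition_uniform[OF ab]) simp
    have close: "norm (G s - step_function (Suc k) (?p k) (\<lambda>i. G (?p k i)) s) \<le> \<epsilon> k" if s: "s \<in> {a<..b}" for s
    proof -
      obtain i where i: "i < Suc k" "s \<in> {?p k i<..?p k (Suc i)}"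
        "step_function (Suc k) (?p k) (\<lambda>i. G (?p k i)) s = G (?p k i)"
        using step_function_value[OF p s] by blast
      have bnd: "a \<le> ?p k i" using is_partition_bounds[OF p, of i] i by simp
      have int: "(G' has_integral G s - G (?p k i)) {?p k i..s}"
        using i s bnd by (intro matrix_increment_eq_integral[OF _ _ _ G]) auto
      have "norm (integral {?p k i..s} G') \<le> (s - ?p k i) * D"
        using i s bnd D by (intro norm_integral_le_const continuous_on_subset[OF G']) auto
      also have "\<dots> \<le> \<epsilon> k"
        unfolding \<epsilon>_def using i uniform_partition_Suc[of a b "Suc k" i] D_nonneg by (intro mult_right_mono) auto
      finally show ?thesis using i(3) integral_unique[OF int] by simp
    qed
    have "(\<integral>\<^sup>+s\<in>{a..b}. ennreal ((norm (G s - step_function (Suc k) (?p k) (\<lambda>i. G (?p k i)) s))\<^sup>2) \<partial>lborel)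
        \<le> (\<integral>\<^sup>+s. ennreal ((\<epsilon> k)\<^sup>2) * indicator {a..b} s \<partial>lborel)"
    proof (rule nn_integral_mono_AE)
      show "AE s in lborel. ennreal ((norm (G s - step_function (Suc k) (?p k) (\<lambda>i. G (?p k i)) s))\<^sup>2) * indicator {a..b} s
          \<le> ennreal ((\<epsilon> k)\<^sup>2) * indicator {a..b} s"
        using AE_lborel_singleton[of a]
      proof eventually_elim
        case (elim s)
        show ?case
        proof (cases "s \<in> {a..b}")
          case True
          with elim have "s \<in> {a<..b}" by auto
          then show ?thesis using True power_mono[OF close norm_ge_zero, of s 2] by (simp add: ennreal_leI)
        qed simp
      qed
    qed
    also have "\<dots> = ennreal ((\<epsilon> k)\<^sup>2 * (b - a))"
      using ab by (simp add: nn_integral_cmult_indicator ennreal_mult)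
    finally show ?thesis .
  qed
  have "(\<lambda>k. D * ((b - a) / real (Suc k))) \<longlonglongrightarrow> D * 0"
    by (intro tendsto_mult tendsto_const LIMSEQ_Suc[OF lim_const_over_n])
  then have "\<epsilon> \<longlonglongrightarrow> 0" by (simp add: \<epsilon>_def[abs_def] mult.commute)
  then have "(\<lambda>k. ennreal ((\<epsilon> k)\<^sup>2 * (b - a))) \<longlonglongrightarrow> ennreal (0\<^sup>2 * (b - a))"
    by (intro tendsto_ennrealI tendsto_intros)
  then have "(\<lambda>k. ennreal ((\<epsilon> k)\<^sup>2 * (b - a))) \<longlonglongrightarrow> 0" by simp
  from tendsto_sandwich[OF _ _ tendsto_const this] show ?thesis
    using le by (auto intro!: always_eventually)
qed

context brownian_motion
begin

lemma stochastic_integral_eq_parts: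
  fixes G :: "real \<Rightarrow> real^'n^'d"
  assumes a: "0 \<le> a" "a \<le> b" and G': "continuous_on {a..b} G'"
    and G: "\<And>s. s \<in> {a..b} \<Longrightarrow> (G has_vector_derivative G' s) (at s within {a..b})"
    and I: "is_stochastic_integral M W a b G I"
  shows "AE \<omega> in M. I \<omega> = G b *v (W b \<omega> - W a \<omega>) - integral {a..b} (\<lambda>s. G' s *v (W s \<omega> - W a \<omega>))"
proof (rule stochastic_integral_eq_limit[OF a(1) I])
  show "is_partition a b (Suc k) (uniform_partition a b (Suc k))" for k
    by (rule is_partition_uniform[OF a(2)]) simp
  show "(\<lambda>k. \<integral>\<^sup>+s\<in>{a..b}. ennreal ((norm (G s - step_function (Suc k) (uniform_partition a b (Suc k))
      (\<lambda>i. G (uniform_partition a b (Suc k) i)) s))\<^sup>2) \<partial>lborel) \<longlonglongrightarrow> 0"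
    by (rule left_point_step_functions_tendsto[OF a(2) G' G])
  show "AE \<omega> in M. (\<lambda>k. step_integral W (Suc k) (uniform_partition a b (Suc k))
      (\<lambda>i. G (uniform_partition a b (Suc k) i)) \<omega>)
      \<longlonglongrightarrow> G b *v (W b \<omega> - W a \<omega>) - integral {a..b} (\<lambda>s. G' s *v (W s \<omega> - W a \<omega>))"
    using continuous_paths
  proof eventually_elim
    case (elim \<omega>)
    have "continuous_on {a..b} (\<lambda>t. W t \<omega> - W a \<omega>)"
      using a by (intro continuous_intros continuous_on_subset[OF elim]) auto
    from left_point_sum_tendsto[OF a(2) this G' G]
    show ?case by (simp add: step_integral_def)
  qed
qed

lemma stochastic_integral_eq_ou_velocity:
  assumes a: "0 \<le> a" "a \<le> t"
    and I: "is_stochastic_integral M W a t (\<lambda>s. matrix_exp (- ((t - s) *\<^sub>R \<Gamma>)) ** \<sigma>) I"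
  shows "AE \<omega> in M. I \<omega> = ou_velocity \<Gamma> \<sigma> (\<lambda>s. W s \<omega>) a t"
proof -
  have deriv: "((\<lambda>s. svv_c0 \<Gamma> (t - s) ** \<sigma>) has_vector_derivative (\<Gamma> ** svv_c0 \<Gamma> (t - s)) ** \<sigma>) (at s within {a..t})" for s
    by (rule bounded_linear.has_vector_derivative[OF mm.bounded_linear_left svv_c0_reversed_derivative])
  have cont: "continuous_on {a..t} (\<lambda>s. (\<Gamma> ** svv_c0 \<Gamma> (t - s)) ** \<sigma>)"
    by (intro bounded_linear.continuous_on[OF mm.bounded_linear_left]
        bounded_linear.continuous_on[OF mm.bounded_linear_right] continuous_intros)
  have "AE \<omega> in M. I \<omega> = (svv_c0 \<Gamma> (t - t) ** \<sigma>) *v (W t \<omega> - W a \<omega>)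
      - integral {a..t} (\<lambda>s. ((\<Gamma> ** svv_c0 \<Gamma> (t - s)) ** \<sigma>) *v (W s \<omega> - W a \<omega>))"
    using I by (intro stochastic_integral_eq_parts[OF a cont deriv]) (simp add: svv_c0_def)
  then show ?thesis
    using continuous_paths
  proof eventually_elim
    case (elim \<omega>)
    have "continuous_on {a..t} (\<lambda>s. W s \<omega>)"
      using a by (intro continuous_on_subset[OF elim(2)]) auto
    then have "integral {a..t} (\<lambda>s. \<Gamma> *v (svv_c0 \<Gamma> (t - s) *v (\<sigma> *v (W s \<omega> - W a \<omega>))))
        = \<Gamma> *v ou_position \<Gamma> \<sigma> (\<lambda>s. W s \<omega>) a t"
      unfolding ou_position_def
      by (intro integral_matrix_vector_mult integrable_continuous_real continuous_intros)
    then show ?case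
      unfolding elim(1) ou_velocity_def by (simp add: svv_c0_0 matrix_vector_mul_assoc matrix_mul_assoc)
  qed
qed

text \<open>For each time the stochastic integral equals the pathwise process almost surely; as both are
  continuous, agreement at rational times suffices for the time integrals to agree.\<close>

lemma integral_stochastic_integral_process_eq_ou_position:
  assumes a: "0 \<le> a" "a < b"
    and J: "is_stochastic_integral_process M W a b (\<lambda>t s. matrix_exp (- ((t - s) *\<^sub>R \<Gamma>)) ** \<sigma>) J"
  shows "AE \<omega> in M. integral {a..b} (\<lambda>t. J t \<omega>) = ou_position \<Gamma> \<sigma> (\<lambda>s. W s \<omega>) a b"
proof -
  have "AE \<omega> in M. \<forall>t\<in>\<rat> \<inter> {a<..<b}. J t \<omega> = ou_velocity \<Gamma> \<sigma> (\<lambda>s. W s \<omega>) a t"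
  proof (subst AE_ball_countable)
    show "countable (\<rat> \<inter> {a<..<b})" using countable_rat by (rule countable_subset[rotated]) auto
    show "\<forall>t\<in>\<rat> \<inter> {a<..<b}. AE \<omega> in M. J t \<omega> = ou_velocity \<Gamma> \<sigma> (\<lambda>s. W s \<omega>) a t"
    proof
      fix t assume t: "t \<in> \<rat> \<inter> {a<..<b}"
      then have "is_stochastic_integral M W a t (\<lambda>s. matrix_exp (- ((t - s) *\<^sub>R \<Gamma>)) ** \<sigma>) (J t)"
        using J unfolding is_stochastic_integral_process_def by simp
      then show "AE \<omega> in M. J t \<omega> = ou_velocity \<Gamma> \<sigma> (\<lambda>s. W s \<omega>) a t"
        using t by (intro stochastic_integral_eq_ou_velocity a(1)) auto
    qed
  qed
  moreover have "AE \<omega> in M. continuous_on {a..b} (\<lambda>t. J t \<omega>)"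
    using J unfolding is_stochastic_integral_process_def by simp
  ultimately show ?thesis
    using continuous_paths
  proof eventually_elim
    case (elim \<omega>)
    have w: "continuous_on {a..b} (\<lambda>s. W s \<omega>)"
      using a by (intro continuous_on_subset[OF elim(3)]) auto
    have closure: "closure (\<rat> \<inter> {a<..<b}) = {a..b}"
    proof -
      have "closure (\<rat> \<inter> {a<..<b}) = closure {a<..<b}"
        using closure_open_Int_superset[of "{a<..<b}" \<rat>] by (simp add: Rats_closure_real Int_commute)
      then show ?thesis using a by simp
    qed
    have "J t \<omega> = ou_velocity \<Gamma> \<sigma> (\<lambda>s. W s \<omega>) a t" if t: "t \<in> {a..b}" for t
    proof -
      have "J t \<omega> - ou_velocity \<Gamma> \<sigma> (\<lambda>s. W s \<omega>) a t = 0"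
        by (rule continuous_constant_on_closure[where S = "\<rat> \<inter> {a<..<b}"
              and f = "\<lambda>t. J t \<omega> - ou_velocity \<Gamma> \<sigma> (\<lambda>s. W s \<omega>) a t"])
          (use elim(1,2) t w closure in \<open>auto intro!: continuous_on_diff continuous_on_ou_velocity\<close>)
      then show ?thesis by simp
    qed
    then have "integral {a..b} (\<lambda>t. J t \<omega>) = integral {a..b} (ou_velocity \<Gamma> \<sigma> (\<lambda>s. W s \<omega>) a)"
      by (intro Henstock_Kurzweil_Integration.integral_cong) auto
    then show ?case using integral_ou_velocity[OF w] a by simp
  qed
qed

end

section \<open>The noise contribution of all steps\<close>

text \<open>The left-point Riemann sum of the midpoint moment. It involves finitely many increments of the path
  from the same time \<open>a\<close>, hence inherits measurability and orthogonality from them.\<close>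

definition sampled_moment :: "(real \<Rightarrow> real^'n) \<Rightarrow> real \<Rightarrow> real \<Rightarrow> nat \<Rightarrow> real^'n" where
  "sampled_moment w a b m = (\<Sum>i<Suc m. ((b - a) / real (Suc m)) *\<^sub>R
     (((a + b) / 2 - uniform_partition a b (Suc m) i) *\<^sub>R (w (uniform_partition a b (Suc m) i) - w a)))"

lemma sampled_moment_tendsto:
  assumes "a \<le> b" "continuous_on {a..b} w"
  shows "sampled_moment w a b \<longlonglongrightarrow> midpoint_moment w a b"
  unfolding sampled_moment_def[abs_def] midpoint_moment_def
  by (intro riemann_sum_tendsto assms continuous_intros)

lemma norm_sum_power2_le:
  fixes z :: "nat \<Rightarrow> 'a::real_normed_vector"
  shows "(norm (\<Sum>i<m. z i))\<^sup>2 \<le> real m * (\<Sum>i<m. (norm (z i))\<^sup>2)"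
proof -
  have "(norm (\<Sum>i<m. z i))\<^sup>2 \<le> (\<Sum>i<m. norm (z i))\<^sup>2"
    by (intro power_mono norm_sum norm_ge_zero)
  also have "\<dots> \<le> (\<Sum>i<m. (norm (z i))\<^sup>2) * real (card {..<m})"
    by (rule sum_squared_le_sum_of_squares)
  finally show ?thesis by (simp add: mult.commute)
qed

lemma uniform_partition_range:
  assumes "a \<le> b" "i < Suc m"
  shows "a \<le> uniform_partition a b (Suc m) i" "uniform_partition a b (Suc m) i \<le> b"
  using is_partition_bounds[OF is_partition_uniform[OF assms(1)], of "Suc m" i] assms(2) by auto

context brownian_motion
begin

lemma sampled_moment_measurable:
  assumes "0 \<le> a" "a \<le> b"
  shows "(\<lambda>\<omega>. sampled_moment (\<lambda>s. W s \<omega>) a b m) \<in> borel_measurable (F b)"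
  unfolding sampled_moment_def
  using uniform_partition_range[OF assms(2)] assms
  by (intro borel_measurable_sum borel_measurable_scaleR borel_measurable_const borel_measurable_diff
      W_measurable_past) (auto intro: order_trans)

lemma sampled_moment_square_integrable:
  assumes "0 \<le> a" "a \<le> b"
  shows "square_integrable M (\<lambda>\<omega>. sampled_moment (\<lambda>s. W s \<omega>) a b m)"
  unfolding sampled_moment_def
  using uniform_partition_range[OF assms(2)] assms
  by (intro square_integrable_sum square_integrable_scaleR increment_square_integrable) auto

text \<open>Order five: two factors \<open>b - a\<close> from the squared kernel, two from the squared length of the
  interval, and one from the variance of the increments.\<close>

lemma sampled_moment_second_moment:
  assumes a: "0 \<le> a" "a \<le> b"
  shows "expectation (\<lambda>\<omega>. (norm (sampled_moment (\<lambda>s. W s \<omega>) a b m))\<^sup>2) \<le> real CARD('n) * (b - a) ^ 5 / 4"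
proof -
  let ?n = "real (Suc m)" and ?h = "b - a"
  define u where "u i = uniform_partition a b (Suc m) i" for i
  have u: "a \<le> u i" "u i \<le> b" if "i < Suc m" for i
    unfolding u_def using uniform_partition_range[OF a(2) that] .
  have h: "0 \<le> ?h" using a by simp
  have int: "integrable M (\<lambda>\<omega>. (norm (W (u i) \<omega> - W a \<omega>))\<^sup>2)" if "i < Suc m" for i
    using a u[OF that] by (intro square_integrableD(2) increment_square_integrable) auto
  have le: "(norm (sampled_moment (\<lambda>s. W s \<omega>) a b m))\<^sup>2
      \<le> ?n * (\<Sum>i<Suc m. (?h / ?n)\<^sup>2 * ((?h / 2)\<^sup>2 * (norm (W (u i) \<omega> - W a \<omega>))\<^sup>2))" for \<omega>
  proof -
    have "(norm (sampled_moment (\<lambda>s. W s \<omega>) a b m))\<^sup>2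
        \<le> ?n * (\<Sum>i<Suc m. (norm ((?h / ?n) *\<^sub>R (((a + b) / 2 - u i) *\<^sub>R (W (u i) \<omega> - W a \<omega>))))\<^sup>2)"
      unfolding sampled_moment_def u_def by (rule norm_sum_power2_le)
    also have "\<dots> \<le> ?n * (\<Sum>i<Suc m. (?h / ?n)\<^sup>2 * ((?h / 2)\<^sup>2 * (norm (W (u i) \<omega> - W a \<omega>))\<^sup>2))"
    proof (intro mult_left_mono sum_mono)
      fix i assume "i \<in> {..<Suc m}"
      then have "\<bar>(a + b) / 2 - u i\<bar> \<le> ?h / 2" using u[of i] by (auto simp: abs_le_iff field_simps)
      then have "((a + b) / 2 - u i)\<^sup>2 \<le> (?h / 2)\<^sup>2"
        using power_mono[of "\<bar>(a + b) / 2 - u i\<bar>" "?h / 2" 2] by simp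
      then show "(norm ((?h / ?n) *\<^sub>R (((a + b) / 2 - u i) *\<^sub>R (W (u i) \<omega> - W a \<omega>))))\<^sup>2
          \<le> (?h / ?n)\<^sup>2 * ((?h / 2)\<^sup>2 * (norm (W (u i) \<omega> - W a \<omega>))\<^sup>2)"
        unfolding norm_scaleR power_mult_distrib power2_abs by (intro mult_left_mono mult_right_mono) auto
    qed simp
    finally show ?thesis .
  qed
  have "expectation (\<lambda>\<omega>. (norm (sampled_moment (\<lambda>s. W s \<omega>) a b m))\<^sup>2)
      \<le> expectation (\<lambda>\<omega>. ?n * (\<Sum>i<Suc m. (?h / ?n)\<^sup>2 * ((?h / 2)\<^sup>2 * (norm (W (u i) \<omega> - W a \<omega>))\<^sup>2)))"
    by (intro integral_mono square_integrableD(2) sampled_moment_square_integrable a le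
        integrable_mult_right Bochner_Integration.integrable_sum int) auto
  also have "\<dots> = ?n * (\<Sum>i<Suc m. (?h / ?n)\<^sup>2 * ((?h / 2)\<^sup>2 * expectation (\<lambda>\<omega>. (norm (W (u i) \<omega> - W a \<omega>))\<^sup>2)))"
  proof -
    have "expectation (\<lambda>\<omega>. \<Sum>i<Suc m. (?h / ?n)\<^sup>2 * ((?h / 2)\<^sup>2 * (norm (W (u i) \<omega> - W a \<omega>))\<^sup>2))
        = (\<Sum>i<Suc m. expectation (\<lambda>\<omega>. (?h / ?n)\<^sup>2 * ((?h / 2)\<^sup>2 * (norm (W (u i) \<omega> - W a \<omega>))\<^sup>2)))"
      by (intro Bochner_Integration.integral_sum integrable_mult_right int) auto
    then show ?thesis by (simp only: integral_mult_right_zero)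
  qed
  also have "\<dots> \<le> ?n * (\<Sum>i<Suc m. (?h / ?n)\<^sup>2 * ((?h / 2)\<^sup>2 * (real CARD('n) * ?h)))"
  proof (intro mult_left_mono sum_mono)
    fix i assume "i \<in> {..<Suc m}"
    then have "expectation (\<lambda>\<omega>. (norm (W (u i) \<omega> - W a \<omega>))\<^sup>2) = real CARD('n) * (u i - a)"
      using a u[of i] by (intro increment_norm2) auto
    also have "\<dots> \<le> real CARD('n) * ?h" using u[of i] \<open>i \<in> _\<close> by (intro mult_left_mono) auto
    finally show "expectation (\<lambda>\<omega>. (norm (W (u i) \<omega> - W a \<omega>))\<^sup>2) \<le> real CARD('n) * ?h" .
  qed auto
  also have "\<dots> = ?n * (?n * ((?h / ?n)\<^sup>2 * ((?h / 2)\<^sup>2 * (real CARD('n) * ?h))))"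
    by (simp only: sum_constant card_lessThan)
  also have "\<dots> = real CARD('n) * ?h ^ 5 / 4"
  proof -
    have "n * (n * ((k / n)\<^sup>2 * ((k / 2)\<^sup>2 * (d * k)))) = d * k ^ 5 / 4" if "n \<noteq> 0" for n k d :: real
      using that by (simp add: power2_eq_square eval_nat_numeral field_simps)
    then show ?thesis by this simp
  qed
  finally show ?thesis .
qed

end

locale langevin_noise = brownian_motion M F W + langevin_coefficients f f' \<Gamma> \<sigma> T B
  for M :: "'w measure" and F and W :: "real \<Rightarrow> 'w \<Rightarrow> real^'n" and f :: "real^'n \<Rightarrow> real^'n"
    and f' \<Gamma> \<sigma> T B +
  fixes x :: "real \<Rightarrow> 'w \<Rightarrow> real^'n"
  assumes x_adapted: "\<And>t. t \<in> {0..T} \<Longrightarrow> x t \<in> borel_measurable (F t)"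
begin

text \<open>The leading noise term of step \<open>j\<close>, with \<open>m + 1\<close> sampling points.\<close>

definition noise :: "real \<Rightarrow> nat \<Rightarrow> nat \<Rightarrow> 'w \<Rightarrow> real^'n" where
  "noise h m j \<omega> = f' (x (real j * h) \<omega>)
     (\<sigma> *v sampled_moment (\<lambda>s. W s \<omega>) (real j * h) (real (Suc j) * h) m)"

lemma f'_expand: "f' y (\<sigma> *v z) = (\<Sum>b\<in>Basis. (z \<bullet> b) *\<^sub>R f' y (\<sigma> *v b))"
proof -
  have lin: "linear (\<lambda>z. f' y (\<sigma> *v z))"
    by (intro bounded_linear.linear bounded_linear_compose[OF blinfun.bounded_linear_right]
        matrix_vector_mul_bounded_linear)
  have "f' y (\<sigma> *v z) = f' y (\<sigma> *v (\<Sum>b\<in>Basis. (z \<bullet> b) *\<^sub>R b))"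
    by (simp only: euclidean_representation)
  also have "\<dots> = (\<Sum>b\<in>Basis. f' y (\<sigma> *v ((z \<bullet> b) *\<^sub>R b)))"
    by (rule linear_sum[OF lin])
  also have "\<dots> = (\<Sum>b\<in>Basis. (z \<bullet> b) *\<^sub>R f' y (\<sigma> *v b))"
    by (simp add: mv.scaleR_right blinfun.scaleR_right)
  finally show ?thesis .
qed

lemma f'x_measurable:
  assumes "t \<in> {0..T}" "Z \<in> borel_measurable (F s)" "t \<le> s"
  shows "(\<lambda>\<omega>. f' (x t \<omega>) (\<sigma> *v Z \<omega>)) \<in> borel_measurable (F s)"
proof -
  have sub: "subalgebra (F s) (F t)"
    using filtration_subalgebra[of s] filtration_subalgebra[of t] filtration_mono[of t s] assms
    by (auto simp: subalgebra_def)
  have [measurable]: "x t \<in> borel_measurable (F s)"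
    using measurable_from_subalg[OF sub x_adapted[OF assms(1)]] .
  have cont: "continuous_on UNIV (\<lambda>y. f' y c)" for c
    by (intro continuous_intros continuous_f')
  have [measurable]: "(\<lambda>\<omega>. f' (x t \<omega>) c) \<in> borel_measurable (F s)" for c
    by (rule borel_measurable_continuous_on[OF cont]) measurable
  have "(\<lambda>\<omega>. f' (x t \<omega>) (\<sigma> *v Z \<omega>)) = (\<lambda>\<omega>. \<Sum>b\<in>Basis. (Z \<omega> \<bullet> b) *\<^sub>R f' (x t \<omega>) (\<sigma> *v b))"
    by (rule ext) (rule f'_expand)
  moreover have "(\<lambda>\<omega>. \<Sum>b\<in>Basis. (Z \<omega> \<bullet> b) *\<^sub>R f' (x t \<omega>) (\<sigma> *v b)) \<in> borel_measurable (F s)"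
    using assms(2) by measurable
  ultimately show ?thesis by (simp only:)
qed

lemma noise_norm_le:
  "norm (noise h m j \<omega>) \<le> B\<^sup>2 * norm (sampled_moment (\<lambda>s. W s \<omega>) (real j * h) (real (Suc j) * h) m)"
proof -
  let ?z = "sampled_moment (\<lambda>s. W s \<omega>) (real j * h) (real (Suc j) * h) m"
  have "norm (noise h m j \<omega>) \<le> B * norm (\<sigma> *v ?z)"
    unfolding noise_def by (rule f'_apply_bound)
  also have "\<dots> \<le> B * (B * norm ?z)" by (intro mult_left_mono \<sigma>_bound B_nonneg)
  finally show ?thesis by (simp add: power2_eq_square)
qed

context
  fixes h :: real and N :: nat
  assumes h: "0 < h" "real N * h = T"
begin

lemma grid: "k \<le> N \<Longrightarrow> real k * h \<in> {0..T}" "real j * h \<le> real (Suc j) * h" "0 \<le> real j * h"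
proof -
  show "real k * h \<in> {0..T}" if "k \<le> N"
    unfolding h(2)[symmetric] using that h(1) by (auto intro!: mult_right_mono)
  show "real j * h \<le> real (Suc j) * h" "0 \<le> real j * h"
    using h(1) by (auto intro!: mult_right_mono)
qed

lemma noise_measurable:
  assumes "k < N" shows "noise h m k \<in> borel_measurable (F (real (Suc k) * h))"
  unfolding noise_def[abs_def] using assms
  by (intro f'x_measurable sampled_moment_measurable grid) simp

lemma noise_square_integrable:
  assumes k: "k < N" shows "square_integrable M (noise h m k)"
proof (rule square_integrable_bounded[OF sampled_moment_square_integrable[OF grid(3,2)] _ noise_norm_le])
  show "noise h m k \<in> borel_measurable M"
    using measurable_from_subalg[OF filtration_subalgebra[OF grid(3)] noise_measurable[OF k]] .
qed

lemma noise_second_moment: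
  assumes k: "k < N"
  shows "expectation (\<lambda>\<omega>. (norm (noise h m k \<omega>))\<^sup>2) \<le> B ^ 4 * (real CARD('n) * h ^ 5 / 4)"
proof -
  let ?z = "\<lambda>\<omega>. sampled_moment (\<lambda>s. W s \<omega>) (real k * h) (real (Suc k) * h) m"
  have "expectation (\<lambda>\<omega>. (norm (noise h m k \<omega>))\<^sup>2) \<le> expectation (\<lambda>\<omega>. B ^ 4 * (norm (?z \<omega>))\<^sup>2)"
  proof (intro integral_mono square_integrableD(2) noise_square_integrable k
      integrable_mult_right sampled_moment_square_integrable grid)
    fix \<omega>
    have "(norm (noise h m k \<omega>))\<^sup>2 \<le> (B\<^sup>2 * norm (?z \<omega>))\<^sup>2"
      by (intro power_mono noise_norm_le norm_ge_zero)
    then show "(norm (noise h m k \<omega>))\<^sup>2 \<le> B ^ 4 * (norm (?z \<omega>))\<^sup>2"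
      by (simp add: power_mult_distrib power_mult[symmetric])
  qed
  also have "\<dots> \<le> B ^ 4 * (real CARD('n) * (real (Suc k) * h - real k * h) ^ 5 / 4)"
    unfolding integral_mult_right_zero
    by (intro mult_left_mono sampled_moment_second_moment grid) (simp add: B_nonneg)
  also have "real (Suc k) * h - real k * h = h" by (simp add: algebra_simps)
  finally show ?thesis .
qed

text \<open>Moving the adapted operator \<open>f' \<circ> \<sigma>\<close> to the other side of the inner product leaves Brownian
  increments tested against a random vector of the past.\<close>

lemma noise_orthogonal:
  assumes k: "k < N" and Y: "Y \<in> borel_measurable (F (real k * h))" "square_integrable M Y"
  shows "expectation (\<lambda>\<omega>. Y \<omega> \<bullet> noise h m k \<omega>) = 0"
proof -
  let ?a = "real k * h" and ?b = "real (Suc k) * h"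
  define R where "R \<omega> = (\<Sum>b\<in>Basis. (Y \<omega> \<bullet> f' (x ?a \<omega>) (\<sigma> *v b)) *\<^sub>R b)" for \<omega>
  have adjoint: "R \<omega> \<bullet> z = Y \<omega> \<bullet> f' (x ?a \<omega>) (\<sigma> *v z)" for z \<omega>
    unfolding f'_expand[of _ z] by (simp add: R_def inner_sum_left inner_sum_right inner_commute mult.commute)
  have meas: "(\<lambda>\<omega>. f' (x ?a \<omega>) (\<sigma> *v b)) \<in> borel_measurable (F ?a)" for b
    using grid k by (intro f'x_measurable borel_measurable_const) auto
  have R_meas: "R \<in> borel_measurable (F ?a)"
    unfolding R_def[abs_def] using Y(1) meas by measurable
  have R_sq: "square_integrable M R"
    unfolding R_def[abs_def]
  proof (rule square_integrable_sum)
    fix b :: "real^'n" assume b: "b \<in> Basis"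
    show "square_integrable M (\<lambda>\<omega>. (Y \<omega> \<bullet> f' (x ?a \<omega>) (\<sigma> *v b)) *\<^sub>R b)"
    proof (rule square_integrable_bounded[OF Y(2)])
      show "(\<lambda>\<omega>. (Y \<omega> \<bullet> f' (x ?a \<omega>) (\<sigma> *v b)) *\<^sub>R b) \<in> borel_measurable M"
      proof (rule measurable_from_subalg[OF filtration_subalgebra[OF grid(3)]])
        show "(\<lambda>\<omega>. (Y \<omega> \<bullet> f' (x ?a \<omega>) (\<sigma> *v b)) *\<^sub>R b) \<in> borel_measurable (F ?a)"
          using Y(1) meas[of b] by measurable
      qed
      fix \<omega>
      have "norm (f' (x ?a \<omega>) (\<sigma> *v b)) \<le> B * (B * norm b)"
        by (rule order_trans[OF f'_apply_bound]) (intro mult_left_mono \<sigma>_bound B_nonneg)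
      then have "\<bar>Y \<omega> \<bullet> f' (x ?a \<omega>) (\<sigma> *v b)\<bar> \<le> norm (Y \<omega>) * (B * B)"
        using b by (intro order_trans[OF Cauchy_Schwarz_ineq2] mult_left_mono) auto
      then show "norm ((Y \<omega> \<bullet> f' (x ?a \<omega>) (\<sigma> *v b)) *\<^sub>R b) \<le> (B * B) * norm (Y \<omega>)"
        using b by (simp add: mult.commute)
    qed
  qed
  define u where "u i = uniform_partition ?a ?b (Suc m) i" for i
  define c where "c i = (?b - ?a) / real (Suc m) * ((?a + ?b) / 2 - u i)" for i
  have u: "?a \<le> u i" if "i < Suc m" for i
    unfolding u_def using uniform_partition_range[OF grid(2) that] by simp
  have "Y \<omega> \<bullet> noise h m k \<omega> = (\<Sum>i<Suc m. c i * (R \<omega> \<bullet> (W (u i) \<omega> - W ?a \<omega>)))" for \<omega>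
    unfolding noise_def adjoint[symmetric] sampled_moment_def u_def[symmetric] c_def
    by (simp only: inner_sum_right inner_scaleR_right mult.assoc)
  then have "expectation (\<lambda>\<omega>. Y \<omega> \<bullet> noise h m k \<omega>)
      = expectation (\<lambda>\<omega>. \<Sum>i<Suc m. c i * (R \<omega> \<bullet> (W (u i) \<omega> - W ?a \<omega>)))" by simp
  also have "\<dots> = (\<Sum>i<Suc m. expectation (\<lambda>\<omega>. c i * (R \<omega> \<bullet> (W (u i) \<omega> - W ?a \<omega>))))"
    using u grid(3)
    by (intro Bochner_Integration.integral_sum integrable_mult_right integrable_inner_square_integrable
        R_sq increment_square_integrable) auto
  also have "\<dots> = 0"
  proof (rule sum.neutral, rule)
    fix i assume "i \<in> {..<Suc m}"
    then have "expectation (\<lambda>\<omega>. R \<omega> \<bullet> (W (u i) \<omega> - W ?a \<omega>)) = 0"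
      using u grid(3) by (intro past_increment R_meas R_sq) auto
    then show "expectation (\<lambda>\<omega>. c i * (R \<omega> \<bullet> (W (u i) \<omega> - W ?a \<omega>))) = 0"
      by (simp only: integral_mult_right_zero)
  qed
  finally show ?thesis .
qed

lemma sampled_noise_maximal:
  "(\<integral>\<^sup>+\<omega>. ennreal ((MAX k\<in>{..N}. norm (\<Sum>j<k. noise h m j \<omega>))\<^sup>2) \<partial>M)
    \<le> ennreal (B ^ 4 * real CARD('n) * T * h ^ 4)"
proof -
  have "(\<integral>\<^sup>+\<omega>. ennreal ((MAX k\<in>{..N}. norm (\<Sum>j<k. noise h m j \<omega>))\<^sup>2) \<partial>M)
      \<le> ennreal (4 * (\<Sum>j<N. expectation (\<lambda>\<omega>. (norm (noise h m j \<omega>))\<^sup>2)))"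
  proof (rule doob_maximal_inequality[where G = "\<lambda>k. F (real k * h)"])
    show "subalgebra M (F (real k * h))" for k
      by (rule filtration_subalgebra[OF grid(3)])
    show "sets (F (real j * h)) \<subseteq> sets (F (real k * h))" if "j \<le> k" for j k
      using that h by (intro filtration_mono mult_right_mono) auto
  qed (use noise_measurable noise_square_integrable noise_orthogonal in auto)
  also have "\<dots> \<le> ennreal (4 * (\<Sum>j<N. B ^ 4 * (real CARD('n) * h ^ 5 / 4)))"
    by (intro ennreal_leI mult_left_mono sum_mono noise_second_moment) auto
  also have "4 * (\<Sum>j<N. B ^ 4 * (real CARD('n) * h ^ 5 / 4)) = B ^ 4 * real CARD('n) * (real N * h) * h ^ 4"
    by (simp add: eval_nat_numeral)
  finally show ?thesis by (simp only: h(2))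
qed

end

end

section \<open>Moments of the limiting quantities\<close>

lemma tendsto_running_max:
  assumes "\<And>k. k \<le> N \<Longrightarrow> (\<lambda>m. s m k) \<longlonglongrightarrow> (t k :: real)"
  shows "(\<lambda>m. running_max (s m) N) \<longlonglongrightarrow> running_max t N"
  using assms by (induction N) (auto intro!: tendsto_max)

text \<open>The lower limit of the sequence is a measurable version of \<open>Z\<close>, and Fatou's lemma bounds its integral.\<close>

lemma fatou_almost_sure_limit:
  fixes X :: "nat \<Rightarrow> 'a \<Rightarrow> real"
  assumes meas: "\<And>m. X m \<in> borel_measurable M"
    and lim: "AE \<omega> in M. (\<lambda>m. X m \<omega>) \<longlonglongrightarrow> Z \<omega>"
    and bound: "\<And>m. (\<integral>\<^sup>+\<omega>. ennreal (X m \<omega>) \<partial>M) \<le> c"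
  obtains Y where "Y \<in> borel_measurable M" "AE \<omega> in M. Y \<omega> = ennreal (Z \<omega>)" "(\<integral>\<^sup>+\<omega>. Y \<omega> \<partial>M) \<le> c"
proof (rule that[of "\<lambda>\<omega>. liminf (\<lambda>m. ennreal (X m \<omega>))"])
  have em: "(\<lambda>\<omega>. ennreal (X m \<omega>)) \<in> borel_measurable M" for m
    using meas[of m] by measurable
  show "(\<lambda>\<omega>. liminf (\<lambda>m. ennreal (X m \<omega>))) \<in> borel_measurable M"
    using em by measurable
  show "AE \<omega> in M. liminf (\<lambda>m. ennreal (X m \<omega>)) = ennreal (Z \<omega>)"
    using lim
  proof eventually_elim
    case (elim \<omega>)
    then have "(\<lambda>m. ennreal (X m \<omega>)) \<longlonglongrightarrow> ennreal (Z \<omega>)" by (rule tendsto_ennrealI)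
    then show ?case by (intro lim_imp_Liminf) auto
  qed
  have "(\<integral>\<^sup>+\<omega>. liminf (\<lambda>m. ennreal (X m \<omega>)) \<partial>M) \<le> liminf (\<lambda>m. \<integral>\<^sup>+\<omega>. ennreal (X m \<omega>) \<partial>M)"
    by (rule nn_integral_liminf) (rule em)
  also have "\<dots> \<le> liminf (\<lambda>m. c)"
    by (intro Liminf_mono always_eventually allI bound)
  finally show "(\<integral>\<^sup>+\<omega>. liminf (\<lambda>m. ennreal (X m \<omega>)) \<partial>M) \<le> c" by (simp add: Liminf_const)
qed

lemma (in brownian_motion) integral_norm2_moment:
  assumes T: "0 < T"
  obtains Y where "Y \<in> borel_measurable M"
    "AE \<omega> in M. Y \<omega> = ennreal (integral {0..T} (\<lambda>t. (norm (W t \<omega> - W 0 \<omega>))\<^sup>2))"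
    "(\<integral>\<^sup>+\<omega>. Y \<omega> \<partial>M) \<le> ennreal (real CARD('n) * T\<^sup>2)"
proof -
  define u where "u m i = uniform_partition 0 T (Suc m) i" for m i
  define X where "X m \<omega> = (\<Sum>i<Suc m. (T / real (Suc m)) * (norm (W (u m i) \<omega> - W 0 \<omega>))\<^sup>2)" for m \<omega>
  have u: "0 \<le> u m i" "u m i \<le> T" if "i < Suc m" for m i
    unfolding u_def using uniform_partition_range[of 0 T i m] T that by auto
  have sq: "square_integrable M (\<lambda>\<omega>. W (u m i) \<omega> - W 0 \<omega>)" if "i < Suc m" for m i
    by (intro increment_square_integrable u that order_refl)
  have int: "integrable M (\<lambda>\<omega>. (T / real (Suc m)) * (norm (W (u m i) \<omega> - W 0 \<omega>))\<^sup>2)" if "i < Suc m" for m i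
    by (intro integrable_mult_right square_integrableD(2) sq that)
  have X_int: "integrable M (X m)" for m
    unfolding X_def[abs_def] by (intro Bochner_Integration.integrable_sum int) simp
  have X_nonneg: "0 \<le> X m \<omega>" for m \<omega>
    unfolding X_def using T by (intro sum_nonneg mult_nonneg_nonneg) auto
  have lim: "AE \<omega> in M. (\<lambda>m. X m \<omega>) \<longlonglongrightarrow> integral {0..T} (\<lambda>t. (norm (W t \<omega> - W 0 \<omega>))\<^sup>2)"
    using continuous_paths
  proof eventually_elim
    case (elim \<omega>)
    have "continuous_on {0..T} (\<lambda>t. (norm (W t \<omega> - W 0 \<omega>))\<^sup>2)"
      using T by (intro continuous_intros continuous_on_subset[OF elim]) auto
    from riemann_sum_tendsto[OF _ this] T show ?case
      by (simp add: X_def[abs_def] u_def)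
  qed
  have bound: "(\<integral>\<^sup>+\<omega>. ennreal (X m \<omega>) \<partial>M) \<le> ennreal (real CARD('n) * T\<^sup>2)" for m
  proof -
    have "(\<integral>\<^sup>+\<omega>. ennreal (X m \<omega>) \<partial>M) = ennreal (expectation (X m))"
      by (intro nn_integral_eq_integral X_int AE_I2 X_nonneg)
    also have "expectation (X m) = (\<Sum>i<Suc m. expectation (\<lambda>\<omega>. (T / real (Suc m)) * (norm (W (u m i) \<omega> - W 0 \<omega>))\<^sup>2))"
      unfolding X_def by (intro Bochner_Integration.integral_sum int) simp
    also have "\<dots> = (\<Sum>i<Suc m. (T / real (Suc m)) * (real CARD('n) * (u m i - 0)))"
      using u by (intro sum.cong refl) (simp only: integral_mult_right_zero increment_norm2 lessThan_iff order_refl)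
    also have "\<dots> \<le> (\<Sum>i<Suc m. (T / real (Suc m)) * (real CARD('n) * T))"
      using u T by (intro sum_mono mult_left_mono) auto
    also have "\<dots> = real (Suc m) * ((T / real (Suc m)) * (real CARD('n) * T))"
      by (simp only: sum_constant card_lessThan)
    also have "\<dots> = real CARD('n) * T\<^sup>2" by (simp add: power2_eq_square)
    finally show ?thesis by (simp add: ennreal_leI)
  qed
  show ?thesis
    by (rule fatou_almost_sure_limit[OF borel_measurable_integrable[OF X_int] lim bound that])
qed

context langevin_noise
begin

lemma noise_maximal:
  assumes h: "0 < h" "real N * h = T"
  obtains Y where "Y \<in> borel_measurable M"
    "AE \<omega> in M. Y \<omega> = ennreal ((MAX k\<in>{..N}. norm (\<Sum>j<k. f' (x (real j * h) \<omega>)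
      (\<sigma> *v midpoint_moment (\<lambda>s. W s \<omega>) (real j * h) (real (Suc j) * h))))\<^sup>2)"
    "(\<integral>\<^sup>+\<omega>. Y \<omega> \<partial>M) \<le> ennreal (B ^ 4 * real CARD('n) * T * h ^ 4)"
proof -
  define S where "S m \<omega> k = norm (\<Sum>j<k. noise h m j \<omega>)" for m \<omega> k
  define S\<^sub>0 where "S\<^sub>0 \<omega> k = norm (\<Sum>j<k. f' (x (real j * h) \<omega>)
      (\<sigma> *v midpoint_moment (\<lambda>s. W s \<omega>) (real j * h) (real (Suc j) * h)))" for \<omega> k
  have noise_meas: "noise h m j \<in> borel_measurable M" if "j < N" for m j
    by (rule square_integrableD(1)[OF noise_square_integrable[OF h that]])
  have meas: "(\<lambda>\<omega>. (running_max (S m \<omega>) N)\<^sup>2) \<in> borel_measurable M" for m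
  proof -
    have "(\<lambda>\<omega>. running_max (S m \<omega>) k) \<in> borel_measurable M" if "k \<le> N" for k
      using that
    proof (induction k)
      case 0
      then show ?case by (simp add: S_def)
    next
      case (Suc k)
      have "(\<lambda>\<omega>. S m \<omega> (Suc k)) \<in> borel_measurable M"
      proof -
        have "(\<lambda>\<omega>. \<Sum>j<Suc k. noise h m j \<omega>) \<in> borel_measurable M"
          using Suc.prems by (intro borel_measurable_sum noise_meas) auto
        then show ?thesis unfolding S_def by measurable
      qed
      then show ?case using Suc by simp
    qed
    from this[of N] show ?thesis by simp
  qed
  have lim: "AE \<omega> in M. (\<lambda>m. (running_max (S m \<omega>) N)\<^sup>2) \<longlonglongrightarrow> (running_max (S\<^sub>0 \<omega>) N)\<^sup>2"
    using continuous_paths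
  proof eventually_elim
    case (elim \<omega>)
    have "(\<lambda>m. noise h m j \<omega>) \<longlonglongrightarrow> f' (x (real j * h) \<omega>)
        (\<sigma> *v midpoint_moment (\<lambda>s. W s \<omega>) (real j * h) (real (Suc j) * h))" for j
    proof -
      have "continuous_on {real j * h..real (Suc j) * h} (\<lambda>s. W s \<omega>)"
        using h(1) by (intro continuous_on_subset[OF elim]) auto
      then have "sampled_moment (\<lambda>s. W s \<omega>) (real j * h) (real (Suc j) * h)
          \<longlonglongrightarrow> midpoint_moment (\<lambda>s. W s \<omega>) (real j * h) (real (Suc j) * h)"
        using h(1) by (intro sampled_moment_tendsto mult_right_mono) auto
      then show ?thesis
        unfolding noise_def
        by (intro bounded_linear.tendsto[OF blinfun.bounded_linear_right]
            bounded_linear.tendsto[OF matrix_vector_mul_bounded_linear])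
    qed
    then show ?case
      unfolding S_def S\<^sub>0_def by (intro tendsto_intros tendsto_running_max)
  qed
  have bound: "(\<integral>\<^sup>+\<omega>. ennreal ((running_max (S m \<omega>) N)\<^sup>2) \<partial>M) \<le> ennreal (B ^ 4 * real CARD('n) * T * h ^ 4)" for m
    using sampled_noise_maximal[OF h, of m] by (simp only: running_max_eq_Max S_def)
  show ?thesis
    by (rule fatou_almost_sure_limit[OF meas lim bound])
      (rule that, simp_all only: running_max_eq_Max S\<^sub>0_def)
qed

end

section \<open>Strong order two\<close>

text \<open>The bound on the second derivative makes \<open>f'\<close> Lipschitz continuous; the sum of the individual bounds
  serves as \<open>B\<close>.\<close>

lemma langevin_coefficients_exist:
  fixes f :: "real^'n \<Rightarrow> real^'n"
  assumes T: "0 < T" and f: "bounded_derivatives2 f" and inv: "invertible \<Gamma>"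
  obtains f' B where "langevin_coefficients f f' \<Gamma> \<sigma> T B"
proof -
  obtain f' :: "real^'n \<Rightarrow> (real^'n) \<Rightarrow>\<^sub>L (real^'n)" and f'' :: "real^'n \<Rightarrow> (real^'n) \<Rightarrow>\<^sub>L ((real^'n) \<Rightarrow>\<^sub>L (real^'n))"
    where f': "\<And>y. (f has_derivative blinfun_apply (f' y)) (at y)"
      and f'': "\<And>y. (f' has_derivative blinfun_apply (f'' y)) (at y)"
      and bdd: "bounded (range f')" "bounded (range f'')"
    using f unfolding bounded_derivatives2_def by blast
  obtain B1 where B1: "\<And>y. norm (f' y) \<le> B1" using bdd(1) by (auto simp: bounded_iff)
  obtain B2 where B2: "\<And>y. norm (f'' y) \<le> B2" using bdd(2) by (auto simp: bounded_iff)
  have lip: "norm (f' y - f' z) \<le> B2 * norm (y - z)" for y z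
    by (rule differentiable_bound[of UNIV]) (auto intro: f'' simp: norm_blinfun.rep_eq[symmetric] B2)
  obtain B3 where B3: "B3 \<ge> 0"
    "\<And>t w. t \<in> {0..T} \<Longrightarrow> norm (svv_c0 \<Gamma> t *v w) \<le> B3 * norm w"
    "\<And>t w. t \<in> {0..T} \<Longrightarrow> norm (svv_c0 \<Gamma> t *v w - w) \<le> B3 * t * norm w"
    "\<And>t w. t \<in> {0..T} \<Longrightarrow> norm (svv_c1 \<Gamma> t *v w) \<le> B3 * t * norm w"
    "\<And>t w. t \<in> {0..T} \<Longrightarrow> norm (svv_c2 \<Gamma> t *v w) \<le> B3 * t\<^sup>2 * norm w"
    using svv_coefficient_bounds[OF inv] by blast
  have on: "norm (A *v z) \<le> onorm ((*v) A) * norm z" for A :: "real^'n^'n" and z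
    by (rule onorm) (rule matrix_vector_mul_bounded_linear)
  have on_pos: "0 \<le> onorm ((*v) A)" for A :: "real^'n^'n"
    by (rule onorm_pos_le) (rule matrix_vector_mul_bounded_linear)
  define B where "B = 1 + B1 + B2 + B3 + norm (f 0) + onorm ((*v) \<Gamma>) + onorm ((*v) \<sigma>)"
  have "0 \<le> B1" "0 \<le> B2" using B1 B2 norm_ge_zero order_trans by blast+
  then have le: "1 \<le> B" "B1 \<le> B" "B2 \<le> B" "B3 \<le> B" "norm (f 0) \<le> B" "onorm ((*v) \<Gamma>) \<le> B" "onorm ((*v) \<sigma>) \<le> B"
    using B3(1) on_pos[of \<Gamma>] on_pos[of \<sigma>] norm_ge_zero[of "f 0"] unfolding B_def by linarith+
  have up: "y \<le> B * z" if "y \<le> b * z" "b \<le> B" "0 \<le> z" for y z b :: real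
    using that mult_right_mono order_trans by blast
  have "langevin_coefficients f f' \<Gamma> \<sigma> T B"
  proof
    show "norm (f' y - f' z) \<le> B * norm (y - z)" for y z
      by (rule up[OF lip le(3)]) simp
    show "norm (\<Gamma> *v z) \<le> B * norm z" "norm (\<sigma> *v z) \<le> B * norm z" for z
      by (rule up[OF on le(6)] up[OF on le(7)], simp)+
    fix t z assume t: "t \<in> {0..T}"
    show "norm (svv_c0 \<Gamma> t *v z) \<le> B * norm z" by (rule up[OF B3(2)[OF t] le(4)]) simp
    show "norm (svv_c0 \<Gamma> t *v z - z) \<le> B * t * norm z" "norm (svv_c1 \<Gamma> t *v z) \<le> B * t * norm z"
      "norm (svv_c2 \<Gamma> t *v z) \<le> B * t\<^sup>2 * norm z"
      using up[of _ B3 "t * norm z"] up[of _ B3 "t\<^sup>2 * norm z"] B3(3-5)[OF t] le(4) t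
      by (simp_all add: mult.assoc)
  qed (use T inv f' B1 le in \<open>auto intro: order_trans\<close>)
  then show ?thesis by (rule that)
qed

theorem theorem3p3:
  fixes M :: "'w measure" and F :: "real \<Rightarrow> 'w measure"
    and W :: "real \<Rightarrow> 'w \<Rightarrow> real^'n"
    and f :: "real^'n \<Rightarrow> real^'n" and \<Gamma> \<sigma> :: "real^'n^'n"
    and k\<^sub>B \<Theta> T :: real
    and x v :: "real \<Rightarrow> 'w \<Rightarrow> real^'n"
    and X V :: "real \<Rightarrow> nat \<Rightarrow> 'w \<Rightarrow> real^'n"
  assumes "0 < T"
    and "brownian_motion M F W"
    and "bounded_derivatives2 f"
    and "invertible \<Gamma>"
    and "\<sigma> ** transpose \<sigma> = (2 * k\<^sub>B * \<Theta>) *\<^sub>R \<Gamma>"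
    and "langevin_solution M F W T f \<Gamma> \<sigma> x v"
    and "integrable M (\<lambda>\<omega>. (norm (x 0 \<omega>, v 0 \<omega>))\<^sup>2)"
    and "\<And>h N. 0 < h \<Longrightarrow> real N * h = T \<Longrightarrow>
           svv_algorithm M W f \<Gamma> \<sigma> (x 0) (v 0) h N (X h) (V h)"
  shows "strong_order M T (\<lambda>t \<omega>. (x t \<omega>, v t \<omega>)) (\<lambda>h k \<omega>. (X h k \<omega>, V h k \<omega>)) 2"
proof -
  interpret brownian_motion M F W by fact
  obtain f' B where coeff: "langevin_coefficients f f' \<Gamma> \<sigma> T B"
    using langevin_coefficients_exist assms by metis
  interpret langevin_coefficients f f' \<Gamma> \<sigma> T B by fact
  interpret langevin_noise M F W f f' \<Gamma> \<sigma> T B x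
    using assms(6) by unfold_locales (auto simp: langevin_solution_def)
  have path: "AE \<omega> in M. langevin_path f f' \<Gamma> \<sigma> T B (\<lambda>t. x t \<omega>) (\<lambda>t. v t \<omega>) (\<lambda>t. W t \<omega>)"
  proof -
    have "AE \<omega> in M. continuous_on {0..T} (\<lambda>t. x t \<omega>) \<and> continuous_on {0..T} (\<lambda>t. v t \<omega>) \<and>
        (\<forall>t\<in>{0..T}. x t \<omega> = x 0 \<omega> + integral {0..t} (\<lambda>s. v s \<omega>) \<and>
           v t \<omega> = v 0 \<omega> + integral {0..t} (\<lambda>s. f (x s \<omega>)) - integral {0..t} (\<lambda>s. \<Gamma> *v v s \<omega>)
                  + \<sigma> *v (W t \<omega> - W 0 \<omega>))"
      using assms(6) by (simp add: langevin_solution_def)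
    then show ?thesis
      using continuous_paths
    proof eventually_elim
      case (elim \<omega>)
      have "continuous_on {0..T} (\<lambda>t. W t \<omega>)"
        by (rule continuous_on_subset[OF elim(2)]) auto
      moreover note bspec[OF conjunct2[OF conjunct2[OF elim(1)]]]
      ultimately show ?case
        using conjunct1[OF elim(1)] conjunct1[OF conjunct2[OF elim(1)]]
        by (intro langevin_path.intro coeff langevin_path_axioms.intro; (assumption | simp only:))
    qed
  qed
  define m\<^sub>0 where "m\<^sub>0 = expectation (\<lambda>\<omega>. (norm (x 0 \<omega>, v 0 \<omega>))\<^sup>2)"
  have m\<^sub>0: "(\<integral>\<^sup>+\<omega>. ennreal ((norm (x 0 \<omega>, v 0 \<omega>))\<^sup>2) \<partial>M) = ennreal m\<^sub>0" "0 \<le> m\<^sub>0"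
    unfolding m\<^sub>0_def by (intro nn_integral_eq_integral assms(7)) auto
  obtain R where R: "R \<in> borel_measurable M"
    "AE \<omega> in M. R \<omega> = ennreal (integral {0..T} (\<lambda>t. (norm (W t \<omega> - W 0 \<omega>))\<^sup>2))"
    "(\<integral>\<^sup>+\<omega>. R \<omega> \<partial>M) \<le> ennreal (real CARD('n) * T\<^sup>2)"
    by (rule integral_norm2_moment[OF assms(1)]) (rule that)
  define E where "E = 2 * exp (12 * B\<^sup>2 * T)"
  define K where "K = exp ((2 * T + 9 * B\<^sup>2 * T) * T)"
  have EK: "0 \<le> E" "0 \<le> K" by (auto simp: E_def K_def)
  have T: "0 \<le> T" using assms(1) by simp
  define C where "C = E / 2 + E * 5 * B\<^sup>2 * K * T + E / 2 * (B ^ 4 * real CARD('n) * T)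
    + E * 5 * B\<^sup>2 * K * T * 3 * m\<^sub>0 + E * 5 * B\<^sup>2 * K * (3 * B\<^sup>2) * (real CARD('n) * T\<^sup>2)"
  show ?thesis
    unfolding strong_order_def
  proof (intro exI conjI allI impI)
    \<comment> \<open>the restriction on the step size under which \<open>global_error\<close> holds\<close>
    show "0 < 1 / (12 * B\<^sup>2)" using B_ge_1 by simp
    fix h N assume h': "0 < h \<and> h < 1 / (12 * B\<^sup>2) \<and> real N * h = T"
    then have h: "0 < h" "real N * h = T" by auto
    have hB: "12 * B\<^sup>2 * h \<le> 1" using h' B_ge_1 by (auto simp: field_simps)
    obtain Y where Y: "Y \<in> borel_measurable M"
      "AE \<omega> in M. Y \<omega> = ennreal ((MAX k\<in>{..N}. norm (\<Sum>j<k. f' (x (real j * h) \<omega>)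
        (\<sigma> *v midpoint_moment (\<lambda>s. W s \<omega>) (real j * h) (real (Suc j) * h))))\<^sup>2)"
      "(\<integral>\<^sup>+\<omega>. Y \<omega> \<partial>M) \<le> ennreal (B ^ 4 * real CARD('n) * T * h ^ 4)"
      by (rule noise_maximal[OF h]) (rule that)
    have alg: "svv_algorithm M W f \<Gamma> \<sigma> (x 0) (v 0) h N (X h) (V h)"
      by (rule assms(8)[OF h])
    have steps: "AE \<omega> in M. \<forall>k\<in>{..<N}.
        X h (Suc k) \<omega> = position_step h (X h k \<omega>) (V h k \<omega>)
          (ou_position \<Gamma> \<sigma> (\<lambda>s. W s \<omega>) (real k * h) (real (Suc k) * h)) \<and>
        V h (Suc k) \<omega> = velocity_step h (X h k \<omega>) (X h (Suc k) \<omega>) (V h k \<omega>)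
          (ou_velocity \<Gamma> \<sigma> (\<lambda>s. W s \<omega>) (real k * h) (real (Suc k) * h))"
    proof (subst AE_ball_countable, simp, rule)
      fix k assume "k \<in> {..<N}"
      then have k: "k < N" by simp
      let ?a = "real k * h" and ?b = "real (Suc k) * h"
      have ab: "0 \<le> ?a" "?a < ?b" using h(1) by auto
      obtain J I where J: "is_stochastic_integral_process M W ?a ?b (\<lambda>t s. matrix_exp (- ((t - s) *\<^sub>R \<Gamma>)) ** \<sigma>) J"
        and I: "is_stochastic_integral M W ?a ?b (\<lambda>s. matrix_exp (- ((?b - s) *\<^sub>R \<Gamma>)) ** \<sigma>) I"
        and step: "AE \<omega> in M. X h (Suc k) \<omega> = X h k \<omega> + svv_c1 \<Gamma> h *v V h k \<omega> + svv_c2 \<Gamma> h *v f (X h k \<omega>)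
              + integral {?a..?b} (\<lambda>t. J t \<omega>) \<and>
            V h (Suc k) \<omega> = svv_c0 \<Gamma> h *v V h k \<omega> + svv_c1 \<Gamma> h *v f (X h k \<omega>)
              + ((1 / h) *\<^sub>R svv_c2 \<Gamma> h) *v (f (X h (Suc k) \<omega>) - f (X h k \<omega>)) + I \<omega>"
        using alg k unfolding svv_algorithm_def Let_def by blast
      from step integral_stochastic_integral_process_eq_ou_position[OF ab J]
        stochastic_integral_eq_ou_velocity[OF ab(1) less_imp_le[OF ab(2)] I]
      show "AE \<omega> in M. X h (Suc k) \<omega> = position_step h (X h k \<omega>) (V h k \<omega>)
          (ou_position \<Gamma> \<sigma> (\<lambda>s. W s \<omega>) (real k * h) (real (Suc k) * h)) \<and>
        V h (Suc k) \<omega> = velocity_step h (X h k \<omega>) (X h (Suc k) \<omega>) (V h k \<omega>)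
          (ou_velocity \<Gamma> \<sigma> (\<lambda>s. W s \<omega>) (real k * h) (real (Suc k) * h))"
        by eventually_elim (simp add: position_step_def velocity_step_def)
    qed
    have init: "AE \<omega> in M. X h 0 \<omega> = x 0 \<omega> \<and> V h 0 \<omega> = v 0 \<omega>"
      using alg unfolding svv_algorithm_def by blast
    let ?err = "\<lambda>\<omega>. MAX k\<in>{..N}. norm ((x (real k * h) \<omega>, v (real k * h) \<omega>) - (X h k \<omega>, V h k \<omega>))"
    define G where "G = E * 5 * B\<^sup>2 * h\<^sup>2 * K"
    define a\<^sub>0 where "a\<^sub>0 = E * h\<^sup>2 / 2 + G * T"
    define a\<^sub>1 where "a\<^sub>1 = E / (2 * h\<^sup>2)"
    define a\<^sub>2 where "a\<^sub>2 = G * T * 3"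
    define a\<^sub>3 where "a\<^sub>3 = G * (3 * B\<^sup>2)"
    have G: "0 \<le> G" using EK by (simp add: G_def)
    have a: "0 \<le> a\<^sub>0" "0 \<le> a\<^sub>1" "0 \<le> a\<^sub>2" "0 \<le> a\<^sub>3"
      unfolding a\<^sub>0_def a\<^sub>1_def a\<^sub>2_def a\<^sub>3_def using EK T G by auto
    have "AE \<omega> in M. ennreal (?err \<omega>) \<le> ennreal a\<^sub>0 + ennreal a\<^sub>1 * Y \<omega>
        + ennreal a\<^sub>2 * ennreal ((norm (x 0 \<omega>, v 0 \<omega>))\<^sup>2) + ennreal a\<^sub>3 * R \<omega>"
      using path steps init Y(2) R(2)
    proof eventually_elim
      case (elim \<omega>)
      interpret langevin_path f f' \<Gamma> \<sigma> T B "\<lambda>t. x t \<omega>" "\<lambda>t. v t \<omega>" "\<lambda>t. W t \<omega>" by (rule elim(1))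
      define D where "D = (MAX k\<in>{..N}. norm (\<Sum>j<k. f' (x (real j * h) \<omega>)
        (\<sigma> *v midpoint_moment (\<lambda>s. W s \<omega>) (real j * h) (real (Suc j) * h))))"
      define I where "I = integral {0..T} (\<lambda>t. (norm (W t \<omega> - W 0 \<omega>))\<^sup>2)"
      have I: "0 \<le> I"
        unfolding I_def by (intro integral_nonneg integrable_continuous_real continuous_intros cont_w) auto
      define z where "z = (norm (x 0 \<omega>, v 0 \<omega>))\<^sup>2"
      have z: "z = (norm (x 0 \<omega>))\<^sup>2 + (norm (v 0 \<omega>))\<^sup>2"
        by (simp add: z_def norm_Pair)
      have q: "integral {0..T} energy \<le> K * (T * (1 + 3 * z) + 3 * B\<^sup>2 * I)"
        using integral_energy_le unfolding K_def I_def z by (simp add: algebra_simps)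
      have "?err \<omega> \<le> E * (D + 5 * B\<^sup>2 * h\<^sup>2 * integral {0..T} energy)"
      proof (rule Max.boundedI)
        fix r assume "r \<in> (\<lambda>k. norm ((x (real k * h) \<omega>, v (real k * h) \<omega>) - (X h k \<omega>, V h k \<omega>))) ` {..N}"
        then obtain k where k: "k \<le> N"
          and r: "r = norm (x (real k * h) \<omega> - X h k \<omega>, v (real k * h) \<omega> - V h k \<omega>)" by auto
        show "r \<le> E * (D + 5 * B\<^sup>2 * h\<^sup>2 * integral {0..T} energy)"
          unfolding r E_def
        proof (rule global_error[OF h hB _ _ _ _ _ k, where X = "\<lambda>k. X h k \<omega>" and V = "\<lambda>k. V h k \<omega>"])
          show "norm (\<Sum>j<k. f' (x (real j * h) \<omega>)
              (\<sigma> *v midpoint_moment (\<lambda>t. W t \<omega>) (real j * h) (real (Suc j) * h))) \<le> D" if "k \<le> N" for k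
            unfolding D_def using that by (intro Max_ge) auto
        qed (use elim(2,3) in auto)
      qed auto
      also have "\<dots> \<le> E * (D + 5 * B\<^sup>2 * h\<^sup>2 * (K * (T * (1 + 3 * z) + 3 * B\<^sup>2 * I)))"
        by (intro mult_left_mono add_left_mono q) (use EK in auto)
      also have "\<dots> = E * D + G * (T * (1 + 3 * z) + 3 * B\<^sup>2 * I)"
        by (simp add: G_def algebra_simps)
      \<comment> \<open>\<open>D\<close> has size \<open>h\<^sup>2\<close>, which dictates the weights in Young's inequality.\<close>
      also have "E * D \<le> E * (h\<^sup>2 / 2 + D\<^sup>2 / (2 * h\<^sup>2))"
      proof (rule mult_left_mono)
        have "0 \<le> (h\<^sup>2 - D)\<^sup>2 / (2 * h\<^sup>2)" by simp
        also have "\<dots> = h\<^sup>2 / 2 - D + D\<^sup>2 / (2 * h\<^sup>2)"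
          using h(1) by (simp add: power2_diff field_simps power2_eq_square)
        finally show "D \<le> h\<^sup>2 / 2 + D\<^sup>2 / (2 * h\<^sup>2)" by simp
      qed (rule EK)
      also have "E * (h\<^sup>2 / 2 + D\<^sup>2 / (2 * h\<^sup>2)) + G * (T * (1 + 3 * z) + 3 * B\<^sup>2 * I)
          = a\<^sub>0 + a\<^sub>1 * D\<^sup>2 + a\<^sub>2 * z + a\<^sub>3 * I"
        by (simp add: a\<^sub>0_def a\<^sub>1_def a\<^sub>2_def a\<^sub>3_def algebra_simps)
      finally have "?err \<omega> \<le> a\<^sub>0 + a\<^sub>1 * D\<^sup>2 + a\<^sub>2 * z + a\<^sub>3 * I" by simp
      then have "ennreal (?err \<omega>) \<le> ennreal (a\<^sub>0 + a\<^sub>1 * D\<^sup>2 + a\<^sub>2 * z + a\<^sub>3 * I)"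
        by (rule ennreal_leI)
      also have "\<dots> = ennreal a\<^sub>0 + ennreal a\<^sub>1 * ennreal (D\<^sup>2) + ennreal a\<^sub>2 * ennreal z + ennreal a\<^sub>3 * ennreal I"
      proof -
        have "0 \<le> z" by (simp add: z_def)
        then show ?thesis using a I by (simp add: ennreal_plus ennreal_mult)
      qed
      finally show ?case using elim(4,5) by (simp only: D_def I_def z_def)
    qed
    then have "(\<integral>\<^sup>+\<omega>. ennreal (?err \<omega>) \<partial>M) \<le> (\<integral>\<^sup>+\<omega>. ennreal a\<^sub>0 + ennreal a\<^sub>1 * Y \<omega>
        + ennreal a\<^sub>2 * ennreal ((norm (x 0 \<omega>, v 0 \<omega>))\<^sup>2) + ennreal a\<^sub>3 * R \<omega> \<partial>M)"
      by (rule nn_integral_mono_AE)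
    also have "\<dots> = ennreal a\<^sub>0 + ennreal a\<^sub>1 * (\<integral>\<^sup>+\<omega>. Y \<omega> \<partial>M)
        + ennreal a\<^sub>2 * (\<integral>\<^sup>+\<omega>. ennreal ((norm (x 0 \<omega>, v 0 \<omega>))\<^sup>2) \<partial>M) + ennreal a\<^sub>3 * (\<integral>\<^sup>+\<omega>. R \<omega> \<partial>M)"
    proof -
      note [measurable] = Y(1) R(1) borel_measurable_integrable[OF assms(7)]
      show ?thesis by (simp add: nn_integral_add nn_integral_cmult emeasure_space_1)
    qed
    also have "\<dots> \<le> ennreal a\<^sub>0 + ennreal a\<^sub>1 * ennreal (B ^ 4 * real CARD('n) * T * h ^ 4)
        + ennreal a\<^sub>2 * ennreal m\<^sub>0 + ennreal a\<^sub>3 * ennreal (real CARD('n) * T\<^sup>2)"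
      unfolding m\<^sub>0(1) by (intro add_mono mult_left_mono Y(3) R(3) order_refl) auto
    also have "\<dots> = ennreal (a\<^sub>0 + a\<^sub>1 * (B ^ 4 * real CARD('n) * T * h ^ 4) + a\<^sub>2 * m\<^sub>0 + a\<^sub>3 * (real CARD('n) * T\<^sup>2))"
      using a m\<^sub>0(2) T B_nonneg h(1) by (simp add: ennreal_plus ennreal_mult)
    also have "a\<^sub>0 + a\<^sub>1 * (B ^ 4 * real CARD('n) * T * h ^ 4) + a\<^sub>2 * m\<^sub>0 + a\<^sub>3 * (real CARD('n) * T\<^sup>2) = C * h powr 2"
    proof -
      have "a\<^sub>1 * (B ^ 4 * real CARD('n) * T * h ^ 4) = E / 2 * (B ^ 4 * real CARD('n) * T) * h\<^sup>2"
        using h(1) by (simp add: a\<^sub>1_def eval_nat_numeral)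
      moreover have "h powr 2 = h\<^sup>2" using h(1) by simp
      ultimately show ?thesis
        unfolding C_def a\<^sub>0_def a\<^sub>2_def a\<^sub>3_def G_def by (simp add: algebra_simps)
    qed
    finally show "(\<integral>\<^sup>+\<omega>. ennreal (?err \<omega>) \<partial>M) \<le> ennreal (C * h powr 2)" .
  qed
qed

end
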